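(* Let $(A,\alpha,L)$ be an Exel system, let $A\rtimes_{\alpha,L}\mathbb{N}$ be its Exel crossed product with canonical maps $j:A\to A\rtimes_{\alpha,L}\mathbb{N}$ and $t\in M(A\rtimes_{\alpha,L}\mathbb{N})$, and let $\hat\alpha$ be the dual action of $\mathbb{T}$. Then there is an injective endomorphism $\beta$ of the fixed-point algebra $(A\rtimes_{\alpha,L}\mathbb{N})^{\hat\alpha}$ such that $$\beta\big(j(a)t^it^{*i}j(b)\big)=j(\alpha(a))\,t^{i+1}t^{*(i+1)}\,j(\alpha(b))\qquad(a,b\in A,\ i\in\mathbb{N}).$$ The endomorphism $\beta$ is extendible with $\overline{\beta}(1)=tt^*$ and has range $tt^*(A\rtimes_{\alpha,L}\mathbb{N})^{\hat\alpha}tt^*$. Writing $\operatorname{id}$ for the inclusion of $(A\rtimes_{\alpha,L}\mathbb{N})^{\hat\alpha}$ in $A\rtimes_{\alpha,L}\mathbb{N}$, the pair $(\operatorname{id},t)$ is a Stacey-covariant representation of $\big((A\rtimes_{\alpha,L}\mathbb{N})^{\hat\alpha},\beta\big)$, and $\operatorname{id}\times t$ is an isomorphism of the Stacey crossed product $(A\rtimes_{\alpha,L}\mathbb{N})^{\hat\alpha}\times_\beta\mathbb{N}$ onto the Exel crossed product $A\rtimes_{\alpha,L}\mathbb{N}$.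
   Context: Here $\mathbb{N}=\{0,1,2,\dots\}$ and $M(A)$ is the multiplier algebra of $A$. An endomorphism $\alpha$ of a $C^*$-algebra $A$ is extendible if it extends to a strictly continuous endomorphism $\overline{\alpha}$ of $M(A)$. An Exel system $(A,\alpha,L)$ consists of a $C^*$-algebra $A$ (not necessarily unital), an extendible endomorphism $\alpha$ of $A$, and a positive linear map $L:A\to A$ (a transfer operator) which extends to a positive linear map $\overline{L}:M(A)\to M(A)$ such that $L(\alpha(a)m)=a\overline{L}(m)$ for $a\in A$, $m\in M(A)$, and $\overline{L}(1)=1$. The bimodule $M_L$: give $A$ the bimodule structure $a\cdot m=am$, $m\cdot b=m\alpha(b)$ and the pre-inner product $\langle m,n\rangle=L(m^*n)$; modding out by elements of norm $0$ and completing gives a right-Hilbert $A$--$A$ bimodule $M_L$. Write $q:A\to M_L$ for the canonical map and $\phi:A\to\mathcal{L}(M_L)$ for the left action. A representation $(\psi,\pi)$ of $M_L$ in a $C^*$-algebra $B$ consists of a linear map $\psi:M_L\to B$ and a homomorphism $\pi:A\to B$ with $\psi(m\cdot a)=\psi(m)\pi(a)$, $\psi(m)^*\psi(n)=\pi(\langle m,n\rangle)$, $\psi(a\cdot m)=\pi(a)\psi(m)$; it induces a homomorphism $(\psi,\pi)^{(1)}:\mathcal{K}(M_L)\to B$ with $(\psi,\pi)^{(1)}(\Theta_{m,n})=\psi(m)\psi(n)^*$, where $\Theta_{m,n}(p)=m\cdot\langle n,p\rangle$. A Toeplitz-covariant representation of $(A,\alpha,L)$ in $B$ consists of a nondegenerate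 homomorphism $\pi:A\to B$ and $S\in M(B)$ with $S\pi(a)=\pi(\alpha(a))S$ and $S^*\pi(a)S=\pi(L(a))$ for $a\in A$. The Toeplitz crossed product $\mathcal{T}(A,\alpha,L)$ is generated (by $i(A)\cup i(A)s$) by a universal Toeplitz-covariant representation $(i,s)$. There is a map $\psi_s:M_L\to\mathcal{T}(A,\alpha,L)$ with $\psi_s(q(a))=i(a)s$, and $(\psi_s,i)$ is a representation of $M_L$. Let $K_\alpha:=\overline{A\alpha(A)A}\cap\phi^{-1}(\mathcal{K}(M_L))$, where $\overline{A\alpha(A)A}$ is the closed linear span. The Exel crossed product $A\rtimes_{\alpha,L}\mathbb{N}$ is the quotient of $\mathcal{T}(A,\alpha,L)$ by the ideal generated by $\{i(a)-(\psi_s,i)^{(1)}(\phi(a)):a\in K_\alpha\}$. With $\mathcal{Q}$ the quotient map, $j:=\mathcal{Q}\circ i$ and $t:=\overline{\mathcal{Q}}(s)\in M(A\rtimes_{\alpha,L}\mathbb{N})$. The dual action $\hat\alpha$ of $\mathbb{T}$ satisfies $\hat\alpha_z(j(a))=j(a)$ and $\hat\alpha_z(t)=zt$. Moreover $(A\rtimes_{\alpha,L}\mathbb{N})^{\hat\alpha}=\overline{\operatorname{span}}\{j(a)t^it^{*i}j(b):a,b\in A,\ i\in\mathbb{N}\}$. A Stacey-covariant representation of a pair $(C,\beta)$ ($\beta$ an endomorphism of a $C^*$-algebra $C$) in a $C^*$-algebra $D$ consists of a nondegenerate homomorphism $\pi:C\to D$ and an isometry $W\in M(D)$ with $\pi(\beta(c))=W\pi(c)W^*$.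 The Stacey crossed product $C\times_\beta\mathbb{N}$ is generated by a universal Stacey-covariant representation $(i_C,v)$; $\pi\times W$ denotes the nondegenerate homomorphism of $C\times_\beta\mathbb{N}$ into $D$ with $(\pi\times W)\circ i_C=\pi$ and (on multipliers) $(\pi\times W)(v)=W$. *)

theory Defs
  imports "HOL-Analysis.Analysis"
begin

section \<open>Complex Banach spaces and C*-algebras with explicit carriers\<close>

record 'a cspace =
  car :: "'a set"
  zer :: 'a
  add :: "'a \<Rightarrow> 'a \<Rightarrow> 'a"
  scl :: "complex \<Rightarrow> 'a \<Rightarrow> 'a"
  nrm :: "'a \<Rightarrow> real"

record 'a cstar = "'a cspace" +
  mul :: "'a \<Rightarrow> 'a \<Rightarrow> 'a"  (infixl \<open>\<cdot>\<index>\<close> 70)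
  star :: "'a \<Rightarrow> 'a"

definition sub :: "('a, 'r) cspace_scheme \<Rightarrow> 'a \<Rightarrow> 'a \<Rightarrow> 'a" where
  "sub V x y = add V x (scl V (-1) y)"

text \<open>The library's \<^locale>\<open>Metric_space\<close> asks for symmetry and nonnegativity on the whole type,
  hence the default value off the carrier.\<close>

definition dst :: "('a, 'r) cspace_scheme \<Rightarrow> 'a \<Rightarrow> 'a \<Rightarrow> real" where
  "dst V x y = (if x \<in> car V \<and> y \<in> car V then nrm V (sub V x y) else 0)"

definition norm_top :: "('a, 'r) cspace_scheme \<Rightarrow> 'a topology" where
  "norm_top V = Metric_space.mtopology (car V) (dst V)"

locale complex_banach =
  fixes V :: "('a, 'r) cspace_scheme"
  assumes zer_closed: "zer V \<in> car V"
    and add_closed: "\<lbrakk>x \<in> car V; y \<in> car V\<rbrakk> \<Longrightarrow> add V x y \<in> car V"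
    and scl_closed: "x \<in> car V \<Longrightarrow> scl V c x \<in> car V"
    and add_assoc: "\<lbrakk>x \<in> car V; y \<in> car V; z \<in> car V\<rbrakk>
      \<Longrightarrow> add V (add V x y) z = add V x (add V y z)"
    and add_commute: "\<lbrakk>x \<in> car V; y \<in> car V\<rbrakk> \<Longrightarrow> add V x y = add V y x"
    and add_zero: "x \<in> car V \<Longrightarrow> add V x (zer V) = x"
    and add_neg: "x \<in> car V \<Longrightarrow> add V x (scl V (-1) x) = zer V"
    and scl_add_right: "\<lbrakk>x \<in> car V; y \<in> car V\<rbrakk>
      \<Longrightarrow> scl V c (add V x y) = add V (scl V c x) (scl V c y)"
    and scl_add_left: "x \<in> car V \<Longrightarrow> scl V (c + d) x = add V (scl V c x) (scl V d x)"
    and scl_scl: "x \<in> car V \<Longrightarrow> scl V c (scl V d x) = scl V (c * d) x"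
    and scl_one: "x \<in> car V \<Longrightarrow> scl V 1 x = x"
    and nrm_nonneg: "x \<in> car V \<Longrightarrow> 0 \<le> nrm V x"
    and nrm_eq_zero: "x \<in> car V \<Longrightarrow> nrm V x = 0 \<longleftrightarrow> x = zer V"
    and nrm_triangle: "\<lbrakk>x \<in> car V; y \<in> car V\<rbrakk> \<Longrightarrow> nrm V (add V x y) \<le> nrm V x + nrm V y"
    and nrm_scl: "x \<in> car V \<Longrightarrow> nrm V (scl V c x) = cmod c * nrm V x"
    and complete: "Metric_space.mcomplete (car V) (dst V)"

locale cstar_algebra = complex_banach A for A :: "'a cstar" +
  assumes mul_closed: "\<lbrakk>x \<in> car A; y \<in> car A\<rbrakk> \<Longrightarrow> x \<cdot>\<^bsub>A\<^esub> y \<in> car A"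
    and mul_assoc: "\<lbrakk>x \<in> car A; y \<in> car A; z \<in> car A\<rbrakk>
      \<Longrightarrow> (x \<cdot>\<^bsub>A\<^esub> y) \<cdot>\<^bsub>A\<^esub> z = x \<cdot>\<^bsub>A\<^esub> (y \<cdot>\<^bsub>A\<^esub> z)"
    and mul_add_left: "\<lbrakk>x \<in> car A; y \<in> car A; z \<in> car A\<rbrakk>
      \<Longrightarrow> add A x y \<cdot>\<^bsub>A\<^esub> z = add A (x \<cdot>\<^bsub>A\<^esub> z) (y \<cdot>\<^bsub>A\<^esub> z)"
    and mul_add_right: "\<lbrakk>x \<in> car A; y \<in> car A; z \<in> car A\<rbrakk>
      \<Longrightarrow> x \<cdot>\<^bsub>A\<^esub> add A y z = add A (x \<cdot>\<^bsub>A\<^esub> y) (x \<cdot>\<^bsub>A\<^esub> z)"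
    and mul_scl_left: "\<lbrakk>x \<in> car A; y \<in> car A\<rbrakk> \<Longrightarrow> scl A c x \<cdot>\<^bsub>A\<^esub> y = scl A c (x \<cdot>\<^bsub>A\<^esub> y)"
    and mul_scl_right: "\<lbrakk>x \<in> car A; y \<in> car A\<rbrakk> \<Longrightarrow> x \<cdot>\<^bsub>A\<^esub> scl A c y = scl A c (x \<cdot>\<^bsub>A\<^esub> y)"
    and nrm_mul: "\<lbrakk>x \<in> car A; y \<in> car A\<rbrakk> \<Longrightarrow> nrm A (x \<cdot>\<^bsub>A\<^esub> y) \<le> nrm A x * nrm A y"
    and star_closed: "x \<in> car A \<Longrightarrow> star A x \<in> car A"
    and star_star: "x \<in> car A \<Longrightarrow> star A (star A x) = x"
    and star_add: "\<lbrakk>x \<in> car A; y \<in> car A\<rbrakk> \<Longrightarrow> star A (add A x y) = add A (star A x) (star A y)"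
    and star_scl: "x \<in> car A \<Longrightarrow> star A (scl A c x) = scl A (cnj c) (star A x)"
    and star_mul: "\<lbrakk>x \<in> car A; y \<in> car A\<rbrakk> \<Longrightarrow> star A (x \<cdot>\<^bsub>A\<^esub> y) = star A y \<cdot>\<^bsub>A\<^esub> star A x"
    and cstar_identity: "x \<in> car A \<Longrightarrow> nrm A (star A x \<cdot>\<^bsub>A\<^esub> x) = (nrm A x)\<^sup>2"

definition positive :: "'a cstar \<Rightarrow> 'a set" where
  "positive A = {star A y \<cdot>\<^bsub>A\<^esub> y | y. y \<in> car A}"

definition linear_map ::
  "('a, 'r) cspace_scheme \<Rightarrow> ('b, 's) cspace_scheme \<Rightarrow> ('a \<Rightarrow> 'b) \<Rightarrow> bool" where
  "linear_map V W f \<longleftrightarrow> f \<in> car V \<rightarrow> car W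
    \<and> (\<forall>x\<in>car V. \<forall>y\<in>car V. f (add V x y) = add W (f x) (f y))
    \<and> (\<forall>c. \<forall>x\<in>car V. f (scl V c x) = scl W c (f x))"

definition positive_map :: "'a cstar \<Rightarrow> 'b cstar \<Rightarrow> ('a \<Rightarrow> 'b) \<Rightarrow> bool" where
  "positive_map A B f \<longleftrightarrow> linear_map A B f \<and> f ` positive A \<subseteq> positive B"

definition cstar_hom :: "'a cstar \<Rightarrow> 'b cstar \<Rightarrow> ('a \<Rightarrow> 'b) \<Rightarrow> bool" where
  "cstar_hom A B f \<longleftrightarrow> linear_map A B f
    \<and> (\<forall>x\<in>car A. \<forall>y\<in>car A. f (x \<cdot>\<^bsub>A\<^esub> y) = f x \<cdot>\<^bsub>B\<^esub> f y)
    \<and> (\<forall>x\<in>car A. f (star A x) = star B (f x))"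

definition closed_subspace :: "('a, 'r) cspace_scheme \<Rightarrow> 'a set \<Rightarrow> bool" where
  "closed_subspace V U \<longleftrightarrow> U \<subseteq> car V \<and> zer V \<in> U
    \<and> (\<forall>x\<in>U. \<forall>y\<in>U. add V x y \<in> U) \<and> (\<forall>c. \<forall>x\<in>U. scl V c x \<in> U)
    \<and> closedin (norm_top V) U"

definition closed_span :: "('a, 'r) cspace_scheme \<Rightarrow> 'a set \<Rightarrow> 'a set" where
  "closed_span V X = \<Inter> {U. closed_subspace V U \<and> X \<subseteq> U}"

definition cstar_generated :: "'a cstar \<Rightarrow> 'a set \<Rightarrow> 'a set" where
  "cstar_generated A X = \<Inter> {U. closed_subspace A U
    \<and> (\<forall>x\<in>U. \<forall>y\<in>U. x \<cdot>\<^bsub>A\<^esub> y \<in> U) \<and> (\<forall>x\<in>U. star A x \<in> U) \<and> X \<subseteq> U}"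

definition ideal_generated :: "'a cstar \<Rightarrow> 'a set \<Rightarrow> 'a set" where
  "ideal_generated A X = \<Inter> {J. closed_subspace A J
    \<and> (\<forall>x\<in>J. \<forall>a\<in>car A. a \<cdot>\<^bsub>A\<^esub> x \<in> J \<and> x \<cdot>\<^bsub>A\<^esub> a \<in> J) \<and> X \<subseteq> J}"

definition nondegenerate :: "'a cstar \<Rightarrow> 'b cstar \<Rightarrow> ('a \<Rightarrow> 'b) \<Rightarrow> bool" where
  "nondegenerate A B f \<longleftrightarrow> closed_span B {f a \<cdot>\<^bsub>B\<^esub> b | a b. a \<in> car A \<and> b \<in> car B} = car B"

definition op_norm :: "('a, 'r) cspace_scheme \<Rightarrow> ('a \<Rightarrow> 'a) \<Rightarrow> real" where
  "op_norm V f = Sup {nrm V (f x) | x. x \<in> car V \<and> nrm V x \<le> 1}"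

section \<open>Multiplier algebras\<close>

text \<open>A multiplier is a double centraliser $(l,r)$, written as $l(a) = m a$ and $r(a) = a m$.
  The component maps are extensional, so that equality of pairs is equality of multipliers.\<close>

type_synonym 'a mlt = "('a \<Rightarrow> 'a) \<times> ('a \<Rightarrow> 'a)"

abbreviation lmul :: "'a mlt \<Rightarrow> 'a \<Rightarrow> 'a"  (infixr \<open>\<triangleright>\<close> 72) where
  "m \<triangleright> a \<equiv> fst m a"

abbreviation rmul :: "'a \<Rightarrow> 'a mlt \<Rightarrow> 'a"  (infixl \<open>\<triangleleft>\<close> 72) where
  "a \<triangleleft> m \<equiv> snd m a"

definition bounded_op :: "('a, 'r) cspace_scheme \<Rightarrow> ('a \<Rightarrow> 'a) \<Rightarrow> bool" where
  "bounded_op V f \<longleftrightarrow> f \<in> extensional (car V) \<and> linear_map V V f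
    \<and> (\<exists>K. \<forall>x\<in>car V. nrm V (f x) \<le> K * nrm V x)"

definition multiplier :: "'a cstar \<Rightarrow> 'a mlt cstar" where
  "multiplier A = \<lparr>
     car = {m. bounded_op A (fst m) \<and> bounded_op A (snd m)
       \<and> (\<forall>a\<in>car A. \<forall>b\<in>car A.
            m \<triangleright> (a \<cdot>\<^bsub>A\<^esub> b) = (m \<triangleright> a) \<cdot>\<^bsub>A\<^esub> b
          \<and> (a \<cdot>\<^bsub>A\<^esub> b) \<triangleleft> m = a \<cdot>\<^bsub>A\<^esub> (b \<triangleleft> m)
          \<and> (a \<triangleleft> m) \<cdot>\<^bsub>A\<^esub> b = a \<cdot>\<^bsub>A\<^esub> (m \<triangleright> b))},
     zer = (\<lambda>a\<in>car A. zer A, \<lambda>a\<in>car A. zer A),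
     add = (\<lambda>m n. (\<lambda>a\<in>car A. add A (m \<triangleright> a) (n \<triangleright> a), \<lambda>a\<in>car A. add A (a \<triangleleft> m) (a \<triangleleft> n))),
     scl = (\<lambda>c m. (\<lambda>a\<in>car A. scl A c (m \<triangleright> a), \<lambda>a\<in>car A. scl A c (a \<triangleleft> m))),
     nrm = (\<lambda>m. op_norm A (fst m)),
     mul = (\<lambda>m n. (\<lambda>a\<in>car A. m \<triangleright> (n \<triangleright> a), \<lambda>a\<in>car A. (a \<triangleleft> m) \<triangleleft> n)),
     star = (\<lambda>m. (\<lambda>a\<in>car A. star A (star A a \<triangleleft> m), \<lambda>a\<in>car A. star A (m \<triangleright> star A a))) \<rparr>"

definition mone :: "'a cstar \<Rightarrow> 'a mlt" where
  "mone A = (\<lambda>a\<in>car A. a, \<lambda>a\<in>car A. a)"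

definition memb :: "'a cstar \<Rightarrow> 'a \<Rightarrow> 'a mlt" where
  "memb A a = (\<lambda>b\<in>car A. a \<cdot>\<^bsub>A\<^esub> b, \<lambda>b\<in>car A. b \<cdot>\<^bsub>A\<^esub> a)"

primrec mpow :: "'a cstar \<Rightarrow> 'a mlt \<Rightarrow> nat \<Rightarrow> 'a mlt" where
  "mpow A m 0 = mone A"
| "mpow A m (Suc k) = mpow A m k \<cdot>\<^bsub>multiplier A\<^esub> m"

definition strict_top :: "'a cstar \<Rightarrow> 'a mlt topology" where
  "strict_top A = topology_generated_by
     ({{m \<in> car (multiplier A). dst A (m \<triangleright> a) (n \<triangleright> a) < e} | n a e.
         n \<in> car (multiplier A) \<and> a \<in> car A \<and> 0 < e}
    \<union> {{m \<in> car (multiplier A). dst A (a \<triangleleft> m) (a \<triangleleft> n) < e} | n a e.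
         n \<in> car (multiplier A) \<and> a \<in> car A \<and> 0 < e})"

definition strict_extension :: "'a cstar \<Rightarrow> ('a \<Rightarrow> 'a) \<Rightarrow> ('a mlt \<Rightarrow> 'a mlt) \<Rightarrow> bool" where
  "strict_extension A f F \<longleftrightarrow> cstar_hom (multiplier A) (multiplier A) F
    \<and> continuous_map (strict_top A) (strict_top A) F
    \<and> (\<forall>a\<in>car A. F (memb A a) = memb A (f a))"

definition extendible :: "'a cstar \<Rightarrow> ('a \<Rightarrow> 'a) \<Rightarrow> bool" where
  "extendible A f \<longleftrightarrow> (\<exists>F. strict_extension A f F)"

text \<open>For a nondegenerate homomorphism $h$, the canonical extension $\overline{h}$ to multipliers is
  determined by $\overline{h}(m) h(a) = h(m a)$; the following says $\overline{h}(m) = n$.\<close>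

definition mult_ext :: "'a cstar \<Rightarrow> 'b cstar \<Rightarrow> ('a \<Rightarrow> 'b) \<Rightarrow> 'a mlt \<Rightarrow> 'b mlt \<Rightarrow> bool" where
  "mult_ext A B h m n \<longleftrightarrow> m \<in> car (multiplier A) \<and> n \<in> car (multiplier B)
    \<and> (\<forall>a\<in>car A. n \<triangleright> h a = h (m \<triangleright> a))"

text \<open>A multiplier of an algebra that leaves the subalgebra $F$ invariant, as a multiplier of $F$.\<close>

definition mult_restrict :: "'a cstar \<Rightarrow> 'a mlt \<Rightarrow> 'a mlt" where
  "mult_restrict F m = (restrict (fst m) (car F), restrict (snd m) (car F))"

section \<open>Exel systems and the Toeplitz crossed product\<close>

definition exel_system :: "'a cstar \<Rightarrow> ('a \<Rightarrow> 'a) \<Rightarrow> ('a \<Rightarrow> 'a) \<Rightarrow> bool" where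
  "exel_system A \<alpha> L \<longleftrightarrow> cstar_algebra A \<and> cstar_hom A A \<alpha> \<and> extendible A \<alpha> \<and> positive_map A A L
    \<and> (\<exists>L'. positive_map (multiplier A) (multiplier A) L'
          \<and> (\<forall>a\<in>car A. L' (memb A a) = memb A (L a))
          \<and> (\<forall>a\<in>car A. \<forall>m\<in>car (multiplier A). L (\<alpha> a \<triangleleft> m) = a \<triangleleft> L' m)
          \<and> L' (mone A) = mone A)"

definition toeplitz_rep ::
  "'a cstar \<Rightarrow> ('a \<Rightarrow> 'a) \<Rightarrow> ('a \<Rightarrow> 'a) \<Rightarrow> 'b cstar \<Rightarrow> ('a \<Rightarrow> 'b) \<Rightarrow> 'b mlt \<Rightarrow> bool" where
  "toeplitz_rep A \<alpha> L B \<pi> S \<longleftrightarrow> cstar_hom A B \<pi> \<and> nondegenerate A B \<pi> \<and> S \<in> car (multiplier B)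
    \<and> (\<forall>a\<in>car A. S \<cdot>\<^bsub>multiplier B\<^esub> memb B (\<pi> a) = memb B (\<pi> (\<alpha> a)) \<cdot>\<^bsub>multiplier B\<^esub> S)
    \<and> (\<forall>a\<in>car A. star (multiplier B) S \<cdot>\<^bsub>multiplier B\<^esub> memb B (\<pi> a) \<cdot>\<^bsub>multiplier B\<^esub> S
          = memb B (\<pi> (L a)))"

text \<open>HOL cannot quantify over all types inside a formula, so universality is tested against the
  C*-algebras carried by subsets of \<^typ>\<open>nat \<Rightarrow> 'a + 't\<close>. This is no restriction: a covariant
  representation takes its values in the C*-algebra generated by $\pi(A) \cup \pi(A)S$
  (where it is still nondegenerate, with $S$ a multiplier), every element of which is
  the limit of a sequence of polynomials, with coefficients in a countable dense field, in the
  elements of that generating set. Hence it has at most as many elements as there are sequences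
  in $A$, and is isomorphic to one of the algebras tested.
  The homomorphism $h$ is unique because the generators determine it.\<close>

definition toeplitz_crossed_product ::
  "'a cstar \<Rightarrow> ('a \<Rightarrow> 'a) \<Rightarrow> ('a \<Rightarrow> 'a) \<Rightarrow> 't cstar \<Rightarrow> ('a \<Rightarrow> 't) \<Rightarrow> 't mlt \<Rightarrow> bool" where
  "toeplitz_crossed_product A \<alpha> L T i s \<longleftrightarrow> cstar_algebra T \<and> toeplitz_rep A \<alpha> L T i s
    \<and> cstar_generated T (i ` car A \<union> (\<lambda>a. i a \<triangleleft> s) ` car A) = car T
    \<and> (\<forall>(B :: (nat \<Rightarrow> 'a + 't) cstar) \<pi> S. cstar_algebra B \<and> toeplitz_rep A \<alpha> L B \<pi> S \<longrightarrow>
        (\<exists>h. cstar_hom T B h \<and> nondegenerate T B h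
          \<and> (\<forall>a\<in>car A. h (i a) = \<pi> a) \<and> mult_ext T B h s S))"

section \<open>Right-Hilbert bimodules\<close>

record ('a, 'm) hbimod = "'m cspace" +
  ract :: "'m \<Rightarrow> 'a \<Rightarrow> 'm"
  lact :: "'a \<Rightarrow> 'm \<Rightarrow> 'm"
  inner :: "'m \<Rightarrow> 'm \<Rightarrow> 'a"

locale hilbert_bimodule = complex_banach M for A :: "'a cstar" and M :: "('a, 'm) hbimod" +
  assumes ract_closed: "\<lbrakk>x \<in> car M; a \<in> car A\<rbrakk> \<Longrightarrow> ract M x a \<in> car M"
    and ract_linear_left: "a \<in> car A \<Longrightarrow> linear_map M M (\<lambda>x. ract M x a)"
    and ract_linear_right: "x \<in> car M \<Longrightarrow> linear_map A M (ract M x)"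
    and ract_mul: "\<lbrakk>x \<in> car M; a \<in> car A; b \<in> car A\<rbrakk>
      \<Longrightarrow> ract M x (a \<cdot>\<^bsub>A\<^esub> b) = ract M (ract M x a) b"
    and inner_linear: "x \<in> car M \<Longrightarrow> linear_map M A (inner M x)"
    and inner_ract: "\<lbrakk>x \<in> car M; y \<in> car M; a \<in> car A\<rbrakk>
      \<Longrightarrow> inner M x (ract M y a) = inner M x y \<cdot>\<^bsub>A\<^esub> a"
    and inner_star: "\<lbrakk>x \<in> car M; y \<in> car M\<rbrakk> \<Longrightarrow> star A (inner M x y) = inner M y x"
    and inner_positive: "x \<in> car M \<Longrightarrow> inner M x x \<in> positive A"
    and nrm_inner: "x \<in> car M \<Longrightarrow> nrm M x = sqrt (nrm A (inner M x x))"
    and lact_linear_left: "x \<in> car M \<Longrightarrow> linear_map A M (\<lambda>a. lact M a x)"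
    and lact_linear_right: "a \<in> car A \<Longrightarrow> linear_map M M (lact M a)"
    and lact_mul: "\<lbrakk>x \<in> car M; a \<in> car A; b \<in> car A\<rbrakk>
      \<Longrightarrow> lact M (a \<cdot>\<^bsub>A\<^esub> b) x = lact M a (lact M b x)"
    and lact_adjoint: "\<lbrakk>x \<in> car M; y \<in> car M; a \<in> car A\<rbrakk>
      \<Longrightarrow> inner M (lact M a x) y = inner M x (lact M (star A a) y)"

definition is_adjoint :: "('a, 'm) hbimod \<Rightarrow> ('m \<Rightarrow> 'm) \<Rightarrow> ('m \<Rightarrow> 'm) \<Rightarrow> bool" where
  "is_adjoint M f g \<longleftrightarrow> f \<in> car M \<rightarrow>\<^sub>E car M \<and> g \<in> car M \<rightarrow>\<^sub>E car M
    \<and> (\<forall>x\<in>car M. \<forall>y\<in>car M. inner M (f x) y = inner M x (g y))"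

definition adjointables :: "('a, 'm) hbimod \<Rightarrow> ('m \<Rightarrow> 'm) cstar" where
  "adjointables M = \<lparr>
     car = {f. \<exists>g. is_adjoint M f g},
     zer = (\<lambda>x\<in>car M. zer M),
     add = (\<lambda>f g. \<lambda>x\<in>car M. add M (f x) (g x)),
     scl = (\<lambda>c f. \<lambda>x\<in>car M. scl M c (f x)),
     nrm = op_norm M,
     mul = (\<lambda>f g. \<lambda>x\<in>car M. f (g x)),
     star = (\<lambda>f. THE g. is_adjoint M f g) \<rparr>"

definition rank_one :: "('a, 'm) hbimod \<Rightarrow> 'm \<Rightarrow> 'm \<Rightarrow> 'm \<Rightarrow> 'm" where
  "rank_one M m n = (\<lambda>p\<in>car M. ract M m (inner M n p))"

definition compacts :: "('a, 'm) hbimod \<Rightarrow> ('m \<Rightarrow> 'm) cstar" where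
  "compacts M = (adjointables M)\<lparr> car :=
     closed_span (adjointables M) {rank_one M m n | m n. m \<in> car M \<and> n \<in> car M} \<rparr>"

definition left_action :: "('a, 'm) hbimod \<Rightarrow> 'a \<Rightarrow> 'm \<Rightarrow> 'm" where
  "left_action M a = (\<lambda>x\<in>car M. lact M a x)"

definition bimodule_rep ::
  "'a cstar \<Rightarrow> ('a, 'm) hbimod \<Rightarrow> 'b cstar \<Rightarrow> ('m \<Rightarrow> 'b) \<Rightarrow> ('a \<Rightarrow> 'b) \<Rightarrow> bool" where
  "bimodule_rep A M B \<psi> \<pi> \<longleftrightarrow> linear_map M B \<psi> \<and> cstar_hom A B \<pi>
    \<and> (\<forall>m\<in>car M. \<forall>a\<in>car A. \<psi> (ract M m a) = \<psi> m \<cdot>\<^bsub>B\<^esub> \<pi> a)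
    \<and> (\<forall>m\<in>car M. \<forall>n\<in>car M. star B (\<psi> m) \<cdot>\<^bsub>B\<^esub> \<psi> n = \<pi> (inner M m n))
    \<and> (\<forall>a\<in>car A. \<forall>m\<in>car M. \<psi> (lact M a m) = \<pi> a \<cdot>\<^bsub>B\<^esub> \<psi> m)"

text \<open>The homomorphism $(\psi,\pi)^{(1)}$ of the compact operators; it does not involve $\pi$.\<close>

definition induced_hom :: "('a, 'm) hbimod \<Rightarrow> 'b cstar \<Rightarrow> ('m \<Rightarrow> 'b) \<Rightarrow> ('m \<Rightarrow> 'm) \<Rightarrow> 'b" where
  "induced_hom M B \<psi> = (THE \<kappa>. \<kappa> \<in> extensional (car (compacts M)) \<and> cstar_hom (compacts M) B \<kappa>
    \<and> (\<forall>m\<in>car M. \<forall>n\<in>car M. \<kappa> (rank_one M m n) = \<psi> m \<cdot>\<^bsub>B\<^esub> star B (\<psi> n)))"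

section \<open>The Exel crossed product\<close>

text \<open>$(M,q)$ is the bimodule $M_L$ with its canonical map: a Hilbert bimodule in which
  $A$ modulo vectors of length 0 sits densely, with the prescribed operations on its image. As
  for any completion, this determines $(M,q)$ up to a unique isomorphism.\<close>

definition transfer_bimodule ::
  "'a cstar \<Rightarrow> ('a \<Rightarrow> 'a) \<Rightarrow> ('a \<Rightarrow> 'a) \<Rightarrow> ('a, 'm) hbimod \<Rightarrow> ('a \<Rightarrow> 'm) \<Rightarrow> bool" where
  "transfer_bimodule A \<alpha> L M q \<longleftrightarrow> hilbert_bimodule A M \<and> linear_map A M q
    \<and> norm_top M closure_of (q ` car A) = car M
    \<and> (\<forall>m\<in>car A. \<forall>n\<in>car A. inner M (q m) (q n) = L (star A m \<cdot>\<^bsub>A\<^esub> n))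
    \<and> (\<forall>m\<in>car A. \<forall>b\<in>car A. ract M (q m) b = q (m \<cdot>\<^bsub>A\<^esub> \<alpha> b))
    \<and> (\<forall>a\<in>car A. \<forall>m\<in>car A. lact M a (q m) = q (a \<cdot>\<^bsub>A\<^esub> m))"

definition K_alpha :: "'a cstar \<Rightarrow> ('a \<Rightarrow> 'a) \<Rightarrow> ('a, 'm) hbimod \<Rightarrow> 'a set" where
  "K_alpha A \<alpha> M =
     closed_span A {a \<cdot>\<^bsub>A\<^esub> \<alpha> b \<cdot>\<^bsub>A\<^esub> c | a b c. a \<in> car A \<and> b \<in> car A \<and> c \<in> car A}
     \<inter> {a \<in> car A. left_action M a \<in> car (compacts M)}"

definition exel_ideal ::
  "'a cstar \<Rightarrow> ('a \<Rightarrow> 'a) \<Rightarrow> ('a, 'm) hbimod \<Rightarrow> 't cstar \<Rightarrow> ('a \<Rightarrow> 't) \<Rightarrow> ('m \<Rightarrow> 't) \<Rightarrow> 't set" where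
  "exel_ideal A \<alpha> M T i \<psi> = ideal_generated T
     {sub T (i a) (induced_hom M T \<psi> (left_action M a)) | a. a \<in> K_alpha A \<alpha> M}"

definition is_quotient :: "'t cstar \<Rightarrow> 't set \<Rightarrow> 'd cstar \<Rightarrow> ('t \<Rightarrow> 'd) \<Rightarrow> bool" where
  "is_quotient T J D Q \<longleftrightarrow> cstar_algebra D \<and> cstar_hom T D Q \<and> Q ` car T = car D
    \<and> {x \<in> car T. Q x = zer D} = J"

text \<open>$D$ is the Exel crossed product, with quotient map $Q$, so that $j = Q \circ i$, and
  $t = \overline{Q}(s)$. All the data of its construction are arguments: the Toeplitz crossed product
  $(T,i,s)$, the bimodule $(M,q)$, and $\psi = \psi_s$, which is determined by its values on
  the dense subspace $q(A)$.\<close>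

definition exel_crossed_product ::
  "'a cstar \<Rightarrow> ('a \<Rightarrow> 'a) \<Rightarrow> ('a \<Rightarrow> 'a) \<Rightarrow> 't cstar \<Rightarrow> ('a \<Rightarrow> 't) \<Rightarrow> 't mlt \<Rightarrow> ('a, 'm) hbimod \<Rightarrow> ('a \<Rightarrow> 'm)
    \<Rightarrow> ('m \<Rightarrow> 't) \<Rightarrow> 'd cstar \<Rightarrow> ('t \<Rightarrow> 'd) \<Rightarrow> ('a \<Rightarrow> 'd) \<Rightarrow> 'd mlt \<Rightarrow> bool" where
  "exel_crossed_product A \<alpha> L T i s M q \<psi> D Q j t \<longleftrightarrow>
      toeplitz_crossed_product A \<alpha> L T i s
    \<and> transfer_bimodule A \<alpha> L M q
    \<and> bimodule_rep A M T \<psi> i \<and> (\<forall>a\<in>car A. \<psi> (q a) = i a \<triangleleft> s)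
    \<and> is_quotient T (exel_ideal A \<alpha> M T i \<psi>) D Q
    \<and> j = Q \<circ> i \<and> mult_ext T D Q s t"

definition circle_action :: "'d cstar \<Rightarrow> (complex \<Rightarrow> 'd \<Rightarrow> 'd) \<Rightarrow> bool" where
  "circle_action D \<gamma> \<longleftrightarrow>
      (\<forall>z\<in>sphere 0 1. cstar_hom D D (\<gamma> z) \<and> bij_betw (\<gamma> z) (car D) (car D))
    \<and> (\<forall>z\<in>sphere 0 1. \<forall>w\<in>sphere 0 1. \<forall>x\<in>car D. \<gamma> (z * w) x = \<gamma> z (\<gamma> w x))
    \<and> (\<forall>x\<in>car D. continuous_map (top_of_set (sphere 0 1)) (norm_top D) (\<lambda>z. \<gamma> z x))"

definition dual_action ::
  "'a cstar \<Rightarrow> 'd cstar \<Rightarrow> ('a \<Rightarrow> 'd) \<Rightarrow> 'd mlt \<Rightarrow> (complex \<Rightarrow> 'd \<Rightarrow> 'd) \<Rightarrow> bool" where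
  "dual_action A D j t \<gamma> \<longleftrightarrow> circle_action D \<gamma>
    \<and> (\<forall>z\<in>sphere 0 1. (\<forall>a\<in>car A. \<gamma> z (j a) = j a)
         \<and> mult_ext D D (\<gamma> z) t (scl (multiplier D) z t))"

definition fixed_algebra :: "'d cstar \<Rightarrow> (complex \<Rightarrow> 'd \<Rightarrow> 'd) \<Rightarrow> 'd cstar" where
  "fixed_algebra D \<gamma> = D\<lparr> car := {x \<in> car D. \<forall>z\<in>sphere 0 1. \<gamma> z x = x} \<rparr>"

text \<open>The element $j(a) t^k t^{*k} j(b)$.\<close>

definition core_elt :: "'d cstar \<Rightarrow> ('a \<Rightarrow> 'd) \<Rightarrow> 'd mlt \<Rightarrow> 'a \<Rightarrow> nat \<Rightarrow> 'a \<Rightarrow> 'd" where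
  "core_elt D j t a k b =
     j a \<cdot>\<^bsub>D\<^esub> ((mpow D t k \<cdot>\<^bsub>multiplier D\<^esub> mpow D (star (multiplier D) t) k) \<triangleright> j b)"

section \<open>Stacey crossed products\<close>

definition stacey_rep ::
  "'c cstar \<Rightarrow> ('c \<Rightarrow> 'c) \<Rightarrow> 'b cstar \<Rightarrow> ('c \<Rightarrow> 'b) \<Rightarrow> 'b mlt \<Rightarrow> bool" where
  "stacey_rep C \<beta> B \<pi> W \<longleftrightarrow> cstar_hom C B \<pi> \<and> nondegenerate C B \<pi> \<and> W \<in> car (multiplier B)
    \<and> star (multiplier B) W \<cdot>\<^bsub>multiplier B\<^esub> W = mone B
    \<and> (\<forall>c\<in>car C. memb B (\<pi> (\<beta> c))
          = W \<cdot>\<^bsub>multiplier B\<^esub> memb B (\<pi> c) \<cdot>\<^bsub>multiplier B\<^esub> star (multiplier B) W)"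

text \<open>$h = \pi \times W$, as a homomorphism of the crossed product $(E,i_C,v)$ into $B$.\<close>

definition integrated_form ::
  "'c cstar \<Rightarrow> 'e cstar \<Rightarrow> ('c \<Rightarrow> 'e) \<Rightarrow> 'e mlt \<Rightarrow> 'b cstar \<Rightarrow> ('c \<Rightarrow> 'b) \<Rightarrow> 'b mlt \<Rightarrow> ('e \<Rightarrow> 'b) \<Rightarrow> bool" where
  "integrated_form C E iC v B \<pi> W h \<longleftrightarrow> cstar_hom E B h \<and> nondegenerate E B h
    \<and> (\<forall>c\<in>car C. h (iC c) = \<pi> c) \<and> mult_ext E B h v W"

text \<open>The type of the test algebras is large enough for the same reason as for
  \<^const>\<open>toeplitz_crossed_product\<close>.\<close>

definition stacey_crossed_product ::
  "'c cstar \<Rightarrow> ('c \<Rightarrow> 'c) \<Rightarrow> 'e cstar \<Rightarrow> ('c \<Rightarrow> 'e) \<Rightarrow> 'e mlt \<Rightarrow> bool" where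
  "stacey_crossed_product C \<beta> E iC v \<longleftrightarrow> cstar_algebra E \<and> stacey_rep C \<beta> E iC v
    \<and> cstar_generated E (iC ` car C \<union> (\<lambda>c. iC c \<triangleleft> v) ` car C) = car E
    \<and> (\<forall>(B :: (nat \<Rightarrow> 'c + 'e) cstar) \<pi> W. cstar_algebra B \<and> stacey_rep C \<beta> B \<pi> W \<longrightarrow>
        (\<exists>h. integrated_form C E iC v B \<pi> W h))"

end

theory Submission
  imports Defs
begin

text \<open>The relation \<open>t\<^sup>* j(\<alpha>(a)) t = j(L(\<alpha>(a))) = j(a)\<close> makes \<open>t\<close> an isometry, so \<open>\<beta>(x) = t x t\<^sup>*\<close> is an injective
  endomorphism of the fixed-point algebra \<open>F\<close> onto \<open>tt\<^sup>* F tt\<^sup>*\<close>, and \<open>(id, t)\<close> is covariant. By Cohen's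
  factorisation each \<open>tt\<^sup>* x\<close> with \<open>x\<close> in \<open>F\<close> has the form \<open>\<beta>(f) y\<close>, and \<open>m \<mapsto> \<beta>(m f) y\<close> defines the strictly
  continuous extension of \<open>\<beta>\<close> at \<open>x\<close>.

  The Stacey crossed product \<open>E\<close> is the closure of the sum of the subspaces \<open>v\<^sup>*\<^sup>k F v\<^sup>l\<close>, graded by \<open>l - k\<close>.
  The homomorphism to \<open>D\<close> is isometric on each homogeneous component, and the dual action extracts
  components in \<open>D\<close> by contractions, so \<open>\<parallel>x\<parallel>\<close> is at most the number of components times the norm of the
  image. Applied to high powers of \<open>x\<^sup>* x\<close> this estimate shows that the homomorphism is isometric; hence its range is
  closed, and it contains the generators of \<open>D\<close>.\<close>

section \<open>Carrier vector spaces\<close>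

text \<open>No spectral theory or continuous functional calculus is invoked: square roots of
  \<open>1 - a^2\<close> and the elements \<open>h (h + \<i>v)\<^sup>-\<^sup>1\<close> are fixed
  points of contractions, and unitaries such as the Cayley transform appear only multiplied by an
  element, since the algebras need not have a unit. Three obstacles shape the argument. First,
  \<open>\<beta>\<close> is degenerate, so its extension to multipliers cannot be defined on a dense
  set \<open>\<beta>(F) F\<close>; but its range is a whole corner, and Cohen factorisation with a
  factor in that range describes each \<open>p x\<close> exactly. Second, covariance says nothing
  directly about \<open>v v\<^sup>* iF(c)\<close> and \<open>v\<^sup>* iF(c) v\<close>. That these
  remain in the image of \<open>iF\<close> must be proved; it puts \<open>x\<^sup>* x\<close>, for
  homogeneous \<open>x\<close>, into \<open>iF(F)\<close>, where the homomorphism to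
  \<open>D\<close> is isometric. Third, \<open>E\<close> comes without a gauge action of its own, so
  that its degrees are visible only through \<open>D\<close>; the power estimate replaces a
  comparison of two conditional expectations.\<close>

definition functional :: "('a, 'r) cspace_scheme \<Rightarrow> ('a \<Rightarrow> complex) \<Rightarrow> bool" where
  "functional V f \<longleftrightarrow> (\<forall>x\<in>car V. \<forall>y\<in>car V. f (add V x y) = f x + f y)
    \<and> (\<forall>c. \<forall>x\<in>car V. f (scl V c x) = c * f x)"

definition subspace_of :: "('a, 'r) cspace_scheme \<Rightarrow> 'a set \<Rightarrow> bool" where
  "subspace_of V U \<longleftrightarrow> U \<subseteq> car V \<and> zer V \<in> U
    \<and> (\<forall>x\<in>U. \<forall>y\<in>U. add V x y \<in> U) \<and> (\<forall>c. \<forall>x\<in>U. scl V c x \<in> U)"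

context complex_banach
begin

lemmas closed_simps [simp] = zer_closed add_closed scl_closed add_zero scl_one

lemma add_left_commute:
  "\<lbrakk>x \<in> car V; y \<in> car V; z \<in> car V\<rbrakk> \<Longrightarrow> add V x (add V y z) = add V y (add V x z)"
  by (metis add_assoc add_commute)

lemma zero_add [simp]: "x \<in> car V \<Longrightarrow> add V (zer V) x = x"
  by (metis add_commute add_zero zer_closed)

lemma scl_zero_left [simp]: "x \<in> car V \<Longrightarrow> scl V 0 x = zer V"
  using scl_add_left[of x 1 "-1"] by (simp add: add_neg)

lemma scl_zer [simp]: "scl V c (zer V) = zer V"
  by (metis mult_zero_right scl_scl scl_zero_left zer_closed)

lemma sub_closed [simp]: "\<lbrakk>x \<in> car V; y \<in> car V\<rbrakk> \<Longrightarrow> sub V x y \<in> car V"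
  by (simp add: sub_def)

lemma functional_zer: "functional V f \<Longrightarrow> f (zer V) = 0"
  unfolding functional_def by (metis mult_zero_left scl_zer zer_closed scl_zero_left)

text \<open>A maximal subspace avoiding \<open>x\<close> has codimension one, which gives a functional
  that does not vanish at \<open>x\<close>.\<close>

lemma functional_separates:
  assumes x: "x \<in> car V" "x \<noteq> zer V"
  obtains f where "functional V f" "f x \<noteq> 0"
proof -
  let ?S = "{U. subspace_of V U \<and> x \<notin> U}"
  have "\<exists>U\<in>?S. \<forall>W\<in>?S. U \<subseteq> W \<longrightarrow> W = U"
  proof (rule subset_Zorn_nonempty)
    show "?S \<noteq> {}" using x by (auto simp: subspace_of_def intro!: exI[of _ "{zer V}"])
    fix \<C> assume C: "\<C> \<noteq> {}" "subset.chain ?S \<C>"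
    then have sub: "\<And>U. U \<in> \<C> \<Longrightarrow> subspace_of V U \<and> x \<notin> U"
      and ch: "\<And>U W. U \<in> \<C> \<Longrightarrow> W \<in> \<C> \<Longrightarrow> U \<subseteq> W \<or> W \<subseteq> U"
      by (auto simp: subset_chain_def)
    have "add V u w \<in> \<Union>\<C>" if uw: "u \<in> \<Union>\<C>" "w \<in> \<Union>\<C>" for u w
    proof -
      obtain U W where UW: "U \<in> \<C>" "W \<in> \<C>" "u \<in> U" "w \<in> W" using uw by blast
      have "u \<in> U \<and> w \<in> U \<or> u \<in> W \<and> w \<in> W" using ch UW by blast
      with UW show ?thesis using sub unfolding subspace_of_def by (meson UnionI)
    qed
    moreover have "zer V \<in> \<Union>\<C>" using C(1) sub by (auto simp: subspace_of_def)
    ultimately show "\<Union>\<C> \<in> ?S"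
      using sub unfolding subspace_of_def by blast
  qed
  then obtain U where U: "subspace_of V U" "x \<notin> U"
    and mx: "\<And>W. subspace_of V W \<Longrightarrow> x \<notin> W \<Longrightarrow> U \<subseteq> W \<Longrightarrow> W = U" by blast
  have Uc: "\<And>u. u \<in> U \<Longrightarrow> u \<in> car V" and U0: "zer V \<in> U"
    and Ua: "\<And>u w. u \<in> U \<Longrightarrow> w \<in> U \<Longrightarrow> add V u w \<in> U"
    and Us: "\<And>c u. u \<in> U \<Longrightarrow> scl V c u \<in> U"
    using U(1) by (auto simp: subspace_of_def)
  have ex: "\<exists>c. \<exists>u\<in>U. v = add V u (scl V c x)" if v: "v \<in> car V" for v
  proof (cases "v \<in> U")
    case True
    then show ?thesis using x by (intro exI[of _ 0] bexI[of _ v]) (auto simp: Uc)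
  next
    case False
    let ?W = "{add V u (scl V c v) | u c. u \<in> U}"
    have "subspace_of V ?W"
      unfolding subspace_of_def
    proof (intro conjI ballI allI)
      show "?W \<subseteq> car V" using Uc v by auto
      show "zer V \<in> ?W" using U0 v by (auto intro!: exI[of _ "zer V"] exI[of _ 0])
      fix a assume "a \<in> ?W"
      then obtain u c where a: "a = add V u (scl V c v)" "u \<in> U" by blast
      show "scl V d a \<in> ?W" for d
        using a Us[of u d] v Uc by (auto simp: scl_add_right scl_scl)
      fix b assume "b \<in> ?W"
      then obtain u' c' where b: "b = add V u' (scl V c' v)" "u' \<in> U" by blast
      have "add V a b = add V (add V u u') (scl V (c + c') v)"
        using a b Uc v by (simp add: scl_add_left add_assoc add_left_commute)
      then show "add V a b \<in> ?W" using Ua a b by blast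
    qed
    moreover have "U \<subseteq> ?W"
    proof
      fix u assume "u \<in> U"
      then show "u \<in> ?W" using v Uc by (auto intro!: exI[of _ u] exI[of _ 0])
    qed
    moreover have "v \<in> ?W" using U0 v by (auto intro!: exI[of _ "zer V"] exI[of _ 1])
    ultimately have "x \<in> ?W" using mx[of ?W] False by blast
    then obtain u c where uc: "x = add V u (scl V c v)" "u \<in> U" by blast
    have "c \<noteq> 0" using uc U(2) Uc v by auto
    have "add V (scl V (- (1/c)) u) (scl V (1/c) x)
        = add V (scl V (- (1/c)) u) (add V (scl V (1/c) u) (scl V 1 v))"
      using uc \<open>c \<noteq> 0\<close> Uc v by (simp add: scl_add_right scl_scl)
    also have "\<dots> = add V (scl V (- (1/c) + 1/c) u) v"
      using uc Uc v by (subst scl_add_left) (simp_all add: add_assoc)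
    also have "\<dots> = v" using uc Uc v by simp
    finally show ?thesis using Us[OF uc(2)] by metis
  qed
  \<comment> \<open>Two different coordinates would put \<open>(c - d) x\<close>, hence
    \<open>x\<close>, into \<open>U\<close>.\<close>
  have uq: "c = d" if "u \<in> U" "w \<in> U" "add V u (scl V c x) = add V w (scl V d x)" for u w c d
  proof (rule ccontr)
    assume "c \<noteq> d"
    have "add V (scl V (-1) u) (add V (add V u (scl V c x)) (scl V (-d) x))
        = add V (add V u (scl V (-1) u)) (scl V (c - d) x)"
      using that(1,2) Uc x scl_add_left[of x c "-d"] by (simp add: add_assoc add_left_commute)
    also have "\<dots> = scl V (c - d) x" using that Uc x by (simp add: add_neg)
    finally have 1: "scl V (c - d) x
        = add V (scl V (-1) u) (add V (add V w (scl V d x)) (scl V (-d) x))"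
      using that by simp
    also have "\<dots> = add V (scl V (-1) u) (add V w (scl V (d + -d) x))"
      using that Uc x by (simp only: scl_add_left add_assoc closed_simps)
    also have "\<dots> = add V (scl V (-1) u) w" using that Uc x by simp
    finally have "scl V (c - d) x \<in> U" using that Ua Us by simp
    then have "scl V (1 / (c - d)) (scl V (c - d) x) \<in> U" using Us by blast
    then show False using U(2) x \<open>c \<noteq> d\<close> by (simp add: scl_scl)
  qed
  \<comment> \<open>The coordinate along \<open>x\<close> in the decomposition of the carrier into
    \<open>U\<close> and the line through \<open>x\<close>.\<close>
  define f where "f v = (THE c. \<exists>u\<in>U. v = add V u (scl V c x))" for v
  have fI: "f (add V u (scl V c x)) = c" if "u \<in> U" for u c
    unfolding f_def using that uq by (intro the_equality) auto
  have "functional V f"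
    unfolding functional_def
  proof (intro conjI ballI allI)
    fix a assume "a \<in> car V"
    then obtain u c where a: "a = add V u (scl V c x)" "u \<in> U" using ex by blast
    have "scl V d a = add V (scl V d u) (scl V (d * c) x)" for d
      using a Uc x by (simp add: scl_add_right scl_scl)
    then show "f (scl V d a) = d * f a" for d using a Us fI by simp
    fix b assume "b \<in> car V"
    then obtain u' c' where b: "b = add V u' (scl V c' x)" "u' \<in> U" using ex by blast
    have "add V a b = add V (add V u u') (scl V (c + c') x)"
      using a b Uc x by (simp add: scl_add_left add_assoc add_left_commute)
    then show "f (add V a b) = f a + f b" using a b Ua fI by simp
  qed
  moreover have "f x = 1" using fI[OF U0, of 1] x by simp
  ultimately show thesis using that[of f] by simp
qed

text \<open>Linear identities in \<open>V\<close> reduce to identities between complex numbers.\<close>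

lemma vec_eqI:
  assumes "x \<in> car V" "y \<in> car V" "\<And>f. functional V f \<Longrightarrow> f x = f y"
  shows "x = y"
proof (rule ccontr)
  assume "x \<noteq> y"
  have "sub V x y \<noteq> zer V"
  proof
    assume "sub V x y = zer V"
    have "x = add V x (add V (scl V (-1) y) y)"
      using assms(1,2) by (subst add_commute[of _ y]) (simp_all add: add_neg)
    also have "\<dots> = add V (sub V x y) y"
      unfolding sub_def using assms(1,2) by (intro add_assoc[symmetric]) simp_all
    also have "\<dots> = y" using \<open>sub V x y = zer V\<close> assms by simp
    finally show False using \<open>x \<noteq> y\<close> by simp
  qed
  then obtain f where f: "functional V f" "f (sub V x y) \<noteq> 0"
    using functional_separates assms(1,2) by (metis sub_closed)
  then have "f (sub V x y) = f x - f y" using assms(1,2) by (simp add: sub_def functional_def)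
  then show False using f assms(3) by simp
qed

lemma functional_simps:
  assumes "functional V f"
  shows "f (zer V) = 0"
    and "\<lbrakk>x \<in> car V; y \<in> car V\<rbrakk> \<Longrightarrow> f (add V x y) = f x + f y"
    and "x \<in> car V \<Longrightarrow> f (scl V c x) = c * f x"
    and "\<lbrakk>x \<in> car V; y \<in> car V\<rbrakk> \<Longrightarrow> f (sub V x y) = f x - f y"
  using assms functional_zer by (simp_all add: functional_def sub_def)

lemma sub_zer [simp]: "x \<in> car V \<Longrightarrow> sub V x (zer V) = x"
  by (simp add: sub_def)

lemma sub_self [simp]: "x \<in> car V \<Longrightarrow> sub V x x = zer V"
  by (simp add: sub_def add_neg)

lemma sub_eq_zer: "\<lbrakk>x \<in> car V; y \<in> car V\<rbrakk> \<Longrightarrow> sub V x y = zer V \<longleftrightarrow> x = y"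
  by (metis add_assoc add_commute add_neg add_zero scl_closed sub_def sub_self)

lemma nrm_zer [simp]: "nrm V (zer V) = 0"
  using nrm_eq_zero by simp

lemma nrm_sub_commute: "\<lbrakk>x \<in> car V; y \<in> car V\<rbrakk> \<Longrightarrow> nrm V (sub V x y) = nrm V (sub V y x)"
proof -
  assume a: "x \<in> car V" "y \<in> car V"
  have "sub V x y = scl V (-1) (sub V y x)"
    using a by (intro vec_eqI) (auto simp: functional_simps)
  then show ?thesis using a by (simp add: nrm_scl)
qed

lemma nrm_sub_triangle:
  assumes "x \<in> car V" "y \<in> car V" "z \<in> car V"
  shows "nrm V (sub V x z) \<le> nrm V (sub V x y) + nrm V (sub V y z)"
proof -
  have "sub V x z = add V (sub V x y) (sub V y z)"
    using assms by (intro vec_eqI) (auto simp: functional_simps)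
  then show ?thesis using assms by (metis nrm_triangle sub_closed)
qed

lemma nrm_sub_le: "\<lbrakk>x \<in> car V; y \<in> car V\<rbrakk> \<Longrightarrow> nrm V (sub V x y) \<le> nrm V x + nrm V y"
  using nrm_triangle[of x "scl V (-1) y"] by (simp add: sub_def nrm_scl)

lemma nrm_le_sub: 
  assumes "x \<in> car V" "y \<in> car V" shows "nrm V x \<le> nrm V y + nrm V (sub V x y)"
  using nrm_sub_triangle[of x y "zer V"] assms by simp

section \<open>Completeness and the contraction principle\<close>

lemma metric: "Metric_space (car V) (dst V)"
proof
  show "0 \<le> dst V x y" for x y by (simp add: dst_def nrm_nonneg)
  show "dst V x y = dst V y x" for x y by (simp add: dst_def nrm_sub_commute)
  show "x \<in> car V \<Longrightarrow> y \<in> car V \<Longrightarrow> (dst V x y = 0) = (x = y)" for x y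
    by (simp add: dst_def nrm_eq_zero sub_eq_zer)
  show "x \<in> car V \<Longrightarrow> y \<in> car V \<Longrightarrow> z \<in> car V \<Longrightarrow> dst V x z \<le> dst V x y + dst V y z" for x y z
    by (simp add: dst_def nrm_sub_triangle)
qed

lemma closedin_norm_top:
  "closedin (norm_top V) U \<longleftrightarrow> U \<subseteq> car V
    \<and> (\<forall>x\<in>car V. (\<forall>e>0. \<exists>y\<in>U. nrm V (sub V x y) < e) \<longrightarrow> x \<in> U)" (is "_ \<longleftrightarrow> ?R")
proof -
  interpret Metric_space "car V" "dst V" by (rule metric)
  have "closedin mtopology U \<longleftrightarrow> ?R"
    unfolding closedin_metric disjnt_iff mball_def
    by (auto simp: dst_def subset_iff not_less) (metis not_less)+
  then show ?thesis by (simp add: norm_top_def)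
qed

lemma closed_subspaceI:
  assumes "subspace_of V U"
    and "\<And>x. x \<in> car V \<Longrightarrow> (\<And>e. e > 0 \<Longrightarrow> \<exists>y\<in>U. nrm V (sub V x y) < e) \<Longrightarrow> x \<in> U"
  shows "closed_subspace V U"
  using assms unfolding closed_subspace_def subspace_of_def closedin_norm_top by blast

text \<open>Distances telescope to sums of \<open>B\<close>, so the sequence is Cauchy. A bound on
  consecutive terms is what the iterations below supply.\<close>

lemma complete_seq:
  assumes c: "\<And>n. x n \<in> car V" and B: "\<And>n. nrm V (sub V (x (Suc n)) (x n)) \<le> B n" "summable B"
  obtains l where "l \<in> car V" "(\<lambda>n. nrm V (sub V (x n) l)) \<longlonglongrightarrow> 0"
proof -
  interpret Metric_space "car V" "dst V" by (rule metric)
  have B0: "0 \<le> B n" for n using B(1)[of n] nrm_nonneg[of "sub V (x (Suc n)) (x n)"] c by simp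
  have le: "nrm V (sub V (x (n + k)) (x n)) \<le> sum B {n..<n+k}" for n k
  proof (induction k)
    case (Suc k)
    have "nrm V (sub V (x (n + Suc k)) (x n))
        \<le> nrm V (sub V (x (Suc (n + k))) (x (n + k))) + nrm V (sub V (x (n + k)) (x n))"
      using nrm_sub_triangle c by simp
    then show ?case using Suc B(1)[of "n + k"] by simp
  qed (use c in simp)
  have "MCauchy x"
    unfolding MCauchy_def
  proof (intro conjI allI impI)
    show "range x \<subseteq> car V" using c by auto
    fix e :: real assume e: "e > 0"
    obtain N where N: "\<And>m. m \<ge> N \<Longrightarrow> \<bar>sum B {m..<n}\<bar> < e" for n
      using B(2) e unfolding summable_Cauchy by (metis real_norm_def)
    have "dst V (x m) (x n) < e" if "N \<le> m" "m \<le> n" for m n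
    proof -
      have "dst V (x m) (x n) = nrm V (sub V (x (m + (n - m))) (x m))"
        using that c by (simp add: dst_def nrm_sub_commute)
      also have "\<dots> \<le> sum B {m..<n}" using le[of m "n - m"] that by simp
      also have "\<dots> < e" using N[OF that(1), of n] by linarith
      finally show ?thesis .
    qed
    then show "\<exists>N. \<forall>n n'. N \<le> n \<longrightarrow> N \<le> n' \<longrightarrow> dst V (x n) (x n') < e"
      by (metis commute nle_le)
  qed
  then obtain l where "limitin mtopology x l sequentially"
    using complete by (auto simp: mcomplete_def)
  then have l: "l \<in> car V" and lim: "\<And>e. e > 0 \<Longrightarrow> \<forall>\<^sub>F n in sequentially. dst V (x n) l < e"
    by (auto simp: limitin_metric elim!: eventually_mono)
  have "(\<lambda>n. nrm V (sub V (x n) l)) \<longlonglongrightarrow> 0"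
  proof (rule tendstoI)
    fix e :: real assume "e > 0"
    then show "\<forall>\<^sub>F n in sequentially. dist (nrm V (sub V (x n) l)) 0 < e"
      using lim[of e] c l nrm_nonneg by (auto simp: dst_def elim!: eventually_mono)
  qed
  then show thesis using l that by blast
qed

text \<open>Banach's contraction principle; it produces square roots and resolvents. The closed set
  \<open>X\<close> carries side conditions, such as self-adjointness or commutation, over to the
  fixed point.\<close>

lemma fixed_point:
  assumes X: "closedin (norm_top V) X" "x0 \<in> X" "\<And>x. x \<in> X \<Longrightarrow> g x \<in> X"
    and k: "0 \<le> k" "k < 1"
    and con: "\<And>x y. x \<in> X \<Longrightarrow> y \<in> X \<Longrightarrow> nrm V (sub V (g x) (g y)) \<le> k * nrm V (sub V x y)"
  obtains x where "x \<in> X" "g x = x"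
proof -
  have Xc: "x \<in> car V" if "x \<in> X" for x using X(1) that closedin_norm_top by blast
  define s where "s n = (g ^^ n) x0" for n
  have gs: "g (s n) = s (Suc n)" for n by (simp add: s_def)
  have sX: "s n \<in> X" for n by (induction n) (auto simp: s_def X)
  have "nrm V (sub V (s (Suc n)) (s n)) \<le> k ^ n * nrm V (sub V (s 1) (s 0))" for n
  proof (induction n)
    case (Suc n)
    have "nrm V (sub V (s (Suc (Suc n))) (s (Suc n))) \<le> k * nrm V (sub V (s (Suc n)) (s n))"
      using con[OF sX[of "Suc n"] sX[of n]] by (simp only: gs)
    also have "\<dots> \<le> k * (k ^ n * nrm V (sub V (s 1) (s 0)))"
      using Suc k(1) by (intro mult_left_mono) auto
    finally show ?case by simp
  qed simp
  moreover have "summable (\<lambda>n. k ^ n * nrm V (sub V (s 1) (s 0)))"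
    using k by (intro summable_mult2 summable_geometric) simp
  ultimately obtain l where l: "l \<in> car V" "(\<lambda>n. nrm V (sub V (s n) l)) \<longlonglongrightarrow> 0"
    using complete_seq[of s "\<lambda>n. k ^ n * nrm V (sub V (s 1) (s 0))"] Xc[OF sX] by metis
  have ex: "\<exists>n. nrm V (sub V (s n) l) < e" if "e > 0" for e
  proof -
    note that' = that
    obtain N where "\<And>n. n \<ge> N \<Longrightarrow> \<bar>nrm V (sub V (s n) l)\<bar> < e"
      using LIMSEQ_D[OF l(2) that'] by auto
    from this[of N] show ?thesis by (intro exI[of _ N]) linarith
  qed
  have lX: "l \<in> X"
    using X(1) l(1) ex sX Xc nrm_sub_commute unfolding closedin_norm_top by metis
  have "nrm V (sub V (g l) l) \<le> e" if e: "e > 0" for e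
  proof -
    obtain N where N: "\<And>n. n \<ge> N \<Longrightarrow> nrm V (sub V (s n) l) < e / 2"
      using LIMSEQ_D[OF l(2), of "e/2"] e by fastforce
    have "nrm V (sub V (g l) l) \<le> nrm V (sub V (g l) (s (Suc N))) + nrm V (sub V (s (Suc N)) l)"
      using lX sX Xc X(3) by (intro nrm_sub_triangle) auto
    also have "nrm V (sub V (g l) (s (Suc N))) \<le> k * nrm V (sub V l (s N))"
      using con[OF lX sX[of N]] by (simp only: gs)
    also have "\<dots> \<le> 1 * nrm V (sub V (s N) l)"
      using k lX sX Xc nrm_nonneg by (subst nrm_sub_commute) (auto intro!: mult_left_le_one_le)
    finally show ?thesis using N[of N] N[of "Suc N"] by simp
  qed
  then have "nrm V (sub V (g l) l) \<le> 0" by (metis add_0 field_le_epsilon)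
  then have "g l = l"
    using nrm_nonneg[of "sub V (g l) l"] nrm_eq_zero[of "sub V (g l) l"] lX X(3) Xc
    by (auto simp: sub_eq_zer)
  with lX show thesis using that by blast
qed

lemma closed_span_least: "closed_subspace V U \<Longrightarrow> X \<subseteq> U \<Longrightarrow> closed_span V X \<subseteq> U"
  by (auto simp: closed_span_def)

lemma car_closed_subspace: "closed_subspace V (car V)"
  by (intro closed_subspaceI) (auto simp: subspace_of_def)

lemma closed_span_car: "X \<subseteq> car V \<Longrightarrow> closed_span V X \<subseteq> car V"
  by (intro closed_span_least car_closed_subspace)

lemma closed_span_mono: "X \<subseteq> Y \<Longrightarrow> closed_span V X \<subseteq> closed_span V Y"
  by (auto simp: closed_span_def)

end

lemma le_one_of_square_le:
  fixes x :: real assumes "x * x \<le> x" "0 \<le> x" shows "x \<le> 1"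
proof (rule ccontr)
  assume "\<not> x \<le> 1"
  then have "x * 1 < x * x" by (intro mult_strict_left_mono) auto
  with assms show False by simp
qed

section \<open>Closures and Lipschitz maps\<close>

definition approx :: "('a, 'r) cspace_scheme \<Rightarrow> 'a set \<Rightarrow> 'a \<Rightarrow> bool" where
  "approx V X x \<longleftrightarrow> x \<in> car V \<and> (\<forall>e>0. \<exists>y\<in>X. y \<in> car V \<and> nrm V (sub V x y) < e)"

text \<open>Lipschitz rather than bounded linear, so that the conjugate-linear adjoint and
  translations are covered too. The constant may be negative, hence the absolute values in the
  estimates.\<close>

definition lip :: "('a, 'r) cspace_scheme \<Rightarrow> ('b, 's) cspace_scheme \<Rightarrow> ('a \<Rightarrow> 'b) \<Rightarrow> bool" where
  "lip V W g \<longleftrightarrow> g \<in> car V \<rightarrow> car W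
    \<and> (\<exists>K. \<forall>x\<in>car V. \<forall>y\<in>car V. nrm W (sub W (g x) (g y)) \<le> K * nrm V (sub V x y))"

lemma linear_map_simps:
  assumes "linear_map V W g"
  shows "x \<in> car V \<Longrightarrow> g x \<in> car W"
    and "\<lbrakk>x \<in> car V; y \<in> car V\<rbrakk> \<Longrightarrow> g (add V x y) = add W (g x) (g y)"
    and "x \<in> car V \<Longrightarrow> g (scl V c x) = scl W c (g x)"
  using assms by (auto simp: linear_map_def)

lemma (in complex_banach) linear_map_sub:
  "\<lbrakk>linear_map V W g; x \<in> car V; y \<in> car V\<rbrakk> \<Longrightarrow> g (sub V x y) = sub W (g x) (g y)"
  by (simp add: sub_def linear_map_simps)

lemma linear_map_zer:
  assumes "complex_banach V" "complex_banach W" "linear_map V W g"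
  shows "g (zer V) = zer W"
proof -
  interpret V: complex_banach V by fact
  interpret W: complex_banach W by fact
  have "g (scl V 0 (zer V)) = scl W 0 (g (zer V))"
    using assms(3) V.zer_closed by (simp only: linear_map_simps)
  then show ?thesis using assms(3) by (simp add: linear_map_simps(1))
qed

context complex_banach
begin

lemma approx_mem: "\<lbrakk>x \<in> X; x \<in> car V\<rbrakk> \<Longrightarrow> approx V X x"
  by (auto simp: approx_def intro!: bexI[of _ x])

lemma closedin_approx: "closedin (norm_top V) U \<longleftrightarrow> U \<subseteq> car V \<and> (\<forall>x. approx V U x \<longrightarrow> x \<in> U)"
proof -
  have "approx V U x \<longleftrightarrow> x \<in> car V \<and> (\<forall>e>0. \<exists>y\<in>U. nrm V (sub V x y) < e)" if "U \<subseteq> car V" for x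
    using that unfolding approx_def by blast
  then show ?thesis unfolding closedin_norm_top by blast
qed

lemma closed_subspace_approx:
  "closed_subspace V U \<longleftrightarrow> subspace_of V U \<and> (\<forall>x. approx V U x \<longrightarrow> x \<in> U)"
  unfolding closed_subspace_def subspace_of_def closedin_approx by blast

lemma approx_lip:
  assumes "complex_banach W" "approx V X x" "lip V W g"
  shows "approx W (g ` (X \<inter> car V)) (g x)"
proof -
  interpret W: complex_banach W by fact
  obtain K where K: "\<And>x y. x \<in> car V \<Longrightarrow> y \<in> car V
      \<Longrightarrow> nrm W (sub W (g x) (g y)) \<le> K * nrm V (sub V x y)"
    and gc: "\<And>x. x \<in> car V \<Longrightarrow> g x \<in> car W"
    using assms(3) by (auto simp: lip_def)
  have x: "x \<in> car V" using assms(2) by (simp add: approx_def)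
  have "\<exists>y\<in>X \<inter> car V. nrm W (sub W (g x) (g y)) < e" if e: "e > 0" for e
  proof -
    have "e / (\<bar>K\<bar> + 1) > 0" using e by simp
    then obtain y where y: "y \<in> X" "y \<in> car V" "nrm V (sub V x y) < e / (\<bar>K\<bar> + 1)"
      using assms(2) unfolding approx_def by blast
    have "nrm W (sub W (g x) (g y)) \<le> K * nrm V (sub V x y)" using K x y by blast
    also have "\<dots> \<le> (\<bar>K\<bar> + 1) * nrm V (sub V x y)"
      using nrm_nonneg x y by (intro mult_right_mono) auto
    also have "\<dots> < e" using y(3) by (simp add: field_simps)
    finally show ?thesis using y by blast
  qed
  then show ?thesis unfolding approx_def using gc x by auto
qed

text \<open>Compare both maps at a point of \<open>X\<close> close to \<open>x\<close>. Equations
  between Lipschitz maps thus pass to closures, which is how solution sets are shown to be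
  closed.\<close>

lemma approx_eq:
  assumes W: "complex_banach W" and x: "approx V X x" and g: "lip V W g" "lip V W h"
    and eq: "\<And>y. y \<in> X \<Longrightarrow> y \<in> car V \<Longrightarrow> g y = h y"
  shows "g x = h x"
proof -
  interpret W: complex_banach W by fact
  obtain K where K: "\<And>x y. x \<in> car V \<Longrightarrow> y \<in> car V
      \<Longrightarrow> nrm W (sub W (g x) (g y)) \<le> K * nrm V (sub V x y)"
    and gc: "\<And>x. x \<in> car V \<Longrightarrow> g x \<in> car W"
    using g(1) by (auto simp: lip_def)
  obtain L where L: "\<And>x y. x \<in> car V \<Longrightarrow> y \<in> car V
      \<Longrightarrow> nrm W (sub W (h x) (h y)) \<le> L * nrm V (sub V x y)"
    and hc: "\<And>x. x \<in> car V \<Longrightarrow> h x \<in> car W"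
    using g(2) by (auto simp: lip_def)
  have xc: "x \<in> car V" using x by (simp add: approx_def)
  have "nrm W (sub W (g x) (h x)) \<le> 0 + e" if e: "e > 0" for e
  proof -
    \<comment> \<open>The summand 1 keeps the denominator positive when both constants are
      0.\<close>
    have "e / (\<bar>K\<bar> + \<bar>L\<bar> + 1) > 0" using e by simp
    then obtain y where y: "y \<in> X" "y \<in> car V" "nrm V (sub V x y) < e / (\<bar>K\<bar> + \<bar>L\<bar> + 1)"
      using x unfolding approx_def by blast
    have "nrm W (sub W (g x) (h x)) \<le> nrm W (sub W (g x) (g y)) + nrm W (sub W (h y) (h x))"
      using W.nrm_sub_triangle[of "g x" "g y" "h x"] eq y gc hc xc by simp
    also have "\<dots> \<le> K * nrm V (sub V x y) + L * nrm V (sub V y x)"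
      using K L xc y by (intro add_mono) auto
    also have "\<dots> = (K + L) * nrm V (sub V x y)"
      using nrm_sub_commute[OF xc y(2)] by (simp add: algebra_simps)
    also have "\<dots> \<le> (\<bar>K\<bar> + \<bar>L\<bar> + 1) * nrm V (sub V x y)"
      using nrm_nonneg xc y by (intro mult_right_mono) auto
    also have "\<dots> \<le> e" using y(3) by (simp add: field_simps)
    finally show ?thesis by simp
  qed
  then have "nrm W (sub W (g x) (h x)) \<le> 0" by (rule field_le_epsilon)
  then have "sub W (g x) (h x) = zer W"
    using W.nrm_nonneg W.nrm_eq_zero gc hc xc by (metis W.sub_closed antisym)
  then show ?thesis using gc hc xc by (simp add: W.sub_eq_zer)
qed

lemma approx_nrm_le:
  assumes "approx V X x" "\<And>y. y \<in> X \<Longrightarrow> nrm V y \<le> B"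
  shows "nrm V x \<le> B"
proof (rule field_le_epsilon)
  fix e :: real assume "e > 0"
  then obtain y where y: "y \<in> X" "y \<in> car V" "nrm V (sub V x y) < e"
    using assms(1) unfolding approx_def by blast
  then show "nrm V x \<le> B + e"
    using nrm_le_sub[of x y] assms(1,2) by (force simp: approx_def)
qed

lemma lip_linear:
  assumes "complex_banach W" "linear_map V W g" "\<And>x. x \<in> car V \<Longrightarrow> nrm W (g x) \<le> K * nrm V x"
  shows "lip V W g"
proof -
  have "nrm W (sub W (g x) (g y)) \<le> K * nrm V (sub V x y)" if "x \<in> car V" "y \<in> car V" for x y
    using assms(3)[of "sub V x y"] linear_map_sub[OF assms(2)] that by simp
  then show ?thesis using assms(2) by (auto simp: lip_def linear_map_def)
qed

lemma lip_id [simp]: "lip V V (\<lambda>x. x)"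
  by (auto simp: lip_def intro!: exI[of _ 1])

lemma lip_const [simp]: "\<lbrakk>complex_banach W; c \<in> car W\<rbrakk> \<Longrightarrow> lip V W (\<lambda>x. c)"
  by (auto simp: lip_def complex_banach.sub_self complex_banach.nrm_zer intro!: exI[of _ 0])

end

lemma lip_comp:
  assumes "complex_banach V" "complex_banach W" "complex_banach X" "lip V W g" "lip W X h"
  shows "lip V X (\<lambda>x. h (g x))"
proof -
  interpret V: complex_banach V by fact
  interpret W: complex_banach W by fact
  obtain K where K: "\<And>x y. x \<in> car V \<Longrightarrow> y \<in> car V
      \<Longrightarrow> nrm W (sub W (g x) (g y)) \<le> K * nrm V (sub V x y)"
    and gc: "\<And>x. x \<in> car V \<Longrightarrow> g x \<in> car W"
    using assms(4) by (auto simp: lip_def)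
  obtain L where L: "\<And>x y. x \<in> car W \<Longrightarrow> y \<in> car W
      \<Longrightarrow> nrm X (sub X (h x) (h y)) \<le> L * nrm W (sub W x y)"
    and hc: "\<And>x. x \<in> car W \<Longrightarrow> h x \<in> car X"
    using assms(5) by (auto simp: lip_def)
  have "nrm X (sub X (h (g x)) (h (g y))) \<le> \<bar>L\<bar> * K * nrm V (sub V x y)"
    if "x \<in> car V" "y \<in> car V" for x y
  proof -
    have "nrm X (sub X (h (g x)) (h (g y))) \<le> L * nrm W (sub W (g x) (g y))"
      using L gc that by blast
    also have "\<dots> \<le> \<bar>L\<bar> * nrm W (sub W (g x) (g y))"
      using W.nrm_nonneg gc that by (intro mult_right_mono) auto
    also have "\<dots> \<le> \<bar>L\<bar> * (K * nrm V (sub V x y))"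
      using K that by (intro mult_left_mono) auto
    finally show ?thesis by (simp add: mult.assoc)
  qed
  then show ?thesis using gc hc by (auto simp: lip_def)
qed

section \<open>C*-algebra basics\<close>

context cstar_algebra
begin

declare mul_closed [simp] star_closed [simp] star_star [simp]

lemma banach: "complex_banach A"
  by (rule complex_banach_axioms)

lemma mul_zer_left [simp]: "x \<in> car A \<Longrightarrow> zer A \<cdot>\<^bsub>A\<^esub> x = zer A"
  using mul_scl_left[of "zer A" x 0] by simp

lemma mul_zer_right [simp]: "x \<in> car A \<Longrightarrow> x \<cdot>\<^bsub>A\<^esub> zer A = zer A"
  using mul_scl_right[of x "zer A" 0] by simp

lemma star_zer [simp]: "star A (zer A) = zer A"
  using star_scl[of "zer A" 0] by simp

lemma mul_sub_left: "\<lbrakk>x \<in> car A; y \<in> car A; z \<in> car A\<rbrakk>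
    \<Longrightarrow> sub A x y \<cdot>\<^bsub>A\<^esub> z = sub A (x \<cdot>\<^bsub>A\<^esub> z) (y \<cdot>\<^bsub>A\<^esub> z)"
  by (simp add: sub_def mul_add_left mul_scl_left)

lemma mul_sub_right: "\<lbrakk>x \<in> car A; y \<in> car A; z \<in> car A\<rbrakk>
    \<Longrightarrow> x \<cdot>\<^bsub>A\<^esub> sub A y z = sub A (x \<cdot>\<^bsub>A\<^esub> y) (x \<cdot>\<^bsub>A\<^esub> z)"
  by (simp add: sub_def mul_add_right mul_scl_right)

lemma star_sub: "\<lbrakk>x \<in> car A; y \<in> car A\<rbrakk> \<Longrightarrow> star A (sub A x y) = sub A (star A x) (star A y)"
  by (simp add: sub_def star_add star_scl)

lemmas alg_simps = mul_add_left mul_add_right mul_scl_left mul_scl_right mul_sub_left mul_sub_right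
  star_add star_scl star_mul star_sub mul_assoc

lemma nrm_star [simp]:
  assumes x: "x \<in> car A" shows "nrm A (star A x) = nrm A x"
proof -
  have le: "nrm A y \<le> nrm A (star A y)" if y: "y \<in> car A" for y
  proof (cases "nrm A y = 0")
    case False
    have "nrm A y * nrm A y \<le> nrm A (star A y) * nrm A y"
      using cstar_identity[OF y] nrm_mul[of "star A y" y] y by (simp add: power2_eq_square)
    then show ?thesis using False nrm_nonneg[OF y] by simp
  qed (use y nrm_nonneg in simp)
  show ?thesis using le[OF x] le[of "star A x"] x by simp
qed

lemma cstar_identity': "x \<in> car A \<Longrightarrow> nrm A (x \<cdot>\<^bsub>A\<^esub> star A x) = (nrm A x)\<^sup>2"
  using cstar_identity[of "star A x"] by simp

lemma star_mul_zero: "\<lbrakk>x \<in> car A; star A x \<cdot>\<^bsub>A\<^esub> x = zer A\<rbrakk> \<Longrightarrow> x = zer A"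
  using cstar_identity[of x] nrm_eq_zero[of x] by simp

lemma mul_star_zero: "\<lbrakk>x \<in> car A; x \<cdot>\<^bsub>A\<^esub> star A x = zer A\<rbrakk> \<Longrightarrow> x = zer A"
  using cstar_identity'[of x] nrm_eq_zero[of x] by simp

text \<open>With \<open>z\<close> the adjoint of the difference \<open>d\<close> of \<open>x\<close>
  and \<open>y\<close>, the hypothesis gives \<open>d d\<^sup>* = 0\<close>. Identities involving
  multipliers can therefore be tested on products.\<close>

lemma eq_by_right_mult:
  assumes "x \<in> car A" "y \<in> car A" "\<And>z. z \<in> car A \<Longrightarrow> x \<cdot>\<^bsub>A\<^esub> z = y \<cdot>\<^bsub>A\<^esub> z"
  shows "x = y"
proof -
  have "sub A x y \<cdot>\<^bsub>A\<^esub> star A (sub A x y) = zer A"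
    using assms by (simp add: mul_sub_left)
  then show ?thesis using mul_star_zero[of "sub A x y"] assms by (simp add: sub_eq_zer)
qed

lemma eq_by_left_mult:
  assumes "x \<in> car A" "y \<in> car A" "\<And>z. z \<in> car A \<Longrightarrow> z \<cdot>\<^bsub>A\<^esub> x = z \<cdot>\<^bsub>A\<^esub> y"
  shows "x = y"
proof -
  have "star A (sub A x y) \<cdot>\<^bsub>A\<^esub> sub A x y = zer A"
    using assms by (simp add: mul_sub_right)
  then show ?thesis using star_mul_zero[of "sub A x y"] assms by (simp add: sub_eq_zer)
qed

lemma nrm_mul_le: "\<lbrakk>x \<in> car A; y \<in> car A; nrm A x \<le> a; nrm A y \<le> b\<rbrakk> \<Longrightarrow> nrm A (x \<cdot>\<^bsub>A\<^esub> y) \<le> a * b"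
  using nrm_mul[of x y] mult_mono[of "nrm A x" a "nrm A y" b] nrm_nonneg
  by (meson order_trans)

lemma lip_mul_left: "a \<in> car A \<Longrightarrow> lip A A (\<lambda>x. a \<cdot>\<^bsub>A\<^esub> x)"
  by (rule lip_linear[OF banach, where K = "nrm A a"])
    (auto simp: linear_map_def alg_simps nrm_mul)

lemma lip_mul_right: "a \<in> car A \<Longrightarrow> lip A A (\<lambda>x. x \<cdot>\<^bsub>A\<^esub> a)"
  by (rule lip_linear[OF banach, where K = "nrm A a"])
    (auto simp: linear_map_def alg_simps nrm_mul mult.commute[of "nrm A a"])

lemma lip_star: "lip A A (star A)"
  unfolding lip_def by (auto simp: star_sub[symmetric] intro!: exI[of _ 1])

lemma lip_scl: "lip A A (scl A c)"
  by (rule lip_linear[OF banach, where K = "cmod c"])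
    (auto simp: linear_map_def scl_add_right scl_scl mult.commute nrm_scl)

text \<open>The cross terms \<open>c y\<^sup>* z\<close> and \<open>cnj c z\<^sup>* y\<close> cancel
  because \<open>c\<close> is imaginary. This Pythagorean identity, the same for both signs, stands
  in for the unitarity of \<open>a + \<i>b\<close> with commuting self-adjoint parts and
  \<open>a\<^sup>2 + b\<^sup>2 = 1\<close>.\<close>

lemma nrm_plus_i:
  assumes yz: "y \<in> car A" "z \<in> car A" "star A y \<cdot>\<^bsub>A\<^esub> z = star A z \<cdot>\<^bsub>A\<^esub> y" and c: "c = \<i> \<or> c = -\<i>"
  shows "(nrm A (add A y (scl A c z)))\<^sup>2 = nrm A (add A (star A y \<cdot>\<^bsub>A\<^esub> y) (star A z \<cdot>\<^bsub>A\<^esub> z))"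
proof -
  have "star A (add A y (scl A c z)) \<cdot>\<^bsub>A\<^esub> add A y (scl A c z)
      = add A (star A y \<cdot>\<^bsub>A\<^esub> y) (star A z \<cdot>\<^bsub>A\<^esub> z)"
    using yz c by (intro vec_eqI) (auto simp: functional_simps alg_simps algebra_simps)
  then show ?thesis using cstar_identity[of "add A y (scl A c z)"] yz by simp
qed

text \<open>The square root of \<open>1 - a\<^sup>2\<close> is \<open>1 - c\<close>.\<close>

lemma quasi_sqrt:
  assumes a: "a \<in> car A" "star A a = a" "nrm A a < 1"
  obtains c where "c \<in> car A" "star A c = c" "c \<cdot>\<^bsub>A\<^esub> a = a \<cdot>\<^bsub>A\<^esub> c"
    "add A c c = add A (a \<cdot>\<^bsub>A\<^esub> a) (c \<cdot>\<^bsub>A\<^esub> c)"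
proof -
  let ?s = "nrm A a"
  \<comment> \<open>A fixed point of \<open>?g\<close> satisfies
    \<open>2 c = a\<^sup>2 + c\<^sup>2\<close>, that is
    \<open>(1 - c)\<^sup>2 = 1 - a\<^sup>2\<close>. On the ball of radius \<open>?s\<close> the map
    contracts by the factor \<open>?s\<close>.\<close>
  let ?X = "{c \<in> car A. nrm A c \<le> ?s \<and> star A c = c \<and> c \<cdot>\<^bsub>A\<^esub> a = a \<cdot>\<^bsub>A\<^esub> c}"
  let ?g = "\<lambda>c. scl A (1/2) (add A (a \<cdot>\<^bsub>A\<^esub> a) (c \<cdot>\<^bsub>A\<^esub> c))"
  have s: "0 \<le> ?s" using a nrm_nonneg by simp
  have sq: "?s * ?s \<le> ?s" using a(3) s by (simp add: mult_left_le_one_le)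
  have "closedin (norm_top A) ?X"
    unfolding closedin_approx
  proof (intro conjI allI impI)
    fix x assume x: "approx A ?X x"
    have "nrm A x \<le> ?s" by (rule approx_nrm_le[OF x]) simp
    moreover have "star A x = x"
      by (rule approx_eq[OF banach x lip_star lip_id]) simp
    moreover have "x \<cdot>\<^bsub>A\<^esub> a = a \<cdot>\<^bsub>A\<^esub> x"
      by (rule approx_eq[OF banach x lip_mul_right lip_mul_left]) (use a in simp_all)
    ultimately show "x \<in> ?X" using x by (simp add: approx_def)
  qed auto
  moreover have "a \<in> ?X" using a by simp
  moreover have "?g c \<in> ?X" if c: "c \<in> ?X" for c
  proof -
    have "nrm A (?g c) \<le> 1/2 * (nrm A (a \<cdot>\<^bsub>A\<^esub> a) + nrm A (c \<cdot>\<^bsub>A\<^esub> c))"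
      using a c nrm_triangle[of "a \<cdot>\<^bsub>A\<^esub> a" "c \<cdot>\<^bsub>A\<^esub> c"] by (simp add: nrm_scl)
    also have "\<dots> \<le> 1/2 * (?s * ?s + ?s * ?s)"
      using a c nrm_mul_le[of a a ?s ?s] nrm_mul_le[of c c ?s ?s] by simp
    also have "\<dots> \<le> ?s" using sq by simp
    finally have "nrm A (?g c) \<le> ?s" .
    moreover have "c \<cdot>\<^bsub>A\<^esub> c \<cdot>\<^bsub>A\<^esub> a = a \<cdot>\<^bsub>A\<^esub> (c \<cdot>\<^bsub>A\<^esub> c)"
    proof -
      have cc: "c \<in> car A" "c \<cdot>\<^bsub>A\<^esub> a = a \<cdot>\<^bsub>A\<^esub> c" using c by auto
      have "c \<cdot>\<^bsub>A\<^esub> c \<cdot>\<^bsub>A\<^esub> a = c \<cdot>\<^bsub>A\<^esub> (c \<cdot>\<^bsub>A\<^esub> a)" using a cc(1) by (simp add: mul_assoc)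
      also have "\<dots> = c \<cdot>\<^bsub>A\<^esub> (a \<cdot>\<^bsub>A\<^esub> c)" unfolding cc(2) ..
      also have "\<dots> = c \<cdot>\<^bsub>A\<^esub> a \<cdot>\<^bsub>A\<^esub> c" using a cc(1) by (simp add: mul_assoc)
      also have "\<dots> = a \<cdot>\<^bsub>A\<^esub> (c \<cdot>\<^bsub>A\<^esub> c)" unfolding cc(2) using a cc(1) by (simp add: mul_assoc)
      finally show ?thesis .
    qed
    ultimately show ?thesis using a c by (simp add: alg_simps)
  qed
  moreover have "nrm A (sub A (?g x) (?g y)) \<le> ?s * nrm A (sub A x y)" if "x \<in> ?X" "y \<in> ?X" for x y
  proof -
    \<comment> \<open>Noncommutative difference of squares:
      \<open>x\<^sup>2 - y\<^sup>2 = x (x - y) + (x - y) y\<close>.\<close>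
    have "sub A (?g x) (?g y)
        = scl A (1/2) (add A (x \<cdot>\<^bsub>A\<^esub> sub A x y) (sub A x y \<cdot>\<^bsub>A\<^esub> y))"
      using that a by (intro vec_eqI) (auto simp: functional_simps alg_simps algebra_simps)
    then have "nrm A (sub A (?g x) (?g y))
        \<le> 1/2 * (nrm A (x \<cdot>\<^bsub>A\<^esub> sub A x y) + nrm A (sub A x y \<cdot>\<^bsub>A\<^esub> y))"
      using that nrm_triangle by (simp add: nrm_scl)
    also have "\<dots> \<le> 1/2 * (?s * nrm A (sub A x y) + nrm A (sub A x y) * ?s)"
      using that nrm_mul_le[of x "sub A x y" ?s "nrm A (sub A x y)"]
        nrm_mul_le[of "sub A x y" y "nrm A (sub A x y)" ?s] by (simp add: mult.commute)
    finally show ?thesis by (simp add: algebra_simps)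
  qed
  ultimately obtain c where c: "c \<in> ?X" "?g c = c"
    using fixed_point[of ?X a ?g ?s] s a(3) by blast
  have "add A c c = add A (a \<cdot>\<^bsub>A\<^esub> a) (c \<cdot>\<^bsub>A\<^esub> c)"
  proof (rule vec_eqI)
    fix f assume f: "functional A f"
    have "f (?g c) = f c" using c by simp
    then show "f (add A c c) = f (add A (a \<cdot>\<^bsub>A\<^esub> a) (c \<cdot>\<^bsub>A\<^esub> c))"
      using f a c(1) by (simp add: functional_simps)
  qed (use a c in simp_all)
  with c show thesis using that by blast
qed

end

lemma cstar_hom_simps:
  assumes "cstar_hom A B g"
  shows "x \<in> car A \<Longrightarrow> g x \<in> car B"
    and "\<lbrakk>x \<in> car A; y \<in> car A\<rbrakk> \<Longrightarrow> g (add A x y) = add B (g x) (g y)"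
    and "x \<in> car A \<Longrightarrow> g (scl A c x) = scl B c (g x)"
    and "\<lbrakk>x \<in> car A; y \<in> car A\<rbrakk> \<Longrightarrow> g (x \<cdot>\<^bsub>A\<^esub> y) = g x \<cdot>\<^bsub>B\<^esub> g y"
    and "x \<in> car A \<Longrightarrow> g (star A x) = star B (g x)"
  using assms by (auto simp: cstar_hom_def linear_map_def)

lemma cstar_hom_linear: "cstar_hom A B g \<Longrightarrow> linear_map A B g"
  by (simp add: cstar_hom_def)

text \<open>For self-adjoint \<open>a\<close> of norm less than 1 with quasi square root \<open>c\<close>, the images \<open>h\<close>, \<open>k\<close>
  make \<open>1 - k + \<i>h\<close> and its adjoint unitary, and \<open>h\<close> is a combination of both.\<close>

lemma cstar_hom_contractive:
  assumes AB: "cstar_algebra A" "cstar_algebra B" and g: "cstar_hom A B g" and x: "x \<in> car A"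
  shows "nrm B (g x) \<le> nrm A x"
proof -
  interpret A: cstar_algebra A by fact
  interpret B: cstar_algebra B by fact
  note gs [simp] = cstar_hom_simps[OF g]
  have sa1: "nrm B (g a) \<le> 1" if a: "a \<in> car A" "star A a = a" "nrm A a < 1" for a
  proof -
    obtain c where c: "c \<in> car A" "star A c = c" "c \<cdot>\<^bsub>A\<^esub> a = a \<cdot>\<^bsub>A\<^esub> c"
      "add A c c = add A (a \<cdot>\<^bsub>A\<^esub> a) (c \<cdot>\<^bsub>A\<^esub> c)"
      using A.quasi_sqrt[OF a] by blast
    define h k where "h = g a" and "k = g c"
    have hk [simp]: "h \<in> car B" "k \<in> car B" and st: "star B h = h" "star B k = k"
      using a c by (simp_all add: h_def k_def flip: gs(5))
    have cm: "k \<cdot>\<^bsub>B\<^esub> h = h \<cdot>\<^bsub>B\<^esub> k" and eq: "add B k k = add B (h \<cdot>\<^bsub>B\<^esub> h) (k \<cdot>\<^bsub>B\<^esub> k)"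
      using a c by (simp_all add: h_def k_def flip: gs(2,4))
    \<comment> \<open>\<open>y\<close> and \<open>z\<close> are the two parts of
      \<open>(1 - k + \<i>h) h\<close>; the extra factor \<open>h\<close> makes a unit
      unnecessary.\<close>
    define y where "y = sub B h (k \<cdot>\<^bsub>B\<^esub> h)"
    define z where "z = h \<cdot>\<^bsub>B\<^esub> h"
    have [simp]: "y \<in> car B" "z \<in> car B" by (simp_all add: y_def z_def)
    have cm': "k \<cdot>\<^bsub>B\<^esub> (h \<cdot>\<^bsub>B\<^esub> u) = h \<cdot>\<^bsub>B\<^esub> (k \<cdot>\<^bsub>B\<^esub> u)" if "u \<in> car B" for u
      using cm that by (simp flip: B.mul_assoc)
    have eq': "f (k \<cdot>\<^bsub>B\<^esub> u) + f (k \<cdot>\<^bsub>B\<^esub> u) = f (h \<cdot>\<^bsub>B\<^esub> (h \<cdot>\<^bsub>B\<^esub> u)) + f (k \<cdot>\<^bsub>B\<^esub> (k \<cdot>\<^bsub>B\<^esub> u))"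
      if "u \<in> car B" "functional B f" for u f
    proof -
      have "f (add B k k \<cdot>\<^bsub>B\<^esub> u) = f (add B (h \<cdot>\<^bsub>B\<^esub> h) (k \<cdot>\<^bsub>B\<^esub> k) \<cdot>\<^bsub>B\<^esub> u)" using eq by simp
      then show ?thesis using that by (simp add: B.alg_simps B.functional_simps)
    qed
    have yz: "star B y \<cdot>\<^bsub>B\<^esub> z = star B z \<cdot>\<^bsub>B\<^esub> y"
      unfolding y_def z_def
      by (rule B.vec_eqI) (auto simp: B.alg_simps B.functional_simps st cm cm')
    \<comment> \<open>The left side is \<open>h ((1 - k)\<^sup>2 + h\<^sup>2) h\<close>, whose
      middle factor is 1 by the equation for \<open>k\<close>.\<close>
    have "add B (star B y \<cdot>\<^bsub>B\<^esub> y) (star B z \<cdot>\<^bsub>B\<^esub> z) = star B h \<cdot>\<^bsub>B\<^esub> h"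
    proof (rule B.vec_eqI)
      fix f assume f: "functional B f"
      have "f (h \<cdot>\<^bsub>B\<^esub> (k \<cdot>\<^bsub>B\<^esub> h)) + f (h \<cdot>\<^bsub>B\<^esub> (k \<cdot>\<^bsub>B\<^esub> h))
          = f (h \<cdot>\<^bsub>B\<^esub> (h \<cdot>\<^bsub>B\<^esub> (h \<cdot>\<^bsub>B\<^esub> h))) + f (h \<cdot>\<^bsub>B\<^esub> (k \<cdot>\<^bsub>B\<^esub> (k \<cdot>\<^bsub>B\<^esub> h)))"
        using eq'[of "h \<cdot>\<^bsub>B\<^esub> h" f] f by (simp add: cm')
      then show "f (add B (star B y \<cdot>\<^bsub>B\<^esub> y) (star B z \<cdot>\<^bsub>B\<^esub> z)) = f (star B h \<cdot>\<^bsub>B\<^esub> h)"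
        using f unfolding y_def z_def
        by (simp add: B.alg_simps B.functional_simps st cm cm' algebra_simps)
    qed simp_all
    then have U: "nrm B (add B y (scl B d z)) = nrm B h" if "d = \<i> \<or> d = - \<i>" for d
      using B.nrm_plus_i[OF _ _ yz that] B.cstar_identity[of h] B.nrm_nonneg
      by (simp add: power2_eq_iff_nonneg)
    \<comment> \<open>\<open>z = h\<^sup>2\<close> is half a difference of two elements of norm
      \<open>nrm B h\<close>, up to a scalar of modulus 1. Hence \<open>nrm B h\<close> squared is
      at most \<open>nrm B h\<close>.\<close>
    have "z = scl B (- \<i> / 2) (sub B (add B y (scl B \<i> z)) (add B y (scl B (-\<i>) z)))"
      by (rule B.vec_eqI) (auto simp: B.functional_simps algebra_simps)
    then have "nrm B z = nrm B (scl B (- \<i> / 2) (sub B (add B y (scl B \<i> z)) (add B y (scl B (-\<i>) z))))"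
      by (rule arg_cong)
    also have "\<dots> \<le> 1/2 * (nrm B (add B y (scl B \<i> z)) + nrm B (add B y (scl B (-\<i>) z)))"
      using B.nrm_sub_le[of "add B y (scl B \<i> z)" "add B y (scl B (-\<i>) z)"]
      by (simp add: B.nrm_scl norm_divide)
    also have "\<dots> = nrm B h" using U by simp
    finally have "nrm B h * nrm B h \<le> nrm B h"
      using B.cstar_identity[of h] st by (simp add: z_def power2_eq_square)
    then show ?thesis using B.nrm_nonneg[of h] hk(1) le_one_of_square_le unfolding h_def by blast
  qed
  have sa: "nrm B (g a) \<le> nrm A a" if a: "a \<in> car A" "star A a = a" for a
  proof (rule field_le_epsilon)
    fix e :: real assume e: "e > 0"
    \<comment> \<open>The summand \<open>e\<close> makes the rescaled element strictly smaller than
      1 in norm, and \<open>r\<close> positive even for \<open>a = 0\<close>.\<close>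
    define r where "r = nrm A a + e"
    have r: "r > 0" "nrm A a < r" using e A.nrm_nonneg[OF a(1)] by (simp_all add: r_def)
    have "nrm B (g (scl A (of_real (1 / r)) a)) \<le> 1"
      using a r by (intro sa1) (auto simp: A.alg_simps A.nrm_scl norm_divide)
    then show "nrm B (g a) \<le> nrm A a + e"
      using a r(1) unfolding r_def[symmetric] by (simp add: B.nrm_scl norm_divide field_simps)
  qed
  have "(nrm B (g x))\<^sup>2 = nrm B (g (star A x \<cdot>\<^bsub>A\<^esub> x))"
    using x B.cstar_identity[of "g x"] by simp
  also have "\<dots> \<le> nrm A (star A x \<cdot>\<^bsub>A\<^esub> x)"
    using x by (intro sa) (auto simp: A.alg_simps)
  also have "\<dots> = (nrm A x)\<^sup>2" using x A.cstar_identity by simp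
  finally show ?thesis using A.nrm_nonneg[OF x] power2_le_imp_le by blast
qed

lemma cstar_hom_lip:
  assumes "cstar_algebra A" "cstar_algebra B" "cstar_hom A B g"
  shows "lip A B g"
proof -
  interpret A: cstar_algebra A by fact
  interpret B: cstar_algebra B by fact
  show ?thesis
    using A.lip_linear[OF B.banach cstar_hom_linear[OF assms(3)], of 1]
      cstar_hom_contractive[OF assms] by simp
qed

section \<open>Resolvents and Cohen factorisation\<close>

definition cstar_sub :: "'a cstar \<Rightarrow> 'a set \<Rightarrow> bool" where
  "cstar_sub A G \<longleftrightarrow> closed_subspace A G \<and> (\<forall>x\<in>G. \<forall>y\<in>G. x \<cdot>\<^bsub>A\<^esub> y \<in> G) \<and> (\<forall>x\<in>G. star A x \<in> G)"

context cstar_algebra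
begin

text \<open>\<open>w\<close> is \<open>h (h + \<i>v)\<^sup>-\<^sup>1\<close>. Its Cayley transform \<open>1 - 2w\<close> is unitary, so that \<open>w\<close> and \<open>1 - w\<close>
  are contractions.\<close>

definition resolvent :: "'a \<Rightarrow> real \<Rightarrow> 'a \<Rightarrow> bool" where
  "resolvent h v w \<longleftrightarrow> w \<in> car A \<and> add A (h \<cdot>\<^bsub>A\<^esub> w) (scl A (\<i> * v) w) = h
    \<and> (\<forall>y\<in>car A. y \<cdot>\<^bsub>A\<^esub> h = h \<cdot>\<^bsub>A\<^esub> y \<longrightarrow> y \<cdot>\<^bsub>A\<^esub> w = w \<cdot>\<^bsub>A\<^esub> y)"

text \<open>The equation \<open>(h + \<i>v) w = h\<close> is rewritten as
  \<open>\<i>(s + v) w = h - (h - \<i>s) w\<close>. Multiplication by \<open>h - \<i>s\<close> has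
  norm at most \<open>sqrt ((nrm A h)\<^sup>2 + s\<^sup>2)\<close>, which is less than
  \<open>s + v\<close> for a suitable \<open>s\<close>, so iteration converges.\<close>

lemma resolvent_exists:
  assumes G: "cstar_sub A G" "h \<in> G" "star A h = h" and v: "v > 0"
  obtains w where "w \<in> G" "resolvent h v w"
proof -
  have Gs: "closed_subspace A G" "G \<subseteq> car A" "zer A \<in> G"
    "\<And>x y. x \<in> G \<Longrightarrow> y \<in> G \<Longrightarrow> add A x y \<in> G" "\<And>x y. x \<in> G \<Longrightarrow> y \<in> G \<Longrightarrow> x \<cdot>\<^bsub>A\<^esub> y \<in> G"
    "\<And>c x. x \<in> G \<Longrightarrow> scl A c x \<in> G"
    using G(1) by (auto simp: cstar_sub_def closed_subspace_def)
  have h: "h \<in> car A" using Gs G by auto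
  \<comment> \<open>With \<open>s v = (nrm A h)\<^sup>2\<close> the cross term of
    \<open>(s + v)\<^sup>2\<close> is \<open>2 (nrm A h)\<^sup>2\<close>, which makes
    \<open>k < 1\<close>.\<close>
  define s where "s = (nrm A h)\<^sup>2 / v"
  have s: "s \<ge> 0" using v by (simp add: s_def)
  define k where "k = sqrt ((nrm A h)\<^sup>2 + s\<^sup>2) / (s + v)"
  have k: "0 \<le> k" "k < 1"
  proof -
    show "0 \<le> k" using s v by (simp add: k_def)
    have "s * v = (nrm A h)\<^sup>2" using v by (simp add: s_def)
    then have "(nrm A h)\<^sup>2 + s\<^sup>2 < (s + v)\<^sup>2"
    proof -
      have "(s + v)\<^sup>2 = s\<^sup>2 + 2 * (nrm A h)\<^sup>2 + v\<^sup>2"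
        using \<open>s * v = (nrm A h)\<^sup>2\<close> by (simp add: power2_sum)
      moreover have "v\<^sup>2 > 0" using v by simp
      ultimately show ?thesis using zero_le_power2[of "nrm A h"] by linarith
    qed
    then have "sqrt ((nrm A h)\<^sup>2 + s\<^sup>2) < s + v"
      using s v by (intro real_less_lsqrt) auto
    then show "k < 1" using s v by (simp add: k_def)
  qed
  let ?d = "1 / (\<i> * (s + v)) :: complex"
  let ?g = "\<lambda>w. scl A ?d (sub A h (sub A (h \<cdot>\<^bsub>A\<^esub> w) (scl A (\<i> * s) w)))"
  \<comment> \<open>Commutation is built into the closed set, so the fixed point inherits it; it
    makes the resolvents of one element commute with each other.\<close>
  let ?X = "{w \<in> G. \<forall>y\<in>car A. y \<cdot>\<^bsub>A\<^esub> h = h \<cdot>\<^bsub>A\<^esub> y \<longrightarrow> y \<cdot>\<^bsub>A\<^esub> w = w \<cdot>\<^bsub>A\<^esub> y}"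
  have "closedin (norm_top A) ?X"
    unfolding closedin_approx
  proof (intro conjI allI impI)
    show "?X \<subseteq> car A" using Gs by auto
    fix x assume x: "approx A ?X x"
    have "approx A G x" using x unfolding approx_def by blast
    then have "x \<in> G" using Gs(1) closed_subspace_approx by blast
    moreover have "y \<cdot>\<^bsub>A\<^esub> x = x \<cdot>\<^bsub>A\<^esub> y" if "y \<in> car A" "y \<cdot>\<^bsub>A\<^esub> h = h \<cdot>\<^bsub>A\<^esub> y" for y
      by (rule approx_eq[OF banach x lip_mul_left lip_mul_right]) (use that in simp_all)
    ultimately show "x \<in> ?X" by blast
  qed
  moreover have "zer A \<in> ?X" using Gs by simp
  moreover have "?g w \<in> ?X" if w: "w \<in> ?X" for w
  proof -
    have wc: "w \<in> car A" using w Gs by auto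
    have "?g w \<in> G" using w Gs G(2) unfolding sub_def by simp
    moreover have "y \<cdot>\<^bsub>A\<^esub> ?g w = ?g w \<cdot>\<^bsub>A\<^esub> y" if y: "y \<in> car A" "y \<cdot>\<^bsub>A\<^esub> h = h \<cdot>\<^bsub>A\<^esub> y" for y
    proof -
      have yw: "y \<cdot>\<^bsub>A\<^esub> w = w \<cdot>\<^bsub>A\<^esub> y" using w y by blast
      have "y \<cdot>\<^bsub>A\<^esub> (h \<cdot>\<^bsub>A\<^esub> w) = y \<cdot>\<^bsub>A\<^esub> h \<cdot>\<^bsub>A\<^esub> w" using y(1) h wc by (simp add: mul_assoc)
      also have "\<dots> = h \<cdot>\<^bsub>A\<^esub> (w \<cdot>\<^bsub>A\<^esub> y)" using y h wc yw by (simp add: mul_assoc)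
      finally show ?thesis using y h wc yw by (simp add: alg_simps)
    qed
    ultimately show ?thesis by blast
  qed
  moreover have "nrm A (sub A (?g x) (?g y)) \<le> k * nrm A (sub A x y)" if "x \<in> ?X" "y \<in> ?X" for x y
  proof -
    have xy: "x \<in> car A" "y \<in> car A" using that Gs by auto
    define u where "u = sub A x y"
    have u: "u \<in> car A" using xy by (simp add: u_def)
    define z where "z = scl A (of_real s) u"
    have z: "z \<in> car A" using u by (simp add: z_def)
    have "(nrm A (add A (h \<cdot>\<^bsub>A\<^esub> u) (scl A (-\<i>) z)))\<^sup>2
        = nrm A (add A (star A (h \<cdot>\<^bsub>A\<^esub> u) \<cdot>\<^bsub>A\<^esub> (h \<cdot>\<^bsub>A\<^esub> u)) (star A z \<cdot>\<^bsub>A\<^esub> z))"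
      using h u z G(3) by (intro nrm_plus_i) (auto simp: z_def alg_simps)
    also have "\<dots> \<le> nrm A (star A (h \<cdot>\<^bsub>A\<^esub> u) \<cdot>\<^bsub>A\<^esub> (h \<cdot>\<^bsub>A\<^esub> u)) + nrm A (star A z \<cdot>\<^bsub>A\<^esub> z)"
      using h u z by (intro nrm_triangle) auto
    also have "\<dots> = (nrm A (h \<cdot>\<^bsub>A\<^esub> u))\<^sup>2 + s\<^sup>2 * (nrm A u)\<^sup>2"
      using h u z by (simp only: cstar_identity mul_closed) (simp add: z_def nrm_scl power_mult_distrib)
    also have "\<dots> \<le> (nrm A h * nrm A u)\<^sup>2 + s\<^sup>2 * (nrm A u)\<^sup>2"
      using h u nrm_nonneg by (intro add_right_mono power_mono nrm_mul) auto
    also have "\<dots> = (sqrt ((nrm A h)\<^sup>2 + s\<^sup>2) * nrm A u)\<^sup>2"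
      by (simp add: power_mult_distrib algebra_simps)
    finally have le: "nrm A (add A (h \<cdot>\<^bsub>A\<^esub> u) (scl A (-\<i>) z)) \<le> sqrt ((nrm A h)\<^sup>2 + s\<^sup>2) * nrm A u"
      using nrm_nonneg[OF u] by (auto intro: power2_le_imp_le)
    have "sub A (?g x) (?g y) = scl A (- ?d) (add A (h \<cdot>\<^bsub>A\<^esub> u) (scl A (-\<i>) z))"
      using h xy by (intro vec_eqI)
        (auto simp: functional_simps alg_simps u_def z_def algebra_simps
          add_divide_distrib diff_divide_distrib)
    then have "nrm A (sub A (?g x) (?g y)) = cmod ?d * nrm A (add A (h \<cdot>\<^bsub>A\<^esub> u) (scl A (-\<i>) z))"
      using h u z by (simp add: nrm_scl)
    also have "cmod ?d = 1 / (s + v)"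
      using s v by (simp add: norm_divide norm_mult flip: of_real_add)
    finally show ?thesis using le s v by (simp add: k_def u_def field_simps)
  qed
  ultimately obtain w where w: "w \<in> ?X" "?g w = w"
    using fixed_point[of ?X "zer A" ?g k] k by blast
  have wc: "w \<in> car A" using w Gs by auto
  have "scl A (\<i> * (s + v)) (?g w) = scl A (\<i> * (s + v)) w" using w by simp
  moreover have "\<i> * (complex_of_real s + complex_of_real v) \<noteq> 0"
    using s v by (simp flip: of_real_add)
  ultimately have e: "sub A h (sub A (h \<cdot>\<^bsub>A\<^esub> w) (scl A (\<i> * s) w)) = scl A (\<i> * (s + v)) w"
    using h wc by (simp add: scl_scl)
  have "add A (h \<cdot>\<^bsub>A\<^esub> w) (scl A (\<i> * v) w) = h"
  proof (rule vec_eqI)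
    fix f assume f: "functional A f"
    have "f (sub A h (sub A (h \<cdot>\<^bsub>A\<^esub> w) (scl A (\<i> * s) w))) = f (scl A (\<i> * (s + v)) w)"
      using e by simp
    then show "f (add A (h \<cdot>\<^bsub>A\<^esub> w) (scl A (\<i> * v) w)) = f h"
      using f h wc by (simp add: functional_simps algebra_simps)
  qed (use h wc in simp_all)
  then show thesis using that[of w] w wc unfolding resolvent_def by blast
qed

text \<open>For \<open>x = (h + \<i>v)\<^sup>-\<^sup>1 z\<close> the elements
  \<open>h x + \<i>v x = z\<close> and \<open>h x - \<i>v x = 2 w z - z\<close> have equal norms by
  \<open>nrm_plus_i\<close>. Half their sum is \<open>w z\<close>, half their difference
  \<open>z - w z\<close>.\<close>

lemma resolvent_contraction:
  assumes w: "resolvent h v w" and h: "h \<in> car A" "star A h = h" and v: "v > 0" and z: "z \<in> car A"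
  shows "nrm A (w \<cdot>\<^bsub>A\<^esub> z) \<le> nrm A z" and "nrm A (sub A z (w \<cdot>\<^bsub>A\<^esub> z)) \<le> nrm A z"
proof -
  have wc: "w \<in> car A" and eq: "add A (h \<cdot>\<^bsub>A\<^esub> w) (scl A (\<i> * v) w) = h"
    using w by (auto simp: resolvent_def)
  have eqf: "f (h \<cdot>\<^bsub>A\<^esub> (w \<cdot>\<^bsub>A\<^esub> z)) + \<i> * v * f (w \<cdot>\<^bsub>A\<^esub> z) = f (h \<cdot>\<^bsub>A\<^esub> z)" if "functional A f" for f
  proof -
    have "f (add A (h \<cdot>\<^bsub>A\<^esub> w) (scl A (\<i> * v) w) \<cdot>\<^bsub>A\<^esub> z) = f (h \<cdot>\<^bsub>A\<^esub> z)" using eq by simp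
    then show ?thesis using that wc h z by (simp add: functional_simps alg_simps)
  qed
  define x where "x = scl A (1 / (\<i> * v)) (sub A z (w \<cdot>\<^bsub>A\<^esub> z))"
  define y where "y = scl A (of_real v) x"
  have x: "x \<in> car A" and y: "y \<in> car A" using z wc by (simp_all add: x_def y_def)
  have comm: "star A (h \<cdot>\<^bsub>A\<^esub> x) \<cdot>\<^bsub>A\<^esub> y = star A y \<cdot>\<^bsub>A\<^esub> (h \<cdot>\<^bsub>A\<^esub> x)"
    using h x by (simp add: y_def alg_simps)
  have "(nrm A (add A (h \<cdot>\<^bsub>A\<^esub> x) (scl A \<i> y)))\<^sup>2 = (nrm A (add A (h \<cdot>\<^bsub>A\<^esub> x) (scl A (-\<i>) y)))\<^sup>2"
    using nrm_plus_i[OF _ y comm, of \<i>] nrm_plus_i[OF _ y comm, of "-\<i>"] h x by simp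
  moreover have "add A (h \<cdot>\<^bsub>A\<^esub> x) (scl A \<i> y) = z"
  proof (rule vec_eqI)
    fix f assume f: "functional A f"
    show "f (add A (h \<cdot>\<^bsub>A\<^esub> x) (scl A \<i> y)) = f z"
      using f h wc z eqf[OF f] v unfolding x_def y_def
      by (simp add: functional_simps alg_simps field_simps)
        (simp add: algebra_simps flip: eqf[OF f])
  qed (use h x y z in simp_all)
  moreover have "add A (h \<cdot>\<^bsub>A\<^esub> x) (scl A (-\<i>) y) = sub A (scl A 2 (w \<cdot>\<^bsub>A\<^esub> z)) z"
  proof (rule vec_eqI)
    fix f assume f: "functional A f"
    show "f (add A (h \<cdot>\<^bsub>A\<^esub> x) (scl A (-\<i>) y)) = f (sub A (scl A 2 (w \<cdot>\<^bsub>A\<^esub> z)) z)"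
      using f h wc z eqf[OF f] v unfolding x_def y_def
      by (simp add: functional_simps alg_simps field_simps)
        (simp add: algebra_simps flip: eqf[OF f])
  qed (use h x y z wc in simp_all)
  ultimately have c: "nrm A (sub A (scl A 2 (w \<cdot>\<^bsub>A\<^esub> z)) z) = nrm A z"
    using nrm_nonneg z wc by (simp add: power2_eq_iff_nonneg)
  have "w \<cdot>\<^bsub>A\<^esub> z = scl A (1/2) (add A z (sub A (scl A 2 (w \<cdot>\<^bsub>A\<^esub> z)) z))"
    using z wc by (intro vec_eqI) (auto simp: functional_simps)
  then have "nrm A (w \<cdot>\<^bsub>A\<^esub> z) = nrm A (scl A (1/2) (add A z (sub A (scl A 2 (w \<cdot>\<^bsub>A\<^esub> z)) z)))"
    by (rule arg_cong)
  also have "\<dots> \<le> 1/2 * (nrm A z + nrm A z)"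
    using nrm_triangle[of z "sub A (scl A 2 (w \<cdot>\<^bsub>A\<^esub> z)) z"] z wc c by (simp add: nrm_scl)
  finally show "nrm A (w \<cdot>\<^bsub>A\<^esub> z) \<le> nrm A z" by simp
  have "sub A z (w \<cdot>\<^bsub>A\<^esub> z) = scl A (1/2) (sub A z (sub A (scl A 2 (w \<cdot>\<^bsub>A\<^esub> z)) z))"
    using z wc by (intro vec_eqI) (auto simp: functional_simps algebra_simps)
  then have "nrm A (sub A z (w \<cdot>\<^bsub>A\<^esub> z))
      = nrm A (scl A (1/2) (sub A z (sub A (scl A 2 (w \<cdot>\<^bsub>A\<^esub> z)) z)))"
    by (rule arg_cong)
  also have "\<dots> \<le> 1/2 * (nrm A z + nrm A z)"
    using nrm_sub_le[of z "sub A (scl A 2 (w \<cdot>\<^bsub>A\<^esub> z)) z"] z wc c by (simp add: nrm_scl)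
  finally show "nrm A (sub A z (w \<cdot>\<^bsub>A\<^esub> z)) \<le> nrm A z" by simp
qed

text \<open>The norm bound comes from the contraction property at \<open>star A w\<close>. The last
  identity reads \<open>(1 - w) h = \<i>v w\<close>: for small \<open>v\<close>, \<open>w\<close> is
  nearly a unit for \<open>h\<close>.\<close>

lemma resolvent_facts:
  assumes w: "resolvent h v w" and h: "h \<in> car A" "star A h = h" and v: "v > 0"
  shows "w \<in> car A" "w \<cdot>\<^bsub>A\<^esub> h = h \<cdot>\<^bsub>A\<^esub> w" "nrm A w \<le> 1"
    "sub A h (w \<cdot>\<^bsub>A\<^esub> h) = scl A (\<i> * v) w"
proof -
  show wc: "w \<in> car A" using w by (simp add: resolvent_def)
  show wh: "w \<cdot>\<^bsub>A\<^esub> h = h \<cdot>\<^bsub>A\<^esub> w" using w h by (auto simp: resolvent_def)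
  have "(nrm A w)\<^sup>2 \<le> nrm A w"
    using resolvent_contraction(1)[OF w h v, of "star A w"] wc by (simp add: cstar_identity')
  then show "nrm A w \<le> 1"
    using nrm_nonneg[OF wc] by (intro le_one_of_square_le) (simp_all add: power2_eq_square)
  show "sub A h (w \<cdot>\<^bsub>A\<^esub> h) = scl A (\<i> * v) w"
  proof (rule vec_eqI)
    fix f assume f: "functional A f"
    have "f (add A (h \<cdot>\<^bsub>A\<^esub> w) (scl A (\<i> * v) w)) = f h" using w by (simp add: resolvent_def)
    then show "f (sub A h (w \<cdot>\<^bsub>A\<^esub> h)) = f (scl A (\<i> * v) w)"
      using f h wc wh by (simp add: functional_simps algebra_simps)
  qed (use h wc in simp_all)
qed

text \<open>For \<open>u = x - w x\<close>, the element \<open>r u u\<^sup>*\<close> equals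
  \<open>(1 - w) h (1 - w)\<^sup>*\<close>, whose norm is at most that of
  \<open>(1 - w) h = \<i>v w\<close>. The factor \<open>r\<close> lets one statement serve for
  \<open>x x\<^sup>*\<close> and for its double.\<close>

lemma resolvent_approx:
  assumes w: "resolvent h v w" and h: "h \<in> car A" "star A h = h" and v: "v > 0"
    and x: "x \<in> car A" "h = scl A (of_real r) (x \<cdot>\<^bsub>A\<^esub> star A x)" "r \<ge> 1"
  shows "nrm A (sub A x (w \<cdot>\<^bsub>A\<^esub> x)) \<le> sqrt v"
proof -
  note wf = resolvent_facts[OF w h v]
  define u where "u = sub A x (w \<cdot>\<^bsub>A\<^esub> x)"
  define y where "y = sub A h (w \<cdot>\<^bsub>A\<^esub> h)"
  have uc: "u \<in> car A" and yc: "y \<in> car A" using x h wf by (simp_all add: u_def y_def)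
  have "scl A (of_real r) (u \<cdot>\<^bsub>A\<^esub> star A u) = star A (sub A (star A y) (w \<cdot>\<^bsub>A\<^esub> star A y))"
    using x(1) wf(1) unfolding u_def y_def x(2)
    by (intro vec_eqI) (auto simp: functional_simps alg_simps algebra_simps)
  then have "nrm A (scl A (of_real r) (u \<cdot>\<^bsub>A\<^esub> star A u)) = nrm A (sub A (star A y) (w \<cdot>\<^bsub>A\<^esub> star A y))"
    using yc wf by simp
  also have "\<dots> \<le> nrm A y"
    using resolvent_contraction(2)[OF w h v, of "star A y"] yc by simp
  also have "\<dots> \<le> v" 
    unfolding y_def wf(4) using wf(1,3) v by (simp add: nrm_scl norm_mult mult_left_le)
  finally have "r * (nrm A u)\<^sup>2 \<le> v" using x(3) uc by (simp add: nrm_scl cstar_identity')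
  moreover have "1 * (nrm A u)\<^sup>2 \<le> r * (nrm A u)\<^sup>2" using x(3) by (intro mult_right_mono) auto
  ultimately show ?thesis unfolding u_def[symmetric] by (intro real_le_rsqrt) simp
qed

lemma left_approximate_unit:
  assumes "x \<in> car A" "e > 0"
  obtains w where "w \<in> car A" "nrm A w \<le> 1" "nrm A (sub A x (w \<cdot>\<^bsub>A\<^esub> x)) < e"
proof -
  let ?h = "x \<cdot>\<^bsub>A\<^esub> star A x" and ?v = "(e / 2)\<^sup>2"
  have h: "?h \<in> car A" "star A ?h = ?h" and v: "?v > 0" using assms by (simp_all add: star_mul)
  have "cstar_sub A (car A)" by (simp add: cstar_sub_def car_closed_subspace)
  then obtain w where w: "resolvent ?h ?v w" using resolvent_exists h v by blast
  have "nrm A (sub A x (w \<cdot>\<^bsub>A\<^esub> x)) \<le> sqrt ?v"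
    using resolvent_approx[OF w h v assms(1), of 1] assms by simp
  moreover have "sqrt ?v < e" using assms by simp
  ultimately show thesis using that resolvent_facts[OF w h v] by force
qed

text \<open>Cohen's factorisation, with the commuting invertible elements \<open>(1 + w\<^sub>k)/2\<close> for resolvents
  \<open>w\<^sub>k\<close> of \<open>h = x x\<^sup>*\<close>: their products converge to \<open>f\<close>, and the products of the inverses
  \<open>2 - w'\<^sub>k\<close>, where \<open>w'\<^sub>k\<close> is a resolvent of \<open>2h\<close>, converge on \<open>x\<close>. The elements \<open>a\<^sub>N\<close> are the
  products without their scalar part \<open>2\<^sup>-\<^sup>N\<close>.\<close>

lemma cohen_factorisation:
  assumes G: "cstar_sub A G" and x: "x \<in> car A" and xx: "x \<cdot>\<^bsub>A\<^esub> star A x \<in> G"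
  obtains f y where "f \<in> G" "y \<in> car A" "x = f \<cdot>\<^bsub>A\<^esub> y"
proof -
  define h where "h = x \<cdot>\<^bsub>A\<^esub> star A x"
  define h2 where "h2 = scl A 2 h"
  have Gs: "closed_subspace A G" "G \<subseteq> car A" "zer A \<in> G"
    "\<And>x y. x \<in> G \<Longrightarrow> y \<in> G \<Longrightarrow> add A x y \<in> G" "\<And>x y. x \<in> G \<Longrightarrow> y \<in> G \<Longrightarrow> x \<cdot>\<^bsub>A\<^esub> y \<in> G"
    "\<And>c x. x \<in> G \<Longrightarrow> scl A c x \<in> G"
    using G(1) by (auto simp: cstar_sub_def closed_subspace_def)
  have h: "h \<in> car A" "star A h = h" and h2: "h2 \<in> car A" "star A h2 = h2" and hG: "h \<in> G" "h2 \<in> G"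
    using x xx Gs by (simp_all add: h_def h2_def alg_simps)
  \<comment> \<open>The ratio 16 beats both growth rates below:
    \<open>8 ^ n * v n = (1/2) ^ n\<close> for \<open>a\<close>, and
    \<open>3 ^ n * sqrt (v n) = (3/4) ^ n\<close> for \<open>d\<close>.\<close>
  define v where "v k = (1/16 :: real) ^ k" for k :: nat
  have v: "v k > 0" for k by (simp add: v_def)
  have "\<forall>k. \<exists>w. w \<in> G \<and> resolvent h (v k) w" using resolvent_exists[OF G hG(1) h(2) v] by metis
  then obtain w where w: "\<And>k. w k \<in> G" "\<And>k. resolvent h (v k) (w k)" by metis
  have "\<forall>k. \<exists>w. w \<in> G \<and> resolvent h2 (v k) w" using resolvent_exists[OF G hG(2) h2(2) v] by metis
  then obtain w' where w': "\<And>k. w' k \<in> G" "\<And>k. resolvent h2 (v k) (w' k)" by metis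
  note wf = resolvent_facts[OF w(2) h v] and wf' = resolvent_facts[OF w'(2) h2 v]
  note [simp] = wf(1) wf'(1)
  have h2w: "w k \<cdot>\<^bsub>A\<^esub> h2 = h2 \<cdot>\<^bsub>A\<^esub> w k" for k using wf(2) h by (simp add: h2_def alg_simps)
  have ww: "w k \<cdot>\<^bsub>A\<^esub> w l = w l \<cdot>\<^bsub>A\<^esub> w k" for k l
    using w(2)[of l] wf(1,2)[of k] unfolding resolvent_def by blast
  have ww': "w' k \<cdot>\<^bsub>A\<^esub> w' l = w' l \<cdot>\<^bsub>A\<^esub> w' k" for k l
    using w'(2)[of l] wf'(1,2)[of k] unfolding resolvent_def by blast
  \<comment> \<open>The recursions express
    \<open>(2 ^ (-n) + a n) (1 + w n) / 2 = 2 ^ (-n - 1) + a (Suc n)\<close> and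
    \<open>d (Suc n) = (2 - w' n) d n\<close>.\<close>
  define a where "a = rec_nat (zer A) (\<lambda>n b. add A (scl A (1/2) (add A b (b \<cdot>\<^bsub>A\<^esub> w n))) (scl A ((1/2) ^ Suc n) (w n)))"
  define d where "d = rec_nat x (\<lambda>n b. sub A (scl A 2 b) (w' n \<cdot>\<^bsub>A\<^esub> b))"
  have a0: "a 0 = zer A"
    and aS: "a (Suc n) = add A (scl A (1/2) (add A (a n) (a n \<cdot>\<^bsub>A\<^esub> w n))) (scl A ((1/2) ^ Suc n) (w n))" for n
    by (simp_all add: a_def)
  have d0: "d 0 = x" and dS: "d (Suc n) = sub A (scl A 2 (d n)) (w' n \<cdot>\<^bsub>A\<^esub> d n)" for n
    by (simp_all add: d_def)
  have aG: "a n \<in> G" for n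
  proof (induction n)
    case (Suc n) then show ?case unfolding aS using Gs w by (intro Gs(4-6)) auto
  qed (simp add: a0 Gs)
  then have ac [simp]: "a n \<in> car A" for n using Gs by auto
  have dc [simp]: "d n \<in> car A" for n
    by (induction n) (simp_all add: d0 dS x)
  text \<open>\<open>(1 + w)(2 - w') = 2\<close>\<close>
  have inv: "sub A (scl A 2 (w n)) (w' n) = w n \<cdot>\<^bsub>A\<^esub> w' n" for n
  proof -
    define u where "u = sub A (sub A (scl A 2 (w n)) (w' n)) (w n \<cdot>\<^bsub>A\<^esub> w' n)"
    have u: "u \<in> car A" by (simp add: u_def)
    have e1: "f (h \<cdot>\<^bsub>A\<^esub> w n) + \<i> * v n * f (w n) = f h" if "functional A f" for f
    proof -
      have "f (add A (h \<cdot>\<^bsub>A\<^esub> w n) (scl A (\<i> * v n) (w n))) = f h"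
        using w(2)[of n] by (simp add: resolvent_def)
      then show ?thesis using that h by (simp add: functional_simps)
    qed
    have e2: "2 * f (h \<cdot>\<^bsub>A\<^esub> w' n) + \<i> * v n * f (w' n) = 2 * f h" if "functional A f" for f
    proof -
      have "f (add A (h2 \<cdot>\<^bsub>A\<^esub> w' n) (scl A (\<i> * v n) (w' n))) = f h2"
        using w'(2)[of n] by (simp add: resolvent_def)
      then show ?thesis using that h by (simp add: functional_simps h2_def alg_simps)
    qed
    have e3: "f (h \<cdot>\<^bsub>A\<^esub> (w n \<cdot>\<^bsub>A\<^esub> z)) + \<i> * v n * f (w n \<cdot>\<^bsub>A\<^esub> z) = f (h \<cdot>\<^bsub>A\<^esub> z)"
      if "functional A f" "z \<in> car A" for f z
    proof -
      have "f (add A (h \<cdot>\<^bsub>A\<^esub> w n) (scl A (\<i> * v n) (w n)) \<cdot>\<^bsub>A\<^esub> z) = f (h \<cdot>\<^bsub>A\<^esub> z)"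
        using w(2)[of n] by (simp add: resolvent_def)
      then show ?thesis using that h by (simp add: functional_simps alg_simps)
    qed
    have z: "add A (h \<cdot>\<^bsub>A\<^esub> u) (scl A (\<i> * v n) u) = zer A"
    proof (rule vec_eqI)
      fix f assume f: "functional A f"
      have "f (add A (h \<cdot>\<^bsub>A\<^esub> u) (scl A (\<i> * v n) u))
          = 2 * (f (h \<cdot>\<^bsub>A\<^esub> w n) + \<i> * v n * f (w n)) - f (h \<cdot>\<^bsub>A\<^esub> w' n) - \<i> * v n * f (w' n)
            - (f (h \<cdot>\<^bsub>A\<^esub> (w n \<cdot>\<^bsub>A\<^esub> w' n)) + \<i> * v n * f (w n \<cdot>\<^bsub>A\<^esub> w' n))"
        using f h by (simp add: u_def functional_simps alg_simps algebra_simps)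
      also have "\<dots> = 2 * f h - (2 * f (h \<cdot>\<^bsub>A\<^esub> w' n) + \<i> * v n * f (w' n))"
        using e1[OF f] e3[OF f, of "w' n"] by simp
      also have "\<dots> = f (zer A)" using e2[OF f] f by (simp add: functional_simps)
      finally show "f (add A (h \<cdot>\<^bsub>A\<^esub> u) (scl A (\<i> * v n) u)) = f (zer A)" .
    qed (use h u in simp_all)
    \<comment> \<open>Left multiplication by \<open>w n\<close> turns
      \<open>(h + \<i>v) u = 0\<close> into \<open>h u = 0\<close>, because
      \<open>w (h + \<i>v) = h\<close>; then \<open>\<i>v u = 0\<close> is left.\<close>
    have "scl A (\<i> * v n) u = zer A"
    proof (rule vec_eqI)
      fix f assume f: "functional A f"
      have "f (add A (h \<cdot>\<^bsub>A\<^esub> u) (scl A (\<i> * v n) u)) = 0" 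
        "f (w n \<cdot>\<^bsub>A\<^esub> add A (h \<cdot>\<^bsub>A\<^esub> u) (scl A (\<i> * v n) u)) = 0"
        unfolding z using f by (simp_all add: functional_simps)
      then have "f (h \<cdot>\<^bsub>A\<^esub> u) + \<i> * v n * f u = 0"
        "f (w n \<cdot>\<^bsub>A\<^esub> h \<cdot>\<^bsub>A\<^esub> u) + \<i> * v n * f (w n \<cdot>\<^bsub>A\<^esub> u) = 0"
        using f h u by (simp_all add: functional_simps alg_simps)
      then have "f (h \<cdot>\<^bsub>A\<^esub> u) + \<i> * v n * f u = 0" "f (h \<cdot>\<^bsub>A\<^esub> u) = 0"
        using e3[OF f u] h u unfolding wf(2) by (simp_all add: mul_assoc)
      then show "f (scl A (\<i> * v n) u) = f (zer A)"
        using f u by (simp add: functional_simps)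
    qed (use u in simp_all)
    then have "scl A (1 / (\<i> * v n)) (scl A (\<i> * v n) u) = zer A" by simp
    then have "u = zer A" using u v[of n] by (simp add: scl_scl)
    then show ?thesis unfolding u_def by (simp add: sub_eq_zer)
  qed
  \<comment> \<open>This is \<open>x = (2 ^ (-n) + a n) d n\<close>: each step inserts
    \<open>(1 + w n) / 2\<close> and \<open>2 - w' n\<close>, which are inverse to each
    other.\<close>
  have prod: "add A (scl A ((1/2) ^ n) (d n)) (a n \<cdot>\<^bsub>A\<^esub> d n) = x" for n
  proof (induction n)
    case (Suc n)
    have invf: "f (w n \<cdot>\<^bsub>A\<^esub> (w' n \<cdot>\<^bsub>A\<^esub> d n)) = 2 * f (w n \<cdot>\<^bsub>A\<^esub> d n) - f (w' n \<cdot>\<^bsub>A\<^esub> d n)"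
      "f (a n \<cdot>\<^bsub>A\<^esub> (w n \<cdot>\<^bsub>A\<^esub> (w' n \<cdot>\<^bsub>A\<^esub> d n))) = 2 * f (a n \<cdot>\<^bsub>A\<^esub> (w n \<cdot>\<^bsub>A\<^esub> d n)) - f (a n \<cdot>\<^bsub>A\<^esub> (w' n \<cdot>\<^bsub>A\<^esub> d n))"
      if "functional A f" for f
    proof -
      have "w n \<cdot>\<^bsub>A\<^esub> (w' n \<cdot>\<^bsub>A\<^esub> d n) = sub A (scl A 2 (w n)) (w' n) \<cdot>\<^bsub>A\<^esub> d n"
        unfolding inv by (simp add: mul_assoc)
      then show "f (w n \<cdot>\<^bsub>A\<^esub> (w' n \<cdot>\<^bsub>A\<^esub> d n)) = 2 * f (w n \<cdot>\<^bsub>A\<^esub> d n) - f (w' n \<cdot>\<^bsub>A\<^esub> d n)"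
        "f (a n \<cdot>\<^bsub>A\<^esub> (w n \<cdot>\<^bsub>A\<^esub> (w' n \<cdot>\<^bsub>A\<^esub> d n))) = 2 * f (a n \<cdot>\<^bsub>A\<^esub> (w n \<cdot>\<^bsub>A\<^esub> d n)) - f (a n \<cdot>\<^bsub>A\<^esub> (w' n \<cdot>\<^bsub>A\<^esub> d n))"
        using that by (simp_all add: alg_simps functional_simps)
    qed
    have "add A (scl A ((1/2) ^ Suc n) (d (Suc n))) (a (Suc n) \<cdot>\<^bsub>A\<^esub> d (Suc n))
        = add A (scl A ((1/2) ^ n) (d n)) (a n \<cdot>\<^bsub>A\<^esub> d n)"
    proof (rule vec_eqI)
      fix f assume f: "functional A f"
      show "f (add A (scl A ((1/2) ^ Suc n) (d (Suc n))) (a (Suc n) \<cdot>\<^bsub>A\<^esub> d (Suc n)))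
        = f (add A (scl A ((1/2) ^ n) (d n)) (a n \<cdot>\<^bsub>A\<^esub> d n))"
        unfolding aS dS using f by (simp add: functional_simps alg_simps invf[OF f] algebra_simps)
    qed (simp_all add: aS dS)
    then show ?case using Suc by simp
  qed (use x in \<open>simp add: a0 d0\<close>)
  \<comment> \<open>\<open>d (Suc n)\<close> arises from \<open>d n\<close> by applying
    \<open>2 - w' n\<close>, an operation of norm at most 3 that commutes with
    \<open>w' k\<close>.\<close>
  have dinc: "nrm A (sub A (d n) (w' k \<cdot>\<^bsub>A\<^esub> d n)) \<le> 3 ^ n * (1/4) ^ k" for n k
  proof (induction n)
    case 0
    have "sqrt (v k) = (1/4) ^ k"
      unfolding v_def by (simp add: real_sqrt_power real_sqrt_divide)
    then show ?case
      using resolvent_approx[OF w'(2) h2 v x, of 2 k] by (simp add: d0 h2_def h_def)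
  next
    case (Suc n)
    define u where "u = sub A (d n) (w' k \<cdot>\<^bsub>A\<^esub> d n)"
    have u: "u \<in> car A" by (simp add: u_def)
    have "w' k \<cdot>\<^bsub>A\<^esub> (w' n \<cdot>\<^bsub>A\<^esub> d n) = w' n \<cdot>\<^bsub>A\<^esub> (w' k \<cdot>\<^bsub>A\<^esub> d n)"
      using ww'[of k n] by (simp flip: mul_assoc)
    then have "sub A (d (Suc n)) (w' k \<cdot>\<^bsub>A\<^esub> d (Suc n)) = sub A (scl A 2 u) (w' n \<cdot>\<^bsub>A\<^esub> u)"
      unfolding dS u_def by (intro vec_eqI) (auto simp: functional_simps alg_simps algebra_simps)
    then have "nrm A (sub A (d (Suc n)) (w' k \<cdot>\<^bsub>A\<^esub> d (Suc n))) \<le> 2 * nrm A u + nrm A (w' n \<cdot>\<^bsub>A\<^esub> u)"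
      using nrm_sub_le[of "scl A 2 u" "w' n \<cdot>\<^bsub>A\<^esub> u"] u by (simp add: nrm_scl)
    also have "\<dots> \<le> 3 * nrm A u" using resolvent_contraction(1)[OF w'(2) h2 v u] by simp
    finally show ?case using Suc unfolding u_def by simp
  qed
  have wd: "nrm A (sub A (w n) (w n \<cdot>\<^bsub>A\<^esub> w k)) \<le> v k / v n" for n k
  proof -
    \<comment> \<open>Both sides are \<open>(1 - w n) h (1 - w k)\<close>.\<close>
    have "scl A (\<i> * v n) (sub A (w n) (w n \<cdot>\<^bsub>A\<^esub> w k)) = scl A (\<i> * v k) (sub A (w k) (w n \<cdot>\<^bsub>A\<^esub> w k))"
    proof (rule vec_eqI)
      fix f assume f: "functional A f"
      have 1: "f (scl A (\<i> * v n) (w n)) = f (sub A h (w n \<cdot>\<^bsub>A\<^esub> h))"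
        and 2: "f (scl A (\<i> * v n) (w n) \<cdot>\<^bsub>A\<^esub> w k) = f (sub A h (w n \<cdot>\<^bsub>A\<^esub> h) \<cdot>\<^bsub>A\<^esub> w k)"
        and 3: "f (scl A (\<i> * v k) (w k)) = f (sub A h (w k \<cdot>\<^bsub>A\<^esub> h))"
        and 4: "f (w n \<cdot>\<^bsub>A\<^esub> scl A (\<i> * v k) (w k)) = f (w n \<cdot>\<^bsub>A\<^esub> sub A h (w k \<cdot>\<^bsub>A\<^esub> h))"
        using wf(4) by simp_all
      show "f (scl A (\<i> * v n) (sub A (w n) (w n \<cdot>\<^bsub>A\<^esub> w k))) = f (scl A (\<i> * v k) (sub A (w k) (w n \<cdot>\<^bsub>A\<^esub> w k)))"
        using 1 2 3 4 f h wf(2)[of k]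
        by (simp add: functional_simps alg_simps right_diff_distrib mult.assoc)
    qed simp_all
    then have "nrm A (scl A (\<i> * v n) (sub A (w n) (w n \<cdot>\<^bsub>A\<^esub> w k)))
        = nrm A (scl A (\<i> * v k) (sub A (w k) (w n \<cdot>\<^bsub>A\<^esub> w k)))" by simp
    then have "v n * nrm A (sub A (w n) (w n \<cdot>\<^bsub>A\<^esub> w k)) = v k * nrm A (sub A (w k) (w n \<cdot>\<^bsub>A\<^esub> w k))"
      using v by (simp add: nrm_scl norm_mult less_imp_le)
    also have "\<dots> \<le> v k * 1"
      using resolvent_contraction(2)[OF w(2) h v, of "w k" n] wf(3)[of k] v[of k]
      by (intro mult_left_mono) simp_all
    finally show ?thesis using v[of n] by (simp add: field_simps)
  qed
  \<comment> \<open>The last term of the recursion contributes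
    \<open>(1/2) ^ Suc n * (v k / v n)\<close>; the quotient of 16 and 2 is the origin of the rate
    8.\<close>
  have ainc: "nrm A (sub A (a n) (a n \<cdot>\<^bsub>A\<^esub> w k)) \<le> 8 ^ n * v k" for n k
  proof (induction n)
    case 0 then show ?case using v[of k] by (simp add: a0)
  next
    case (Suc n)
    define u where "u = sub A (a n) (a n \<cdot>\<^bsub>A\<^esub> w k)"
    define y where "y = sub A (w n) (w n \<cdot>\<^bsub>A\<^esub> w k)"
    have u: "u \<in> car A" and y: "y \<in> car A" by (simp_all add: u_def y_def)
    have "sub A (a (Suc n)) (a (Suc n) \<cdot>\<^bsub>A\<^esub> w k)
        = add A (scl A (1/2) (add A u (u \<cdot>\<^bsub>A\<^esub> w n))) (scl A ((1/2) ^ Suc n) y)"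
      unfolding aS u_def y_def using ww[of k n]
      by (intro vec_eqI) (auto simp: functional_simps alg_simps algebra_simps
        diff_divide_distrib add_divide_distrib)
    then have "nrm A (sub A (a (Suc n)) (a (Suc n) \<cdot>\<^bsub>A\<^esub> w k))
        \<le> 1/2 * nrm A (add A u (u \<cdot>\<^bsub>A\<^esub> w n)) + (1/2) ^ Suc n * nrm A y"
      using nrm_triangle[of "scl A (1/2) (add A u (u \<cdot>\<^bsub>A\<^esub> w n))" "scl A ((1/2) ^ Suc n) y"] u y
      by (simp add: nrm_scl norm_mult norm_power norm_divide)
    also have "nrm A (add A u (u \<cdot>\<^bsub>A\<^esub> w n)) \<le> nrm A u + nrm A u * 1"
      using nrm_triangle[of u "u \<cdot>\<^bsub>A\<^esub> w n"] nrm_mul_le[of u "w n" "nrm A u" 1] u wf(3) by simp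
    also have "(1/2) ^ Suc n * nrm A y \<le> (1/2) ^ Suc n * (v k / v n)"
      unfolding y_def by (intro mult_left_mono wd) simp
    also have "(1/2) ^ Suc n * (v k / v n) = 1/2 * 8 ^ n * v k"
      by (simp add: v_def power_divide field_simps flip: power_mult_distrib)
    finally have "nrm A (sub A (a (Suc n)) (a (Suc n) \<cdot>\<^bsub>A\<^esub> w k)) \<le> nrm A u + 1/2 * (8 ^ n * v k)"
      by simp
    moreover have "0 \<le> 8 ^ n * v k" using v[of k] by simp
    moreover have "8 ^ Suc n * v k = 8 * (8 ^ n * v k)" by simp
    ultimately show ?case using Suc unfolding u_def by linarith
  qed
  have "nrm A (sub A (a (Suc n)) (a n)) \<le> (1/2) ^ n" for n
  proof -
    have "sub A (a (Suc n)) (a n)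
        = add A (scl A (- (1/2)) (sub A (a n) (a n \<cdot>\<^bsub>A\<^esub> w n))) (scl A ((1/2) ^ Suc n) (w n))"
      unfolding aS by (intro vec_eqI) (auto simp: functional_simps alg_simps algebra_simps
        diff_divide_distrib add_divide_distrib)
    then have "nrm A (sub A (a (Suc n)) (a n))
        \<le> 1/2 * nrm A (sub A (a n) (a n \<cdot>\<^bsub>A\<^esub> w n)) + (1/2) ^ Suc n * nrm A (w n)"
      using nrm_triangle[of "scl A (- (1/2)) (sub A (a n) (a n \<cdot>\<^bsub>A\<^esub> w n))" "scl A ((1/2) ^ Suc n) (w n)"]
      by (simp add: nrm_scl norm_mult norm_power norm_divide)
    also have "\<dots> \<le> 1/2 * (8 ^ n * v n) + (1/2) ^ Suc n * 1"
      using ainc[of n n] wf(3)[of n] by (intro add_mono mult_left_mono) simp_all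
    also have "8 ^ n * v n = (1/2) ^ n"
      by (simp add: v_def flip: power_mult_distrib)
    finally show ?thesis by simp
  qed
  then obtain f where f: "f \<in> car A" "(\<lambda>n. nrm A (sub A (a n) f)) \<longlonglongrightarrow> 0"
    using complete_seq[of a "\<lambda>n. (1/2) ^ n"] by (auto simp: summable_geometric)
  have dle: "nrm A (sub A (d (Suc n)) (d n)) \<le> (3/4) ^ n" for n
  proof -
    have "sub A (d (Suc n)) (d n) = sub A (d n) (w' n \<cdot>\<^bsub>A\<^esub> d n)"
      unfolding dS by (intro vec_eqI) (auto simp: functional_simps)
    then show ?thesis using dinc[of n n] by (simp flip: power_mult_distrib)
  qed
  obtain y where y: "y \<in> car A" "(\<lambda>n. nrm A (sub A (d n) y)) \<longlonglongrightarrow> 0"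
    by (rule complete_seq[of d "\<lambda>n. (3/4) ^ n"]) (use dle in \<open>auto simp: summable_geometric\<close>)
  have "f \<in> G"
  proof -
    have "approx A G f"
      unfolding approx_def
    proof (intro conjI allI impI f)
      fix e :: real assume "e > 0"
      then have "\<forall>\<^sub>F n in sequentially. nrm A (sub A (a n) f) < e"
        using order_tendstoD(2)[OF f(2)] by blast
      then obtain n where "nrm A (sub A (a n) f) < e"
        by (auto simp: eventually_sequentially)
      then show "\<exists>y\<in>G. y \<in> car A \<and> nrm A (sub A f y) < e"
        using aG f nrm_sub_commute[of f "a n"] by (auto intro!: bexI[of _ "a n"])
    qed
    then show ?thesis using Gs(1) closed_subspace_approx by blast
  qed
  moreover have "x = f \<cdot>\<^bsub>A\<^esub> y"
  proof -
    \<comment> \<open>Bounds the distance from \<open>(2 ^ (-n) + a n) d n\<close>, which is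
      \<open>x\<close>, to \<open>f y\<close>; all three contributions tend to 0.\<close>
    let ?b = "\<lambda>n. (1/2) ^ n * (nrm A y + nrm A (sub A (d n) y))
      + (nrm A (sub A (a n) f) * (nrm A y + nrm A (sub A (d n) y)) + nrm A f * nrm A (sub A (d n) y))"
    have le: "nrm A (sub A x (f \<cdot>\<^bsub>A\<^esub> y)) \<le> ?b n" for n
    proof -
      have "sub A x (f \<cdot>\<^bsub>A\<^esub> y)
          = sub A (add A (scl A ((1/2) ^ n) (d n)) (a n \<cdot>\<^bsub>A\<^esub> d n)) (f \<cdot>\<^bsub>A\<^esub> y)"
        using prod by simp
      also have "\<dots> = add A (scl A ((1/2) ^ n) (d n))
          (add A (sub A (a n) f \<cdot>\<^bsub>A\<^esub> d n) (f \<cdot>\<^bsub>A\<^esub> sub A (d n) y))"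
        using f y by (intro vec_eqI) (auto simp: functional_simps alg_simps)
      finally have "nrm A (sub A x (f \<cdot>\<^bsub>A\<^esub> y)) \<le> nrm A (scl A ((1/2) ^ n) (d n))
          + (nrm A (sub A (a n) f \<cdot>\<^bsub>A\<^esub> d n) + nrm A (f \<cdot>\<^bsub>A\<^esub> sub A (d n) y))"
        using f y nrm_triangle[of "scl A ((1/2) ^ n) (d n)"
            "add A (sub A (a n) f \<cdot>\<^bsub>A\<^esub> d n) (f \<cdot>\<^bsub>A\<^esub> sub A (d n) y)"]
          nrm_triangle[of "sub A (a n) f \<cdot>\<^bsub>A\<^esub> d n" "f \<cdot>\<^bsub>A\<^esub> sub A (d n) y"] by simp
      also have "\<dots> \<le> ?b n"
        using f y nrm_le_sub[of "d n" y]
        by (intro add_mono nrm_mul_le) (auto simp: nrm_scl norm_power norm_divide intro!: mult_left_mono)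
      finally show ?thesis .
    qed
    have "?b \<longlonglongrightarrow> 0 * (nrm A y + 0) + (0 * (nrm A y + 0) + nrm A f * 0)"
      by (intro tendsto_intros f y LIMSEQ_realpow_zero) simp_all
    then have "nrm A (sub A x (f \<cdot>\<^bsub>A\<^esub> y)) \<le> 0"
      using le by (intro LIMSEQ_le_const[of ?b]) auto
    then show ?thesis
      using nrm_nonneg[of "sub A x (f \<cdot>\<^bsub>A\<^esub> y)"] nrm_eq_zero[of "sub A x (f \<cdot>\<^bsub>A\<^esub> y)"] x f y
      by (auto simp: sub_eq_zer)
  qed
  ultimately show thesis using that y by blast
qed

end

section \<open>Multipliers\<close>

context cstar_algebra
begin

lemma multiplierD:
  assumes m: "m \<in> car (multiplier A)"
  shows "x \<in> car A \<Longrightarrow> m \<triangleright> x \<in> car A"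
    and "x \<in> car A \<Longrightarrow> x \<triangleleft> m \<in> car A"
    and "\<lbrakk>x \<in> car A; y \<in> car A\<rbrakk> \<Longrightarrow> m \<triangleright> (x \<cdot>\<^bsub>A\<^esub> y) = (m \<triangleright> x) \<cdot>\<^bsub>A\<^esub> y"
    and "\<lbrakk>x \<in> car A; y \<in> car A\<rbrakk> \<Longrightarrow> (x \<cdot>\<^bsub>A\<^esub> y) \<triangleleft> m = x \<cdot>\<^bsub>A\<^esub> (y \<triangleleft> m)"
    and "\<lbrakk>x \<in> car A; y \<in> car A\<rbrakk> \<Longrightarrow> (x \<triangleleft> m) \<cdot>\<^bsub>A\<^esub> y = x \<cdot>\<^bsub>A\<^esub> (m \<triangleright> y)"
    and "linear_map A A (fst m)" and "linear_map A A (snd m)"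
    and "\<exists>K. \<forall>x\<in>car A. nrm A (m \<triangleright> x) \<le> K * nrm A x"
    and "\<exists>K. \<forall>x\<in>car A. nrm A (x \<triangleleft> m) \<le> K * nrm A x"
  using m by (auto simp: multiplier_def bounded_op_def linear_map_def)

lemma multiplier_add:
  assumes m: "m \<in> car (multiplier A)" and x: "x \<in> car A" "y \<in> car A"
  shows "m \<triangleright> add A x y = add A (m \<triangleright> x) (m \<triangleright> y)" "add A x y \<triangleleft> m = add A (x \<triangleleft> m) (y \<triangleleft> m)"
    "m \<triangleright> sub A x y = sub A (m \<triangleright> x) (m \<triangleright> y)" "sub A x y \<triangleleft> m = sub A (x \<triangleleft> m) (y \<triangleleft> m)"
  using multiplierD(6,7)[OF m] x by (simp_all add: linear_map_simps linear_map_sub)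

lemma multiplier_scl:
  assumes m: "m \<in> car (multiplier A)" and x: "x \<in> car A"
  shows "m \<triangleright> scl A c x = scl A c (m \<triangleright> x)" "scl A c x \<triangleleft> m = scl A c (x \<triangleleft> m)"
  using multiplierD(6,7)[OF m] x by (simp_all add: linear_map_simps)

lemma multiplier_zer [simp]:
  assumes m: "m \<in> car (multiplier A)"
  shows "m \<triangleright> zer A = zer A" "zer A \<triangleleft> m = zer A"
  using multiplierD(6,7)[OF m] linear_map_zer[OF banach banach] by auto

lemma multiplierD_extensional:
  assumes m: "m \<in> car (multiplier A)"
  shows "fst m \<in> extensional (car A)" "snd m \<in> extensional (car A)"
  using m by (auto simp: multiplier_def bounded_op_def)

lemma multiplier_lip:
  assumes m: "m \<in> car (multiplier A)"
  shows "lip A A (fst m)" "lip A A (snd m)"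
  using multiplierD(6-9)[OF m] lip_linear[OF banach] by blast+

text \<open>The adjointness relation does the work: multiplying by an arbitrary element on the other
  side and cancelling it yields linearity and both module properties. One bound is asked for; the
  other follows from the C*-identity.\<close>

lemma multiplierI:
  assumes ext: "fst m \<in> extensional (car A)" "snd m \<in> extensional (car A)"
    and cl: "\<And>x. x \<in> car A \<Longrightarrow> m \<triangleright> x \<in> car A" "\<And>x. x \<in> car A \<Longrightarrow> x \<triangleleft> m \<in> car A"
    and adj: "\<And>x y. x \<in> car A \<Longrightarrow> y \<in> car A \<Longrightarrow> (x \<triangleleft> m) \<cdot>\<^bsub>A\<^esub> y = x \<cdot>\<^bsub>A\<^esub> (m \<triangleright> y)"
    and bd: "\<And>x. x \<in> car A \<Longrightarrow> nrm A (m \<triangleright> x) \<le> K * nrm A x"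
  shows "m \<in> car (multiplier A)"
proof -
  have l1: "m \<triangleright> (a \<cdot>\<^bsub>A\<^esub> b) = (m \<triangleright> a) \<cdot>\<^bsub>A\<^esub> b" if "a \<in> car A" "b \<in> car A" for a b
    using that cl by - (rule eq_by_left_mult; simp flip: adj mul_assoc)
  have r1: "(a \<cdot>\<^bsub>A\<^esub> b) \<triangleleft> m = a \<cdot>\<^bsub>A\<^esub> (b \<triangleleft> m)" if "a \<in> car A" "b \<in> car A" for a b
    using that cl by - (rule eq_by_right_mult; simp add: adj mul_assoc)
  have "m \<triangleright> add A x y = add A (m \<triangleright> x) (m \<triangleright> y)" if "x \<in> car A" "y \<in> car A" for x y
    using that cl by - (rule eq_by_left_mult; simp add: alg_simps flip: adj)
  moreover have "m \<triangleright> scl A c x = scl A c (m \<triangleright> x)" if "x \<in> car A" for c x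
    using that cl by - (rule eq_by_left_mult; simp add: alg_simps flip: adj)
  moreover have "add A x y \<triangleleft> m = add A (x \<triangleleft> m) (y \<triangleleft> m)" if "x \<in> car A" "y \<in> car A" for x y
    using that cl by - (rule eq_by_right_mult; simp add: alg_simps adj)
  moreover have "scl A c x \<triangleleft> m = scl A c (x \<triangleleft> m)" if "x \<in> car A" for c x
    using that cl by - (rule eq_by_right_mult; simp add: alg_simps adj)
  \<comment> \<open>With \<open>y = x \<triangleleft> m\<close>, the square of \<open>?n\<close> is
    the norm of \<open>y (star A y) = x (m \<triangleright> star A y)\<close>; one factor
    \<open>?n\<close> is then cancelled.\<close>
  moreover have "nrm A (x \<triangleleft> m) \<le> \<bar>K\<bar> * nrm A x" if x: "x \<in> car A" for x
  proof -
    let ?n = "nrm A (x \<triangleleft> m)"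
    have "nrm A (m \<triangleright> star A (x \<triangleleft> m)) \<le> K * ?n" using bd[of "star A (x \<triangleleft> m)"] x cl by simp
    also have "\<dots> \<le> \<bar>K\<bar> * ?n" using x cl nrm_nonneg by (intro mult_right_mono) auto
    finally have "nrm A (x \<cdot>\<^bsub>A\<^esub> (m \<triangleright> star A (x \<triangleleft> m))) \<le> nrm A x * (\<bar>K\<bar> * ?n)"
      using x cl by (intro nrm_mul_le) auto
    then have "?n * ?n \<le> (\<bar>K\<bar> * nrm A x) * ?n"
      using x cl cstar_identity'[of "x \<triangleleft> m"] by (simp add: adj power2_eq_square ac_simps)
    then show ?thesis using nrm_nonneg[of "x \<triangleleft> m"] nrm_nonneg[of x] x cl
      by (cases "?n = 0") simp_all
  qed
  moreover have "\<exists>K. \<forall>x\<in>car A. nrm A (m \<triangleright> x) \<le> K * nrm A x" using bd by blast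
  moreover have "\<exists>K. \<forall>x\<in>car A. nrm A (x \<triangleleft> m) \<le> K * nrm A x" using calculation by blast
  ultimately show ?thesis
    using ext cl adj l1 r1 unfolding multiplier_def bounded_op_def linear_map_def by simp
qed

text \<open>The left action determines the right one through
  \<open>(x \<triangleleft> m) y = x (m \<triangleright> y)\<close>.\<close>

lemma multiplier_eqI:
  assumes m: "m \<in> car (multiplier A)" and n: "n \<in> car (multiplier A)"
    and eq: "\<And>x. x \<in> car A \<Longrightarrow> m \<triangleright> x = n \<triangleright> x"
  shows "m = n"
proof (rule prod_eqI)
  show "fst m = fst n"
    by (rule extensionalityI[where A = "car A"]) (use multiplierD_extensional m n eq in auto)
  have "x \<triangleleft> m = x \<triangleleft> n" if "x \<in> car A" for x
    using that multiplierD(2,5)[OF m] multiplierD(2,5)[OF n] eq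
    by - (rule eq_by_right_mult; simp)
  then show "snd m = snd n"
    by (intro extensionalityI[where A = "car A"]) (use multiplierD_extensional m n in auto)
qed

lemma multiplier_apply [simp]:
  assumes "x \<in> car A"
  shows "(m \<cdot>\<^bsub>multiplier A\<^esub> n) \<triangleright> x = m \<triangleright> (n \<triangleright> x)" "x \<triangleleft> (m \<cdot>\<^bsub>multiplier A\<^esub> n) = (x \<triangleleft> m) \<triangleleft> n"
    "star (multiplier A) m \<triangleright> x = star A (star A x \<triangleleft> m)"
    "x \<triangleleft> star (multiplier A) m = star A (m \<triangleright> star A x)"
    "add (multiplier A) m n \<triangleright> x = add A (m \<triangleright> x) (n \<triangleright> x)"
    "scl (multiplier A) c m \<triangleright> x = scl A c (m \<triangleright> x)"
    "x \<triangleleft> scl (multiplier A) c m = scl A c (x \<triangleleft> m)"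
    "mone A \<triangleright> x = x" "x \<triangleleft> mone A = x"
    "memb A a \<triangleright> x = a \<cdot>\<^bsub>A\<^esub> x" "x \<triangleleft> memb A a = x \<cdot>\<^bsub>A\<^esub> a"
  using assms by (simp_all add: multiplier_def mone_def memb_def)

lemma multiplier_apply_left_right:
  assumes "m \<in> car (multiplier A)" "n \<in> car (multiplier A)" "x \<in> car A"
  shows "(m \<triangleright> x) \<triangleleft> n = m \<triangleright> (x \<triangleleft> n)"
proof (rule eq_by_left_mult)
  fix z assume z: "z \<in> car A"
  note [simp] = multiplierD(1,2)[OF assms(1)] multiplierD(1,2)[OF assms(2)]
  have "z \<cdot>\<^bsub>A\<^esub> ((m \<triangleright> x) \<triangleleft> n) = (z \<cdot>\<^bsub>A\<^esub> (m \<triangleright> x)) \<triangleleft> n"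
    using z assms by (simp add: multiplierD(4)[OF assms(2)])
  also have "\<dots> = ((z \<triangleleft> m) \<cdot>\<^bsub>A\<^esub> x) \<triangleleft> n" using z assms by (simp add: multiplierD(5)[OF assms(1)])
  also have "\<dots> = (z \<triangleleft> m) \<cdot>\<^bsub>A\<^esub> (x \<triangleleft> n)" using z assms by (simp add: multiplierD(4)[OF assms(2)])
  also have "\<dots> = z \<cdot>\<^bsub>A\<^esub> (m \<triangleright> (x \<triangleleft> n))" using z assms by (simp add: multiplierD(5)[OF assms(1)])
  finally show "z \<cdot>\<^bsub>A\<^esub> ((m \<triangleright> x) \<triangleleft> n) = z \<cdot>\<^bsub>A\<^esub> (m \<triangleright> (x \<triangleleft> n))" .
qed (use assms multiplierD in simp_all)

lemma multiplier_mul_closed [simp]: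
  assumes m: "m \<in> car (multiplier A)" and n: "n \<in> car (multiplier A)"
  shows "m \<cdot>\<^bsub>multiplier A\<^esub> n \<in> car (multiplier A)"
proof -
  note [simp] = multiplierD(1,2,5)[OF m] multiplierD(1,2,5)[OF n]
  obtain K L where K: "\<And>x. x \<in> car A \<Longrightarrow> nrm A (m \<triangleright> x) \<le> K * nrm A x"
    and L: "\<And>x. x \<in> car A \<Longrightarrow> nrm A (n \<triangleright> x) \<le> L * nrm A x"
    using multiplierD(8)[OF m] multiplierD(8)[OF n] by blast
  show ?thesis
  proof (rule multiplierI[where K = "\<bar>K\<bar> * L"])
    fix x assume x: "x \<in> car A"
    have "nrm A (m \<triangleright> (n \<triangleright> x)) \<le> K * nrm A (n \<triangleright> x)" using K x by simp
    also have "\<dots> \<le> \<bar>K\<bar> * nrm A (n \<triangleright> x)" using nrm_nonneg x by (intro mult_right_mono) auto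
    also have "\<dots> \<le> \<bar>K\<bar> * (L * nrm A x)" using L x by (intro mult_left_mono) auto
    finally show "nrm A ((m \<cdot>\<^bsub>multiplier A\<^esub> n) \<triangleright> x) \<le> \<bar>K\<bar> * L * nrm A x" using x by simp
  qed (simp_all add: multiplier_def)
qed

lemma multiplier_star_closed [simp]:
  assumes m: "m \<in> car (multiplier A)"
  shows "star (multiplier A) m \<in> car (multiplier A)"
proof -
  note [simp] = multiplierD(1,2)[OF m]
  obtain K where K: "\<And>x. x \<in> car A \<Longrightarrow> nrm A (x \<triangleleft> m) \<le> K * nrm A x"
    using multiplierD(9)[OF m] by blast
  have adj: "star A (m \<triangleright> star A x) \<cdot>\<^bsub>A\<^esub> y = x \<cdot>\<^bsub>A\<^esub> star A (star A y \<triangleleft> m)"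
    if "x \<in> car A" "y \<in> car A" for x y
  proof -
    have "star A (star A y \<cdot>\<^bsub>A\<^esub> (m \<triangleright> star A x)) = star A ((star A y \<triangleleft> m) \<cdot>\<^bsub>A\<^esub> star A x)"
      using that by (simp add: multiplierD(5)[OF m])
    then show ?thesis using that by (simp add: star_mul)
  qed
  have "nrm A (star A x \<triangleleft> m) \<le> K * nrm A x" if "x \<in> car A" for x
    using K[of "star A x"] that by simp
  then show ?thesis
    by - (rule multiplierI[where K = K]; use adj in \<open>simp add: multiplier_def\<close>)
qed

lemma mone_closed [simp]: "mone A \<in> car (multiplier A)"
  by (rule multiplierI[where K = 1]) (simp_all add: mone_def)

lemma memb_closed [simp]: "a \<in> car A \<Longrightarrow> memb A a \<in> car (multiplier A)"
  by (rule multiplierI[where K = "nrm A a"]) (simp_all add: memb_def mul_assoc nrm_mul)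

lemma multiplier_scl_closed [simp]:
  assumes m: "m \<in> car (multiplier A)"
  shows "scl (multiplier A) c m \<in> car (multiplier A)"
proof -
  note [simp] = multiplierD(1,2,5)[OF m]
  obtain K where K: "\<And>x. x \<in> car A \<Longrightarrow> nrm A (m \<triangleright> x) \<le> K * nrm A x"
    using multiplierD(8)[OF m] by blast
  show ?thesis
    by (rule multiplierI[where K = "cmod c * K"])
      (use K in \<open>simp_all add: multiplier_def alg_simps nrm_scl mult_left_mono mult.assoc\<close>)
qed

lemma multiplier_add_closed [simp]:
  assumes m: "m \<in> car (multiplier A)" and n: "n \<in> car (multiplier A)"
  shows "add (multiplier A) m n \<in> car (multiplier A)"
proof -
  note [simp] = multiplierD(1,2,5)[OF m] multiplierD(1,2,5)[OF n]
  obtain K L where K: "\<And>x. x \<in> car A \<Longrightarrow> nrm A (m \<triangleright> x) \<le> K * nrm A x"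
    and L: "\<And>x. x \<in> car A \<Longrightarrow> nrm A (n \<triangleright> x) \<le> L * nrm A x"
    using multiplierD(8)[OF m] multiplierD(8)[OF n] by blast
  show ?thesis
  proof (rule multiplierI[where K = "K + L"])
    fix x assume x: "x \<in> car A"
    show "nrm A (add (multiplier A) m n \<triangleright> x) \<le> (K + L) * nrm A x"
      using x K[OF x] L[OF x] nrm_triangle[of "m \<triangleright> x" "n \<triangleright> x"] by (simp add: distrib_right)
  qed (simp_all add: multiplier_def alg_simps)
qed

section \<open>The strict topology\<close>

lemma strict_top_left:
  "\<lbrakk>n \<in> car (multiplier A); a \<in> car A; 0 < e\<rbrakk>
    \<Longrightarrow> openin (strict_top A) {m \<in> car (multiplier A). dst A (m \<triangleright> a) (n \<triangleright> a) < e}"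
  unfolding strict_top_def by (rule topology_generated_by_Basis) blast

lemma strict_top_right:
  "\<lbrakk>n \<in> car (multiplier A); a \<in> car A; 0 < e\<rbrakk>
    \<Longrightarrow> openin (strict_top A) {m \<in> car (multiplier A). dst A (a \<triangleleft> m) (a \<triangleleft> n) < e}"
  unfolding strict_top_def by (rule topology_generated_by_Basis) blast

lemma topspace_strict_top: "topspace (strict_top A) = car (multiplier A)"
proof
  show "topspace (strict_top A) \<subseteq> car (multiplier A)"
    unfolding strict_top_def topology_generated_by_topspace by auto
  have "{m \<in> car (multiplier A). dst A (m \<triangleright> zer A) (mone A \<triangleright> zer A) < 1} \<subseteq> topspace (strict_top A)"
    by (intro openin_subset strict_top_left) simp_all
  moreover have "m \<in> {m \<in> car (multiplier A). dst A (m \<triangleright> zer A) (mone A \<triangleright> zer A) < 1}"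
    if "m \<in> car (multiplier A)" for m using that by (simp add: dst_def)
  ultimately show "car (multiplier A) \<subseteq> topspace (strict_top A)" by blast
qed

text \<open>Subbasic sets are balls around some \<open>n \<triangleright> a\<close> or
  \<open>a \<triangleleft> n\<close>. The test forgets \<open>n\<close> and keeps its value as the
  centre \<open>b\<close>, so only balls in the algebra itself have to be pulled back.\<close>

lemma strict_continuousI:
  assumes cl: "\<And>m. m \<in> car (multiplier A) \<Longrightarrow> g m \<in> car (multiplier A)"
    and L: "\<And>a b e. a \<in> car A \<Longrightarrow> b \<in> car A \<Longrightarrow> 0 < e
      \<Longrightarrow> openin (strict_top A) {m \<in> car (multiplier A). nrm A (sub A (g m \<triangleright> a) b) < e}"
    and R: "\<And>a b e. a \<in> car A \<Longrightarrow> b \<in> car A \<Longrightarrow> 0 < e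
      \<Longrightarrow> openin (strict_top A) {m \<in> car (multiplier A). nrm A (sub A (a \<triangleleft> g m) b) < e}"
  shows "continuous_map (strict_top A) (strict_top A) g"
proof -
  let ?l = "{{m \<in> car (multiplier A). dst A (m \<triangleright> a) (n \<triangleright> a) < e} | n a e.
         n \<in> car (multiplier A) \<and> a \<in> car A \<and> 0 < e}"
  let ?r = "{{m \<in> car (multiplier A). dst A (a \<triangleleft> m) (a \<triangleleft> n) < e} | n a e.
         n \<in> car (multiplier A) \<and> a \<in> car A \<and> 0 < e}"
  have "continuous_map (strict_top A) (topology_generated_by (?l \<union> ?r)) g"
    unfolding continuous_on_generated_topo_iff topspace_strict_top
  proof (intro conjI allI impI)
    fix V assume "V \<in> ?l \<union> ?r"
    then consider (l) n a e where "n \<in> car (multiplier A)" "a \<in> car A" "0 < e"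
        "V = {m \<in> car (multiplier A). dst A (m \<triangleright> a) (n \<triangleright> a) < e}"
      | (r) n a e where "n \<in> car (multiplier A)" "a \<in> car A" "0 < e"
        "V = {m \<in> car (multiplier A). dst A (a \<triangleleft> m) (a \<triangleleft> n) < e}" by blast
    then show "openin (strict_top A) (g -` V \<inter> car (multiplier A))"
    proof cases
      case l
      have "m \<in> g -` V \<longleftrightarrow> nrm A (sub A (g m \<triangleright> a) (n \<triangleright> a)) < e" if "m \<in> car (multiplier A)" for m
        using l cl[OF that] multiplierD(1)[OF cl[OF that]] multiplierD(1)[OF l(1)] by (simp add: dst_def)
      then have "g -` V \<inter> car (multiplier A)
        = {m \<in> car (multiplier A). nrm A (sub A (g m \<triangleright> a) (n \<triangleright> a)) < e}" by blast
      then show ?thesis using L[of a "n \<triangleright> a" e] l multiplierD(1) by simp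
    next
      case r
      have "m \<in> g -` V \<longleftrightarrow> nrm A (sub A (a \<triangleleft> g m) (a \<triangleleft> n)) < e" if "m \<in> car (multiplier A)" for m
        using r cl[OF that] multiplierD(2)[OF cl[OF that]] multiplierD(2)[OF r(1)] by (simp add: dst_def)
      then have "g -` V \<inter> car (multiplier A)
        = {m \<in> car (multiplier A). nrm A (sub A (a \<triangleleft> g m) (a \<triangleleft> n)) < e}" by blast
      then show ?thesis using R[of a "a \<triangleleft> n" e] r multiplierD(2) by simp
    qed
  next
    have "\<Union> (?l \<union> ?r) = car (multiplier A)"
      using topspace_strict_top unfolding strict_top_def topology_generated_by_topspace .
    then show "g ` car (multiplier A) \<subseteq> \<Union> (?l \<union> ?r)" using cl by (simp only:) (rule image_subsetI)
  qed
  then show ?thesis by (simp only: strict_top_def)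
qed

lemma strict_ball_left:
  assumes "a \<in> car A" "b \<in> car A"
  shows "openin (strict_top A) {m \<in> car (multiplier A). nrm A (sub A (m \<triangleright> a) b) < e}"
proof (subst openin_subopen, intro ballI)
  fix m assume "m \<in> {m \<in> car (multiplier A). nrm A (sub A (m \<triangleright> a) b) < e}"
  then have m: "m \<in> car (multiplier A)" "nrm A (sub A (m \<triangleright> a) b) < e" by auto
  let ?U = "{n \<in> car (multiplier A). dst A (n \<triangleright> a) (m \<triangleright> a) < e - nrm A (sub A (m \<triangleright> a) b)}"
  have "openin (strict_top A) ?U" using m assms by (intro strict_top_left) simp_all
  moreover have "m \<in> ?U" using m assms multiplierD(1)[OF m(1)] by (simp add: dst_def)
  moreover have "nrm A (sub A (n \<triangleright> a) b) < e" if "n \<in> ?U" for n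
  proof -
    have n: "n \<in> car (multiplier A)" using that by simp
    show ?thesis
      using that assms multiplierD(1)[OF n] multiplierD(1)[OF m(1)]
        nrm_sub_triangle[of "n \<triangleright> a" "m \<triangleright> a" b] by (simp add: dst_def)
  qed
  ultimately show "\<exists>T. openin (strict_top A) T \<and> m \<in> T
      \<and> T \<subseteq> {m \<in> car (multiplier A). nrm A (sub A (m \<triangleright> a) b) < e}"
    by (intro exI[of _ ?U]) auto
qed

text \<open>As on the left, \<open>b\<close> need not be a value at \<open>a\<close> of a
  multiplier, so the set need not be subbasic; by the triangle inequality it is a union of subbasic
  sets.\<close>

lemma strict_ball_right:
  assumes "a \<in> car A" "b \<in> car A"
  shows "openin (strict_top A) {m \<in> car (multiplier A). nrm A (sub A (a \<triangleleft> m) b) < e}"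
proof (subst openin_subopen, intro ballI)
  fix m assume "m \<in> {m \<in> car (multiplier A). nrm A (sub A (a \<triangleleft> m) b) < e}"
  then have m: "m \<in> car (multiplier A)" "nrm A (sub A (a \<triangleleft> m) b) < e" by auto
  let ?U = "{n \<in> car (multiplier A). dst A (a \<triangleleft> n) (a \<triangleleft> m) < e - nrm A (sub A (a \<triangleleft> m) b)}"
  have "openin (strict_top A) ?U" using m assms by (intro strict_top_right) simp_all
  moreover have "m \<in> ?U" using m assms multiplierD(2)[OF m(1)] by (simp add: dst_def)
  moreover have "nrm A (sub A (a \<triangleleft> n) b) < e" if "n \<in> ?U" for n
  proof -
    have n: "n \<in> car (multiplier A)" using that by simp
    show ?thesis
      using that assms multiplierD(2)[OF n] multiplierD(2)[OF m(1)]
        nrm_sub_triangle[of "a \<triangleleft> n" "a \<triangleleft> m" b] by (simp add: dst_def)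
  qed
  ultimately show "\<exists>T. openin (strict_top A) T \<and> m \<in> T
      \<and> T \<subseteq> {m \<in> car (multiplier A). nrm A (sub A (a \<triangleleft> m) b) < e}"
    by (intro exI[of _ ?U]) auto
qed

lemma nrm_sub_star: "\<lbrakk>x \<in> car A; y \<in> car A\<rbrakk> \<Longrightarrow> nrm A (sub A (star A x) y) = nrm A (sub A x (star A y))"
  using nrm_star[of "sub A x (star A y)"] by (simp add: star_sub)

text \<open>The adjoint exchanges left balls at \<open>a\<close> with right balls at
  \<open>star A a\<close>.\<close>

lemma strict_star_continuous:
  "continuous_map (strict_top A) (strict_top A) (star (multiplier A))"
proof (rule strict_continuousI)
  fix a b and e :: real assume ab: "a \<in> car A" "b \<in> car A"
  have "{m \<in> car (multiplier A). nrm A (sub A (star (multiplier A) m \<triangleright> a) b) < e}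
      = {m \<in> car (multiplier A). nrm A (sub A (star A a \<triangleleft> m) (star A b)) < e}"
    using ab multiplierD(2) by (intro Collect_cong conj_cong) (simp_all add: nrm_sub_star)
  then show "openin (strict_top A) {m \<in> car (multiplier A). nrm A (sub A (star (multiplier A) m \<triangleright> a) b) < e}"
    using strict_ball_right[of "star A a" "star A b" e] ab by simp
  have "{m \<in> car (multiplier A). nrm A (sub A (a \<triangleleft> star (multiplier A) m) b) < e}
      = {m \<in> car (multiplier A). nrm A (sub A (m \<triangleright> star A a) (star A b)) < e}"
    using ab multiplierD(1) by (intro Collect_cong conj_cong) (simp_all add: nrm_sub_star)
  then show "openin (strict_top A) {m \<in> car (multiplier A). nrm A (sub A (a \<triangleleft> star (multiplier A) m) b) < e}"
    using strict_ball_left[of "star A a" "star A b" e] ab by simp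
qed simp

end

section \<open>Extension of an endomorphism onto a corner\<close>

text \<open>\<open>p\<close> is a projection that will be the value of the extension at 1. The last
  two assumptions make the range of \<open>\<beta>\<close> the whole corner \<open>p C p\<close>,
  which takes the place of nondegeneracy.\<close>

locale corner_endomorphism = cstar_algebra C for C :: "'a cstar" +
  fixes \<beta> :: "'a \<Rightarrow> 'a" and p :: "'a mlt"
  assumes hom: "cstar_hom C C \<beta>" and p: "p \<in> car (multiplier C)"
    and p_star: "x \<in> car C \<Longrightarrow> star C (p \<triangleright> x) = star C x \<triangleleft> p"
    and p_idem: "x \<in> car C \<Longrightarrow> p \<triangleright> (p \<triangleright> x) = p \<triangleright> x"
    and p_range: "c \<in> car C \<Longrightarrow> p \<triangleright> \<beta> c = \<beta> c"
    and range: "x \<in> car C \<Longrightarrow> p \<triangleright> (x \<triangleleft> p) \<in> \<beta> ` car C"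
begin

lemmas hom_simps [simp] = cstar_hom_simps[OF hom]
lemmas p_closed [simp] = multiplierD(1,2)[OF p]

lemma range_p: "c \<in> car C \<Longrightarrow> \<beta> c \<triangleleft> p = \<beta> c"
  using p_star[of "\<beta> (star C c)"] p_range[of "star C c"] by simp

lemma mul_range: "\<lbrakk>u \<in> car C; c \<in> car C\<rbrakk> \<Longrightarrow> u \<cdot>\<^bsub>C\<^esub> \<beta> c = (u \<triangleleft> p) \<cdot>\<^bsub>C\<^esub> \<beta> c"
  using multiplierD(5)[OF p, of u "\<beta> c"] p_range by simp

lemma range_mul: "\<lbrakk>u \<in> car C; c \<in> car C\<rbrakk> \<Longrightarrow> \<beta> c \<cdot>\<^bsub>C\<^esub> u = \<beta> c \<cdot>\<^bsub>C\<^esub> (p \<triangleright> u)"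
  using multiplierD(5)[OF p, of "\<beta> c" u] range_p by simp

text \<open>The range is the common fixed set of \<open>x \<mapsto> p x\<close> and
  \<open>x \<mapsto> x p\<close>, hence closed, as Cohen factorisation requires.\<close>

lemma range_cstar_sub: "cstar_sub C (\<beta> ` car C)"
proof -
  have eq: "\<beta> ` car C = {x \<in> car C. p \<triangleright> x = x \<and> x \<triangleleft> p = x}"
  proof
    show "{x \<in> car C. p \<triangleright> x = x \<and> x \<triangleleft> p = x} \<subseteq> \<beta> ` car C" using range by fastforce
  qed (use p_range range_p in auto)
  have "closed_subspace C (\<beta> ` car C)"
    unfolding closed_subspace_approx
  proof (intro conjI allI impI)
    show "subspace_of C (\<beta> ` car C)"
      unfolding eq subspace_of_def using p by (auto simp: multiplier_add multiplier_scl)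
    fix x assume x: "approx C (\<beta> ` car C) x"
    have "p \<triangleright> x = x" "x \<triangleleft> p = x"
      by (rule approx_eq[OF banach x multiplier_lip(1)[OF p] lip_id]
          approx_eq[OF banach x multiplier_lip(2)[OF p] lip_id]; use p_range range_p in auto)+
    then show "x \<in> \<beta> ` car C" unfolding eq using x by (simp add: approx_def)
  qed
  moreover have "\<beta> x \<cdot>\<^bsub>C\<^esub> \<beta> y \<in> \<beta> ` car C" if "x \<in> car C" "y \<in> car C" for x y
    using that by (intro image_eqI[of _ _ "x \<cdot>\<^bsub>C\<^esub> y"]) simp_all
  moreover have "star C (\<beta> x) \<in> \<beta> ` car C" if "x \<in> car C" for x
    using that by (intro image_eqI[of _ _ "star C x"]) simp_all
  ultimately show ?thesis by (auto simp: cstar_sub_def)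
qed

text \<open>\<open>p x\<close> times its adjoint is \<open>p x x\<^sup>* p\<close>, which lies in
  the corner, so Cohen's left factor can be taken in the range of \<open>\<beta>\<close>.\<close>

lemma factor:
  assumes x: "x \<in> car C"
  obtains f y where "f \<in> car C" "y \<in> car C" "p \<triangleright> x = \<beta> f \<cdot>\<^bsub>C\<^esub> y"
proof -
  have "(p \<triangleright> x) \<cdot>\<^bsub>C\<^esub> star C (p \<triangleright> x) = p \<triangleright> ((x \<cdot>\<^bsub>C\<^esub> star C x) \<triangleleft> p)"
    using x multiplierD(3,4)[OF p] by (simp add: p_star)
  then have "(p \<triangleright> x) \<cdot>\<^bsub>C\<^esub> star C (p \<triangleright> x) \<in> \<beta> ` car C" using range x by simp
  then show thesis
    using cohen_factorisation[OF range_cstar_sub, of "p \<triangleright> x"] x that by (metis imageE p_closed(1))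
qed

text \<open>Factorisations of \<open>p x\<close> are far from unique. The choice is among the values
  they produce, and \<open>ext_eq\<close> shows that there is only one.\<close>

definition ext :: "'a mlt \<Rightarrow> 'a \<Rightarrow> 'a" where
  "ext m x = (SOME z. \<exists>f y. f \<in> car C \<and> y \<in> car C \<and> p \<triangleright> x = \<beta> f \<cdot>\<^bsub>C\<^esub> y \<and> z = \<beta> (m \<triangleright> f) \<cdot>\<^bsub>C\<^esub> y)"

text \<open>On the right, \<open>f\<close> and \<open>y\<close> occur only through
  \<open>p x\<close>, so the left side is independent of the factorisation and \<open>ext\<close> is
  well defined. The same identity yields the adjointness of the extended left and right
  actions.\<close>

lemma factor_pairing:
  assumes m: "m \<in> car (multiplier C)" and c: "f \<in> car C" "y \<in> car C" "x \<in> car C" "e \<in> car C" "w \<in> car C" "u \<in> car C"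
    and x: "p \<triangleright> x = \<beta> f \<cdot>\<^bsub>C\<^esub> y" and u: "p \<triangleright> star C u = \<beta> e \<cdot>\<^bsub>C\<^esub> w"
  shows "u \<cdot>\<^bsub>C\<^esub> (\<beta> (m \<triangleright> f) \<cdot>\<^bsub>C\<^esub> y) = star C w \<cdot>\<^bsub>C\<^esub> (\<beta> (star C e \<triangleleft> m) \<cdot>\<^bsub>C\<^esub> (p \<triangleright> x))"
proof -
  note md = multiplierD(1,2,5)[OF m]
  have "u \<triangleleft> p = star C (p \<triangleright> star C u)" using c p_star[of "star C u"] by simp
  also have "\<dots> = star C w \<cdot>\<^bsub>C\<^esub> \<beta> (star C e)" using c unfolding u by (simp add: star_mul)
  finally have up: "u \<triangleleft> p = star C w \<cdot>\<^bsub>C\<^esub> \<beta> (star C e)" .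
  have "u \<cdot>\<^bsub>C\<^esub> (\<beta> (m \<triangleright> f) \<cdot>\<^bsub>C\<^esub> y) = u \<cdot>\<^bsub>C\<^esub> \<beta> (m \<triangleright> f) \<cdot>\<^bsub>C\<^esub> y"
    using c md by (simp add: mul_assoc)
  also have "\<dots> = star C w \<cdot>\<^bsub>C\<^esub> \<beta> (star C e) \<cdot>\<^bsub>C\<^esub> \<beta> (m \<triangleright> f) \<cdot>\<^bsub>C\<^esub> y"
    using c md up mul_range[of u "m \<triangleright> f"] by simp
  also have "\<dots> = star C w \<cdot>\<^bsub>C\<^esub> \<beta> (star C e \<cdot>\<^bsub>C\<^esub> (m \<triangleright> f)) \<cdot>\<^bsub>C\<^esub> y"
    using c md by (simp add: mul_assoc)
  also have "\<dots> = star C w \<cdot>\<^bsub>C\<^esub> \<beta> ((star C e \<triangleleft> m) \<cdot>\<^bsub>C\<^esub> f) \<cdot>\<^bsub>C\<^esub> y"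
    using c md(3) by simp
  also have "\<dots> = star C w \<cdot>\<^bsub>C\<^esub> (\<beta> (star C e \<triangleleft> m) \<cdot>\<^bsub>C\<^esub> (\<beta> f \<cdot>\<^bsub>C\<^esub> y))"
    using c md(1,2) by (simp add: mul_assoc)
  finally show ?thesis using x by simp
qed

lemma ext_eq:
  assumes m: "m \<in> car (multiplier C)" and f: "f \<in> car C" "y \<in> car C" "x \<in> car C" "p \<triangleright> x = \<beta> f \<cdot>\<^bsub>C\<^esub> y"
  shows "ext m x = \<beta> (m \<triangleright> f) \<cdot>\<^bsub>C\<^esub> y"
  unfolding ext_def
proof (rule some_equality)
  fix z assume "\<exists>f y. f \<in> car C \<and> y \<in> car C \<and> p \<triangleright> x = \<beta> f \<cdot>\<^bsub>C\<^esub> y \<and> z = \<beta> (m \<triangleright> f) \<cdot>\<^bsub>C\<^esub> y"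
  then obtain f' y' where f': "f' \<in> car C" "y' \<in> car C" "p \<triangleright> x = \<beta> f' \<cdot>\<^bsub>C\<^esub> y'"
    and z: "z = \<beta> (m \<triangleright> f') \<cdot>\<^bsub>C\<^esub> y'" by blast
  show "z = \<beta> (m \<triangleright> f) \<cdot>\<^bsub>C\<^esub> y"
    unfolding z
  proof (rule eq_by_left_mult)
    fix u assume u: "u \<in> car C"
    obtain e w where e: "e \<in> car C" "w \<in> car C" "p \<triangleright> star C u = \<beta> e \<cdot>\<^bsub>C\<^esub> w"
      using factor[of "star C u"] u by auto
    show "u \<cdot>\<^bsub>C\<^esub> (\<beta> (m \<triangleright> f') \<cdot>\<^bsub>C\<^esub> y') = u \<cdot>\<^bsub>C\<^esub> (\<beta> (m \<triangleright> f) \<cdot>\<^bsub>C\<^esub> y)"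
      using factor_pairing[OF m f'(1,2) f(3) e(1,2) u f'(3) e(3)]
        factor_pairing[OF m f(1,2,3) e(1,2) u f(4) e(3)] by simp
  qed (use f f' multiplierD[OF m] in simp_all)
qed (use f in blast)

lemma ext_closed: "\<lbrakk>m \<in> car (multiplier C); x \<in> car C\<rbrakk> \<Longrightarrow> ext m x \<in> car C"
  by (metis factor ext_eq hom_simps(1) mul_closed multiplierD(1))

lemma p_ext: 
  assumes m: "m \<in> car (multiplier C)" and f: "f \<in> car C" "y \<in> car C" 
  shows "p \<triangleright> (\<beta> (m \<triangleright> f) \<cdot>\<^bsub>C\<^esub> y) = \<beta> (m \<triangleright> f) \<cdot>\<^bsub>C\<^esub> y"
  using multiplierD(3)[OF p] multiplierD(1)[OF m] f by (simp add: p_range)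

text \<open>Factorisation is used here without control of the norms of \<open>f\<close> and
  \<open>y\<close>. A contraction \<open>w\<close> that nearly fixes \<open>m f\<close> removes
  them: \<open>\<beta>(w m f) y = \<beta>(w m) p x\<close>.\<close>

lemma ext_bound:
  assumes m: "m \<in> car (multiplier C)" and K: "\<And>x. x \<in> car C \<Longrightarrow> nrm C (x \<triangleleft> m) \<le> K * nrm C x"
    and P: "\<And>x. x \<in> car C \<Longrightarrow> nrm C (p \<triangleright> x) \<le> P * nrm C x" and x: "x \<in> car C"
  shows "nrm C (ext m x) \<le> \<bar>K\<bar> * P * nrm C x"
proof -
  obtain f y where f: "f \<in> car C" "y \<in> car C" "p \<triangleright> x = \<beta> f \<cdot>\<^bsub>C\<^esub> y" using factor x by blast
  note md [simp] = multiplierD(1,2)[OF m]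
  have con: "nrm C (\<beta> c) \<le> nrm C c" if "c \<in> car C" for c
    using cstar_hom_contractive[OF cstar_algebra_axioms cstar_algebra_axioms hom that] .
  have "nrm C (ext m x) \<le> \<bar>K\<bar> * P * nrm C x + e" if e: "e > 0" for e
  proof -
    have "e / (nrm C y + 1) > 0" using e nrm_nonneg[OF f(2)] by simp
    then obtain w where w: "w \<in> car C" "nrm C w \<le> 1"
      "nrm C (sub C (m \<triangleright> f) (w \<cdot>\<^bsub>C\<^esub> (m \<triangleright> f))) < e / (nrm C y + 1)"
      using left_approximate_unit[of "m \<triangleright> f"] f by auto
    let ?u = "sub C (m \<triangleright> f) (w \<cdot>\<^bsub>C\<^esub> (m \<triangleright> f))"
    have "w \<cdot>\<^bsub>C\<^esub> (m \<triangleright> f) = (w \<triangleleft> m) \<cdot>\<^bsub>C\<^esub> f" using multiplierD(5)[OF m] w f by simp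
    then have "\<beta> (w \<cdot>\<^bsub>C\<^esub> (m \<triangleright> f)) \<cdot>\<^bsub>C\<^esub> y = \<beta> (w \<triangleleft> m) \<cdot>\<^bsub>C\<^esub> (p \<triangleright> x)"
      using w f by (simp add: mul_assoc)
    moreover have "ext m x = add C (\<beta> (w \<cdot>\<^bsub>C\<^esub> (m \<triangleright> f)) \<cdot>\<^bsub>C\<^esub> y) (\<beta> ?u \<cdot>\<^bsub>C\<^esub> y)"
      using f w x ext_eq[OF m f(1,2) x f(3)] linear_map_sub[OF cstar_hom_linear[OF hom]]
      by (intro vec_eqI) (auto simp: functional_simps alg_simps)
    ultimately have "nrm C (ext m x) \<le> nrm C (\<beta> (w \<triangleleft> m) \<cdot>\<^bsub>C\<^esub> (p \<triangleright> x)) + nrm C (\<beta> ?u \<cdot>\<^bsub>C\<^esub> y)"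
      using f w x by (simp add: nrm_triangle)
    also have "nrm C (\<beta> ?u \<cdot>\<^bsub>C\<^esub> y) \<le> (e / (nrm C y + 1)) * nrm C y"
      using f w con[of ?u] by (intro nrm_mul_le) auto
    also have "\<dots> \<le> e" using e nrm_nonneg[OF f(2)] by (simp add: field_simps)
    also have "nrm C (\<beta> (w \<triangleleft> m) \<cdot>\<^bsub>C\<^esub> (p \<triangleright> x)) \<le> \<bar>K\<bar> * (P * nrm C x)"
    proof (rule nrm_mul_le)
      have "nrm C (\<beta> (w \<triangleleft> m)) \<le> K * nrm C w" using con[of "w \<triangleleft> m"] K w by fastforce
      also have "\<dots> \<le> \<bar>K\<bar> * 1" using w nrm_nonneg[OF w(1)] by (intro mult_mono) auto
      finally show "nrm C (\<beta> (w \<triangleleft> m)) \<le> \<bar>K\<bar>" by simp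
    qed (use w x P in simp_all)
    finally show ?thesis by (simp add: mult.assoc)
  qed
  then show ?thesis by (rule field_le_epsilon)
qed

text \<open>The right action is the left one conjugated by the adjoint, which makes preservation of
  adjoints a direct computation.\<close>

definition extension :: "'a mlt \<Rightarrow> 'a mlt" where
  "extension m = (\<lambda>x\<in>car C. ext m x, \<lambda>x\<in>car C. star C (ext (star (multiplier C) m) (star C x)))"

lemma extension_apply [simp]:
  "x \<in> car C \<Longrightarrow> extension m \<triangleright> x = ext m x"
  "x \<in> car C \<Longrightarrow> x \<triangleleft> extension m = star C (ext (star (multiplier C) m) (star C x))"
  by (simp_all add: extension_def)

lemma extension_closed [simp]:
  assumes m: "m \<in> car (multiplier C)"
  shows "extension m \<in> car (multiplier C)"
proof -
  note md [simp] = multiplierD(1,2)[OF m]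
  obtain K where K: "\<And>x. x \<in> car C \<Longrightarrow> nrm C (x \<triangleleft> m) \<le> K * nrm C x"
    using multiplierD(9)[OF m] by blast
  obtain P where P: "\<And>x. x \<in> car C \<Longrightarrow> nrm C (p \<triangleright> x) \<le> P * nrm C x"
    using multiplierD(8)[OF p] by blast
  show ?thesis
  proof (rule multiplierI[where K = "\<bar>K\<bar> * P"])
    fix x y assume x: "x \<in> car C" and y: "y \<in> car C"
    obtain e w where e: "e \<in> car C" "w \<in> car C" "p \<triangleright> star C x = \<beta> e \<cdot>\<^bsub>C\<^esub> w"
      using factor[of "star C x"] x by auto
    obtain f z where f: "f \<in> car C" "z \<in> car C" "p \<triangleright> y = \<beta> f \<cdot>\<^bsub>C\<^esub> z" using factor[OF y] by blast
    have "star C (ext (star (multiplier C) m) (star C x)) \<cdot>\<^bsub>C\<^esub> y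
        = star C w \<cdot>\<^bsub>C\<^esub> (\<beta> (star C e \<triangleleft> m) \<cdot>\<^bsub>C\<^esub> y)"
      using x y e by (subst ext_eq[OF _ e(1,2) _ e(3)]) (simp_all add: m alg_simps)
    also have "\<dots> = x \<cdot>\<^bsub>C\<^esub> (\<beta> (m \<triangleright> f) \<cdot>\<^bsub>C\<^esub> z)"
      using factor_pairing[OF m f(1,2) y e(1,2) x f(3) e(3)] range_mul[OF y, of "star C e \<triangleleft> m"] e
      by simp
    finally show "(x \<triangleleft> extension m) \<cdot>\<^bsub>C\<^esub> y = x \<cdot>\<^bsub>C\<^esub> (extension m \<triangleright> y)"
      using x y ext_eq[OF m f(1,2) y f(3)] by simp
  qed (use ext_bound[OF m K P] ext_closed m in \<open>simp_all add: extension_def\<close>)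
qed

lemma extension_hom: "cstar_hom (multiplier C) (multiplier C) extension"
  unfolding cstar_hom_def linear_map_def
proof (intro conjI ballI allI funcsetI)
  fix m assume m: "m \<in> car (multiplier C)"
  show "extension m \<in> car (multiplier C)" using m by simp
  show "extension (scl (multiplier C) c m) = scl (multiplier C) c (extension m)" for c
  proof (rule multiplier_eqI)
    fix x assume x: "x \<in> car C"
    obtain f y where f: "f \<in> car C" "y \<in> car C" "p \<triangleright> x = \<beta> f \<cdot>\<^bsub>C\<^esub> y" using factor[OF x] by blast
    show "extension (scl (multiplier C) c m) \<triangleright> x = scl (multiplier C) c (extension m) \<triangleright> x"
      using x m f multiplierD(1)[OF m] ext_eq[OF _ f(1,2) x f(3)] by (simp add: alg_simps)
  qed (use m in simp_all)
  show "extension (star (multiplier C) m) = star (multiplier C) (extension m)"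
  proof (rule multiplier_eqI)
    fix x assume x: "x \<in> car C"
    show "extension (star (multiplier C) m) \<triangleright> x = star (multiplier C) (extension m) \<triangleright> x"
      using x m by (simp add: ext_closed)
  qed (use m in simp_all)
  fix n assume n: "n \<in> car (multiplier C)"
  show "extension (add (multiplier C) m n) = add (multiplier C) (extension m) (extension n)"
  proof (rule multiplier_eqI)
    fix x assume x: "x \<in> car C"
    obtain f y where f: "f \<in> car C" "y \<in> car C" "p \<triangleright> x = \<beta> f \<cdot>\<^bsub>C\<^esub> y" using factor[OF x] by blast
    show "extension (add (multiplier C) m n) \<triangleright> x
        = add (multiplier C) (extension m) (extension n) \<triangleright> x"
      using x m n f multiplierD(1)[OF m] multiplierD(1)[OF n] ext_eq[OF _ f(1,2) x f(3)]
      by (simp add: alg_simps)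
  qed (use m n in simp_all)
  show "extension (m \<cdot>\<^bsub>multiplier C\<^esub> n) = extension m \<cdot>\<^bsub>multiplier C\<^esub> extension n"
  proof (rule multiplier_eqI)
    fix x assume x: "x \<in> car C"
    obtain f y where f: "f \<in> car C" "y \<in> car C" "p \<triangleright> x = \<beta> f \<cdot>\<^bsub>C\<^esub> y" using factor[OF x] by blast
    have nf: "n \<triangleright> f \<in> car C" using multiplierD(1)[OF n] f by simp
    \<comment> \<open>\<open>ext n x\<close> comes factored, with the same \<open>y\<close>, so
      \<open>ext m\<close> can be evaluated on it at once.\<close>
    have "ext n x = \<beta> (n \<triangleright> f) \<cdot>\<^bsub>C\<^esub> y" using ext_eq[OF n f(1,2) x f(3)] .
    then have "ext m (ext n x) = \<beta> (m \<triangleright> (n \<triangleright> f)) \<cdot>\<^bsub>C\<^esub> y"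
      using p_ext[OF n f(1,2)] ext_closed[OF n x] by (intro ext_eq[OF m nf f(2)]) simp_all
    then show "extension (m \<cdot>\<^bsub>multiplier C\<^esub> n) \<triangleright> x
        = (extension m \<cdot>\<^bsub>multiplier C\<^esub> extension n) \<triangleright> x"
      using x m n f nf ext_eq[OF _ f(1,2) x f(3)] by simp
  qed (use m n in simp_all)
qed

lemma extension_memb:
  assumes a: "a \<in> car C" shows "extension (memb C a) = memb C (\<beta> a)"
proof (rule multiplier_eqI)
  fix x assume x: "x \<in> car C"
  obtain f y where f: "f \<in> car C" "y \<in> car C" "p \<triangleright> x = \<beta> f \<cdot>\<^bsub>C\<^esub> y" using factor[OF x] by blast
  show "extension (memb C a) \<triangleright> x = memb C (\<beta> a) \<triangleright> x"
    using x a f ext_eq[OF _ f(1,2) x f(3)] range_mul[OF x a] by (simp add: mul_assoc)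
qed (use a in simp_all)

lemma extension_mone: "extension (mone C) = p"
proof (rule multiplier_eqI)
  fix x assume x: "x \<in> car C"
  obtain f y where f: "f \<in> car C" "y \<in> car C" "p \<triangleright> x = \<beta> f \<cdot>\<^bsub>C\<^esub> y" using factor[OF x] by blast
  show "extension (mone C) \<triangleright> x = p \<triangleright> x" using x f ext_eq[OF _ f(1,2) x f(3)] by simp
qed (use p in simp_all)

lemma ext_dist:
  assumes m: "m \<in> car (multiplier C)" and n: "n \<in> car (multiplier C)"
    and f: "f \<in> car C" "y \<in> car C" "x \<in> car C" "p \<triangleright> x = \<beta> f \<cdot>\<^bsub>C\<^esub> y"
  shows "nrm C (sub C (ext m x) (ext n x)) \<le> nrm C (sub C (m \<triangleright> f) (n \<triangleright> f)) * nrm C y"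
proof -
  note [simp] = multiplierD(1)[OF m] multiplierD(1)[OF n]
  have "sub C (ext m x) (ext n x) = \<beta> (sub C (m \<triangleright> f) (n \<triangleright> f)) \<cdot>\<^bsub>C\<^esub> y"
    using f ext_eq[OF m f] ext_eq[OF n f] linear_map_sub[OF cstar_hom_linear[OF hom]]
    by (simp add: mul_sub_left)
  also have "nrm C \<dots> \<le> nrm C (sub C (m \<triangleright> f) (n \<triangleright> f)) * nrm C y"
    using f cstar_hom_contractive[OF cstar_algebra_axioms cstar_algebra_axioms hom]
    by (intro nrm_mul_le) auto
  finally show ?thesis .
qed

text \<open>By \<open>ext_dist\<close>, the seminorm at \<open>x\<close> of the image is dominated by the single seminorm at the
  factor \<open>f\<close>.\<close>

lemma extension_continuous: "continuous_map (strict_top C) (strict_top C) extension"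
proof -
  have L: "openin (strict_top C) {m \<in> car (multiplier C). nrm C (sub C (ext m x) b) < e}"
    if x: "x \<in> car C" and b: "b \<in> car C" for x b e
  proof (subst openin_subopen, intro ballI)
    fix m assume "m \<in> {m \<in> car (multiplier C). nrm C (sub C (ext m x) b) < e}"
    then have m: "m \<in> car (multiplier C)" and lt: "nrm C (sub C (ext m x) b) < e" by auto
    obtain f y where f: "f \<in> car C" "y \<in> car C" "p \<triangleright> x = \<beta> f \<cdot>\<^bsub>C\<^esub> y" using factor[OF x] by blast
    define d where "d = (e - nrm C (sub C (ext m x) b)) / (nrm C y + 1)"
    have d: "d > 0" using lt nrm_nonneg[OF f(2)] by (simp add: d_def)
    let ?U = "{n \<in> car (multiplier C). dst C (n \<triangleright> f) (m \<triangleright> f) < d}"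
    have "nrm C (sub C (ext n x) b) < e" if n: "n \<in> ?U" for n
    proof -
      have nm: "n \<in> car (multiplier C)" using n by simp
      have nd: "nrm C (sub C (n \<triangleright> f) (m \<triangleright> f)) < d"
        using n f multiplierD(1)[OF nm] multiplierD(1)[OF m] by (simp add: dst_def)
      have "nrm C (sub C (ext n x) b) \<le> nrm C (sub C (ext n x) (ext m x)) + nrm C (sub C (ext m x) b)"
        using x b m nm by (intro nrm_sub_triangle ext_closed)
      also have "nrm C (sub C (ext n x) (ext m x)) \<le> nrm C (sub C (n \<triangleright> f) (m \<triangleright> f)) * nrm C y"
        using ext_dist[OF nm m f(1,2) x f(3)] .
      also have "\<dots> \<le> d * nrm C y" using nd nrm_nonneg[OF f(2)] by (intro mult_right_mono) auto
      also have "\<dots> < d * (nrm C y + 1)" using d by simp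
      also have "\<dots> = e - nrm C (sub C (ext m x) b)" using nrm_nonneg[OF f(2)] by (simp add: d_def)
      finally show ?thesis by simp
    qed
    moreover have "openin (strict_top C) ?U" using m f d by (intro strict_top_left)
    moreover have "m \<in> ?U" using m f d multiplierD(1)[OF m] by (simp add: dst_def)
    ultimately show "\<exists>T. openin (strict_top C) T \<and> m \<in> T
        \<and> T \<subseteq> {m \<in> car (multiplier C). nrm C (sub C (ext m x) b) < e}"
      by (intro exI[of _ ?U]) auto
  qed
  show ?thesis
  proof (rule strict_continuousI)
    fix a b and e :: real assume ab: "a \<in> car C" "b \<in> car C"
    then show "openin (strict_top C) {m \<in> car (multiplier C). nrm C (sub C (extension m \<triangleright> a) b) < e}"
      using L by simp
    \<comment> \<open>Right balls are preimages of left balls under the strictly continuous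
      adjoint.\<close>
    let ?U = "{m \<in> car (multiplier C). nrm C (sub C (ext m (star C a)) (star C b)) < e}"
    have "{m \<in> car (multiplier C). nrm C (sub C (a \<triangleleft> extension m) b) < e}
        = {m \<in> topspace (strict_top C). star (multiplier C) m \<in> ?U}"
      using ab ext_closed unfolding topspace_strict_top
      by (intro Collect_cong conj_cong) (simp_all add: nrm_sub_star)
    then show "openin (strict_top C) {m \<in> car (multiplier C). nrm C (sub C (a \<triangleleft> extension m) b) < e}"
      using openin_continuous_map_preimage[OF strict_star_continuous L[of "star C a" "star C b" e]] ab
      by simp
  qed simp
qed

lemma strict_extension: "strict_extension C \<beta> extension"
  unfolding strict_extension_def
  using extension_hom extension_continuous extension_memb by blast

end

section \<open>Subalgebras and isomorphic copies\<close>

text \<open>The isometry \<open>g\<close> carries Cauchy sequences to \<open>V\<close>, and their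
  limits stay in the closed image. With \<open>g\<close> the identity this serves subalgebras, with
  an inverse map it serves copies. The value 0 off \<open>N\<close> matches
  \<open>dst\<close>.\<close>

lemma isometric_mcomplete:
  assumes V: "complex_banach V" and g: "g ` N \<subseteq> car V" "inj_on g N"
    and d: "d = (\<lambda>x y. if x \<in> N \<and> y \<in> N then dst V (g x) (g y) else 0)"
    and cl: "closedin (norm_top V) (g ` N)"
  shows "Metric_space.mcomplete N d"
proof -
  interpret complex_banach V by fact
  interpret V: Metric_space "car V" "dst V" by (rule metric)
  have gc: "g x \<in> car V" if "x \<in> N" for x using that g by blast
  interpret N: Metric_space N d
  proof
    show "0 \<le> d x y" for x y by (simp add: d)
    show "d x y = d y x" for x y by (simp add: d V.commute)
    show "(d x y = 0) = (x = y)" if "x \<in> N" "y \<in> N" for x y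
      using that gc g(2) by (simp add: d inj_on_eq_iff)
    show "d x z \<le> d x y + d y z" if "x \<in> N" "y \<in> N" "z \<in> N" for x y z
      using that gc V.triangle by (simp add: d)
  qed
  show ?thesis
    unfolding N.mcomplete_def
  proof (intro allI impI)
    fix \<sigma> assume s: "N.MCauchy \<sigma>"
    have sN: "\<sigma> n \<in> N" for n using s by (auto simp: N.MCauchy_def)
    have "V.MCauchy (g \<circ> \<sigma>)"
      using s sN gc unfolding V.MCauchy_def N.MCauchy_def by (auto simp: d)
    then obtain l where l: "limitin V.mtopology (g \<circ> \<sigma>) l sequentially"
      using complete by (auto simp: V.mcomplete_def)
    then have "l \<in> g ` N"
      using cl sN unfolding norm_top_def
      by (intro limitin_closedin[of V.mtopology "g \<circ> \<sigma>" l sequentially "g ` N"]) auto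
    then obtain y where y: "y \<in> N" "l = g y" by blast
    have "limitin N.mtopology \<sigma> y sequentially"
      using l y sN gc unfolding V.limitin_metric N.limitin_metric
      by (auto simp: d elim!: eventually_mono)
    then show "\<exists>x. limitin N.mtopology \<sigma> x sequentially" by blast
  qed
qed

context cstar_algebra
begin

lemma cstar_sub_algebra:
  assumes G: "cstar_sub A G"
  shows "cstar_algebra (A\<lparr>car := G\<rparr>)"
proof -
  have Gs: "closedin (norm_top A) G" "G \<subseteq> car A" "zer A \<in> G"
    "\<And>x y. x \<in> G \<Longrightarrow> y \<in> G \<Longrightarrow> add A x y \<in> G" "\<And>x y. x \<in> G \<Longrightarrow> y \<in> G \<Longrightarrow> x \<cdot>\<^bsub>A\<^esub> y \<in> G"
    "\<And>c x. x \<in> G \<Longrightarrow> scl A c x \<in> G" "\<And>x. x \<in> G \<Longrightarrow> star A x \<in> G"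
    using G(1) by (auto simp: cstar_sub_def closed_subspace_def)
  have c [simp]: "x \<in> car A" if "x \<in> G" for x using that Gs by blast
  have "Metric_space.mcomplete G (dst (A\<lparr>car := G\<rparr>))"
    by (rule isometric_mcomplete[OF banach, where g = "\<lambda>x. x"])
      (use Gs in \<open>auto simp: dst_def sub_def fun_eq_iff\<close>)
  then show ?thesis
    using Gs
    by unfold_locales
      (simp_all add: alg_simps add_assoc add_commute add_left_commute add_neg scl_add_right scl_add_left scl_scl
        nrm_nonneg nrm_eq_zero nrm_triangle nrm_scl nrm_mul cstar_identity)
qed

end

section \<open>Transport of structure along an injection\<close>

definition copy :: "('a \<Rightarrow> 'b) \<Rightarrow> 'a cstar \<Rightarrow> 'b cstar" where
  "copy g A = \<lparr> car = g ` car A, zer = g (zer A),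
     add = (\<lambda>x y. g (add A (inv g x) (inv g y))), scl = (\<lambda>c x. g (scl A c (inv g x))),
     nrm = (\<lambda>x. nrm A (inv g x)), mul = (\<lambda>x y. g (inv g x \<cdot>\<^bsub>A\<^esub> inv g y)),
     star = (\<lambda>x. g (star A (inv g x))) \<rparr>"

definition copy_multiplier :: "('a \<Rightarrow> 'b) \<Rightarrow> 'a cstar \<Rightarrow> 'a mlt \<Rightarrow> 'b mlt" where
  "copy_multiplier g A m = (\<lambda>x\<in>g ` car A. g (m \<triangleright> inv g x), \<lambda>x\<in>g ` car A. g (inv g x \<triangleleft> m))"

context cstar_algebra
begin

context
  fixes g :: "'a \<Rightarrow> 'b"
  assumes inj: "inj g"
begin

lemma copy_simps [simp]:
  "car (copy g A) = g ` car A" "zer (copy g A) = g (zer A)"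
  "add (copy g A) (g x) (g y) = g (add A x y)" "scl (copy g A) c (g x) = g (scl A c x)"
  "nrm (copy g A) (g x) = nrm A x" "g x \<cdot>\<^bsub>copy g A\<^esub> g y = g (x \<cdot>\<^bsub>A\<^esub> y)"
  "star (copy g A) (g x) = g (star A x)" "sub (copy g A) (g x) (g y) = g (sub A x y)"
  using inj by (simp_all add: copy_def sub_def)

lemma copy_algebra: "cstar_algebra (copy g A)"
proof -
  have "Metric_space.mcomplete (g ` car A) (dst (copy g A))"
  proof (rule isometric_mcomplete[OF banach, where g = "inv g"])
    show "closedin (norm_top A) (inv g ` g ` car A)"
      using inj car_closed_subspace by (simp add: image_image closed_subspace_def)
    show "dst (copy g A) = (\<lambda>x y. if x \<in> g ` car A \<and> y \<in> g ` car A then dst A (inv g x) (inv g y) else 0)"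
      using inj by (auto simp: fun_eq_iff dst_def)
  qed (use inj in \<open>auto simp: inj_on_def\<close>)
  then show ?thesis
    using inj
    by unfold_locales
      (auto simp: alg_simps add_assoc add_commute add_left_commute add_neg scl_add_right scl_add_left scl_scl
        nrm_nonneg nrm_eq_zero nrm_triangle nrm_scl nrm_mul cstar_identity inj_eq)
qed

lemma copy_hom: "cstar_hom A (copy g A) g"
  by (simp add: cstar_hom_def linear_map_def)

lemma copy_inv_hom: "cstar_hom (copy g A) A (inv g)"
  using inj by (auto simp: cstar_hom_def linear_map_def)

lemma copy_multiplier_apply [simp]:
  "x \<in> car A \<Longrightarrow> copy_multiplier g A m \<triangleright> g x = g (m \<triangleright> x)"
  "x \<in> car A \<Longrightarrow> g x \<triangleleft> copy_multiplier g A m = g (x \<triangleleft> m)"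
  using inj by (simp_all add: copy_multiplier_def)

lemma copy_multiplier_closed:
  assumes m: "m \<in> car (multiplier A)"
  shows "copy_multiplier g A m \<in> car (multiplier (copy g A))"
proof -
  interpret B: cstar_algebra "copy g A" by (rule copy_algebra)
  note [simp] = multiplierD(1,2,5)[OF m]
  obtain K where K: "\<And>x. x \<in> car A \<Longrightarrow> nrm A (m \<triangleright> x) \<le> K * nrm A x"
    using multiplierD(8)[OF m] by blast
  show ?thesis
    by (rule B.multiplierI[where K = K]) (use K in \<open>auto simp: copy_multiplier_def inj\<close>)
qed

end

end

section \<open>Isometric multipliers\<close>

context cstar_algebra
begin

lemma star_lmul: "\<lbrakk>m \<in> car (multiplier A); x \<in> car A\<rbrakk>
    \<Longrightarrow> star A (m \<triangleright> x) = star A x \<triangleleft> star (multiplier A) m"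
  by simp

lemma star_rmul: "\<lbrakk>m \<in> car (multiplier A); x \<in> car A\<rbrakk>
    \<Longrightarrow> star A (x \<triangleleft> m) = star (multiplier A) m \<triangleright> star A x"
  by simp

lemma star_star_multiplier: "m \<in> car (multiplier A) \<Longrightarrow> star (multiplier A) (star (multiplier A) m) = m"
  by (rule multiplier_eqI) (simp_all add: multiplierD(1,2))

lemma mpow_closed: "t \<in> car (multiplier A) \<Longrightarrow> mpow A t k \<in> car (multiplier A)"
  by (induction k) simp_all

lemma mpow_Suc_left: "\<lbrakk>t \<in> car (multiplier A); x \<in> car A\<rbrakk>
    \<Longrightarrow> mpow A t (Suc k) \<triangleright> x = t \<triangleright> (mpow A t k \<triangleright> x)"
  by (induction k arbitrary: x) (simp_all add: multiplierD(1) mpow_closed)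

lemma mpow_Suc_right: "\<lbrakk>t \<in> car (multiplier A); x \<in> car A\<rbrakk>
    \<Longrightarrow> x \<triangleleft> mpow A t (Suc k) = (x \<triangleleft> t) \<triangleleft> mpow A t k"
proof (induction k)
  case (Suc k)
  have "x \<triangleleft> mpow A t (Suc (Suc k)) = (x \<triangleleft> mpow A t (Suc k)) \<triangleleft> t"
    using Suc.prems by (simp add: multiplierD(2) mpow_closed)
  also have "\<dots> = ((x \<triangleleft> t) \<triangleleft> mpow A t k) \<triangleleft> t" using Suc by simp
  also have "\<dots> = (x \<triangleleft> t) \<triangleleft> mpow A t (Suc k)" using Suc.prems by (simp add: multiplierD(2))
  finally show ?case .
qed (simp add: multiplierD(2))

end

locale isometry_multiplier = cstar_algebra A for A :: "'a cstar" +
  fixes t :: "'a mlt"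
  assumes t [simp]: "t \<in> car (multiplier A)"
    and isometry: "x \<in> car A \<Longrightarrow> star (multiplier A) t \<triangleright> (t \<triangleright> x) = x"
begin

text \<open>Simplifier normal form: adjoint multipliers stay symbols, the adjoint of an element
  moves inwards, a multiplier between two factors acts on the right one, and right actions end up
  outside left ones. Then \<open>t' t\<close> cancels by \<open>isometry\<close>.\<close>

declare multiplier_apply(3,4) [simp del]
declare star_lmul [simp] star_rmul [simp] star_star_multiplier [simp] mpow_closed [simp]
declare multiplierD(1-5) [simp]
declare multiplier_apply_left_right [symmetric, simp]
declare isometry [simp]

abbreviation t' where "t' \<equiv> star (multiplier A) t"

lemma isometry_right [simp]: "x \<in> car A \<Longrightarrow> (x \<triangleleft> t') \<triangleleft> t = x"
proof -
  assume x: "x \<in> car A"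
  then have "(x \<triangleleft> t') \<triangleleft> t = star A (t' \<triangleright> (t \<triangleright> star A x))" by (simp del: isometry)
  then show ?thesis using x by simp
qed

lemma isometry_mpow:
  "x \<in> car A \<Longrightarrow> star (multiplier A) (mpow A t k) \<triangleright> (mpow A t k \<triangleright> x) = x"
proof (induction k arbitrary: x)
  case 0 then show ?case by (simp add: multiplier_apply(3))
next
  case (Suc k)
  have "star (multiplier A) (mpow A t (Suc k)) \<triangleright> y = t' \<triangleright> (star (multiplier A) (mpow A t k) \<triangleright> y)"
    if "y \<in> car A" for y
    using that by (simp add: multiplier_apply(3) del: star_lmul star_rmul)
  then show ?case using Suc by (simp del: mpow.simps) simp
qed

lemma power: "isometry_multiplier A (mpow A t k)"
  by unfold_locales (simp_all add: isometry_mpow)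

lemma star_mpow_Suc:
  assumes "x \<in> car A"
  shows "star (multiplier A) (mpow A t (Suc k)) \<triangleright> x = star (multiplier A) (mpow A t k) \<triangleright> (t' \<triangleright> x)"
    and "x \<triangleleft> star (multiplier A) (mpow A t (Suc k)) = (x \<triangleleft> t') \<triangleleft> star (multiplier A) (mpow A t k)"
proof -
  have "star A (star A x \<triangleleft> mpow A t (Suc k)) = star A ((star A x \<triangleleft> t) \<triangleleft> mpow A t k)"
    using assms by (simp only: mpow_Suc_right t star_closed)
  then show "star (multiplier A) (mpow A t (Suc k)) \<triangleright> x = star (multiplier A) (mpow A t k) \<triangleright> (t' \<triangleright> x)"
    using assms by (simp del: mpow.simps)
  have "star A (mpow A t (Suc k) \<triangleright> star A x) = star A (mpow A t k \<triangleright> (t \<triangleright> star A x))"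
    using assms by simp
  then show "x \<triangleleft> star (multiplier A) (mpow A t (Suc k)) = (x \<triangleleft> t') \<triangleleft> star (multiplier A) (mpow A t k)"
    using assms by (simp del: mpow.simps)
qed

end

section \<open>Gauge actions\<close>

locale gauge_isometry = isometry_multiplier D t for D :: "'d cstar" and t :: "'d mlt" +
  fixes \<gamma> :: "complex \<Rightarrow> 'd \<Rightarrow> 'd"
  assumes gauge_hom: "cmod z = 1 \<Longrightarrow> cstar_hom D D (\<gamma> z)"
    and gauge_surj: "cmod z = 1 \<Longrightarrow> \<gamma> z ` car D = car D"
    and gauge_t: "\<lbrakk>cmod z = 1; x \<in> car D\<rbrakk> \<Longrightarrow> \<gamma> z (t \<triangleright> x) = scl D z (t \<triangleright> \<gamma> z x)"
begin

lemmas gauge_simps [simp] = cstar_hom_simps[OF gauge_hom]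

text \<open>The relation for the left action of \<open>t\<close> is transferred by
  \<open>(x t) w = x (t w)\<close>; surjectivity of \<open>\<gamma> z\<close> makes
  \<open>\<gamma> z w\<close> an arbitrary element of \<open>D\<close>.\<close>

lemma gauge_t_right:
  assumes z: "cmod z = 1" and x: "x \<in> car D"
  shows "\<gamma> z (x \<triangleleft> t) = scl D z (\<gamma> z x \<triangleleft> t)"
proof (rule eq_by_right_mult)
  fix y assume "y \<in> car D"
  then obtain w where w: "w \<in> car D" "y = \<gamma> z w" using gauge_surj[OF z] by blast
  have "\<gamma> z (x \<triangleleft> t) \<cdot>\<^bsub>D\<^esub> y = \<gamma> z ((x \<triangleleft> t) \<cdot>\<^bsub>D\<^esub> w)" using z x w by (simp del: multiplierD(5))
  also have "\<dots> = scl D z (\<gamma> z x \<triangleleft> t) \<cdot>\<^bsub>D\<^esub> y"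
    using z x w by (simp add: gauge_t alg_simps)
  finally show "\<gamma> z (x \<triangleleft> t) \<cdot>\<^bsub>D\<^esub> y = scl D z (\<gamma> z x \<triangleleft> t) \<cdot>\<^bsub>D\<^esub> y" .
qed (use z x in simp_all)

lemma gauge_t':
  assumes z: "cmod z = 1" and x: "x \<in> car D"
  shows "\<gamma> z (t' \<triangleright> x) = scl D (cnj z) (t' \<triangleright> \<gamma> z x)" "\<gamma> z (x \<triangleleft> t') = scl D (cnj z) (\<gamma> z x \<triangleleft> t')"
proof -
  have "star D (\<gamma> z (star D x \<triangleleft> t)) = star D (scl D z (\<gamma> z (star D x) \<triangleleft> t))"
    using z x by (simp only: gauge_t_right star_closed)
  then show "\<gamma> z (t' \<triangleright> x) = scl D (cnj z) (t' \<triangleright> \<gamma> z x)"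
    using z x by (simp add: star_scl flip: gauge_simps(5))
  have "star D (\<gamma> z (t \<triangleright> star D x)) = star D (scl D z (t \<triangleright> \<gamma> z (star D x)))"
    using z x by (simp only: gauge_t star_closed)
  then show "\<gamma> z (x \<triangleleft> t') = scl D (cnj z) (\<gamma> z x \<triangleleft> t')"
    using z x by (simp add: star_scl flip: gauge_simps(5))
qed

text \<open>The spectral subspaces of the circle action; degree 0 is the fixed-point
  algebra.\<close>

definition deg :: "int \<Rightarrow> 'd set" where
  "deg n = {x \<in> car D. \<forall>z. cmod z = 1 \<longrightarrow> \<gamma> z x = scl D (z powi n) x}"

lemma degD: "x \<in> deg n \<Longrightarrow> x \<in> car D" "\<lbrakk>x \<in> deg n; cmod z = 1\<rbrakk> \<Longrightarrow> \<gamma> z x = scl D (z powi n) x"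
  by (auto simp: deg_def)

lemma degI: "\<lbrakk>x \<in> car D; \<And>z. cmod z = 1 \<Longrightarrow> \<gamma> z x = scl D (z powi n) x\<rbrakk> \<Longrightarrow> x \<in> deg n"
  by (auto simp: deg_def)

lemma unit_powi: "cmod z = 1 \<Longrightarrow> z powi (n + 1) = z * z powi n"
  "cmod z = 1 \<Longrightarrow> z powi (n - 1) = cnj z * z powi n"
  "cmod z = 1 \<Longrightarrow> cnj z powi n = z powi (- n)"
  "cmod z = 1 \<Longrightarrow> z powi (m + n) = z powi m * z powi n"
proof -
  assume z: "cmod z = 1"
  then have z0: "z \<noteq> 0" and c: "cnj z = inverse z" using complex_div_cnj[of 1 z] by (auto simp: inverse_eq_divide)
  show "z powi (n + 1) = z * z powi n" using z0 by (simp add: power_int_add)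
  show "z powi (n - 1) = cnj z * z powi n" using z0 c by (simp add: power_int_diff field_simps)
  show "z powi (m + n) = z powi m * z powi n" using z0 by (simp add: power_int_add)
  show "cnj z powi n = z powi (- n)"
    using z0 by (simp add: c power_int_minus power_int_inverse)
qed

lemma deg_mul: "\<lbrakk>x \<in> deg m; y \<in> deg n\<rbrakk> \<Longrightarrow> x \<cdot>\<^bsub>D\<^esub> y \<in> deg (m + n)"
  by (rule degI) (simp_all add: degD alg_simps unit_powi scl_scl mult.commute)

lemma deg_star: "x \<in> deg n \<Longrightarrow> star D x \<in> deg (- n)"
  by (rule degI) (simp_all add: degD alg_simps unit_powi)

lemma deg_add: "\<lbrakk>x \<in> deg n; y \<in> deg n\<rbrakk> \<Longrightarrow> add D x y \<in> deg n"
  by (rule degI) (simp_all add: degD scl_add_right)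

lemma deg_scl: "x \<in> deg n \<Longrightarrow> scl D c x \<in> deg n"
  by (rule degI) (simp_all add: degD scl_scl mult.commute)

lemma deg_zer: "zer D \<in> deg n"
  by (rule degI) (simp_all add: linear_map_zer[OF banach banach cstar_hom_linear[OF gauge_hom]])

lemma deg_t: "x \<in> deg n \<Longrightarrow> t \<triangleright> x \<in> deg (n + 1)" "x \<in> deg n \<Longrightarrow> x \<triangleleft> t \<in> deg (n + 1)"
  "x \<in> deg n \<Longrightarrow> t' \<triangleright> x \<in> deg (n - 1)" "x \<in> deg n \<Longrightarrow> x \<triangleleft> t' \<in> deg (n - 1)"
  by (rule degI; simp add: degD gauge_t gauge_t_right gauge_t' multiplier_scl unit_powi scl_scl mult.commute)+

lemma deg_closed: assumes x: "approx D (deg n) x" shows "x \<in> deg n"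
proof (rule degI)
  show "x \<in> car D" using x by (simp add: approx_def)
  fix z :: complex assume z: "cmod z = 1"
  show "\<gamma> z x = scl D (z powi n) x"
    by (rule approx_eq[OF banach x cstar_hom_lip[OF cstar_algebra_axioms cstar_algebra_axioms gauge_hom[OF z]]
        lip_scl]) (use z in \<open>simp add: degD\<close>)
qed

section \<open>The fixed-point algebra and its endomorphism\<close>

abbreviation F where "F \<equiv> fixed_algebra D \<gamma>"

lemma car_F: "car F = deg 0"
  by (auto simp: fixed_algebra_def deg_def)

lemma F_simps [simp]: "zer F = zer D" "add F = add D" "scl F = scl D" "nrm F = nrm D" "mul F = mul D"
  "star F = star D" "sub F = sub D"
  by (auto simp: fixed_algebra_def sub_def fun_eq_iff)

lemma deg_0_cstar_sub: "cstar_sub D (deg 0)"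
  unfolding cstar_sub_def closed_subspace_approx subspace_of_def
  using deg_closed deg_mul[of _ 0 _ 0] deg_star[of _ 0] deg_add deg_scl deg_zer degD by auto

lemma F_algebra: "cstar_algebra F"
proof -
  have "F = D\<lparr>car := deg 0\<rparr>" using car_F by (simp add: fixed_algebra_def)
  then show ?thesis using cstar_sub_algebra[OF deg_0_cstar_sub] by simp
qed

definition \<beta> :: "'d \<Rightarrow> 'd" where "\<beta> x = (t \<triangleright> x) \<triangleleft> t'"

lemma beta_deg: "x \<in> deg n \<Longrightarrow> \<beta> x \<in> deg n"
  using deg_t(1)[of x n] deg_t(4)[of "t \<triangleright> x" "n + 1"] by (simp add: \<beta>_def)

lemma beta_inverse: "x \<in> car D \<Longrightarrow> (t' \<triangleright> \<beta> x) \<triangleleft> t = x"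
  by (simp add: \<beta>_def)

lemma beta_hom: "cstar_hom F F \<beta>"
proof -
  have "\<beta> (x \<cdot>\<^bsub>D\<^esub> y) = \<beta> x \<cdot>\<^bsub>D\<^esub> \<beta> y" if "x \<in> deg 0" "y \<in> deg 0" for x y
    using that by (simp add: \<beta>_def degD)
  then show ?thesis
    unfolding cstar_hom_def linear_map_def car_F
    by (auto simp: beta_deg) (auto simp: \<beta>_def degD multiplier_add multiplier_scl)
qed

definition p where "p = t \<cdot>\<^bsub>multiplier D\<^esub> t'"

lemma p_closed [simp]: "p \<in> car (multiplier D)" by (simp add: p_def)

lemma p_apply: "x \<in> car D \<Longrightarrow> p \<triangleright> x = t \<triangleright> (t' \<triangleright> x)" "x \<in> car D \<Longrightarrow> x \<triangleleft> p = (x \<triangleleft> t) \<triangleleft> t'"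
  by (simp_all add: p_def)

lemma p_deg: "x \<in> deg n \<Longrightarrow> p \<triangleright> x \<in> deg n" "x \<in> deg n \<Longrightarrow> x \<triangleleft> p \<in> deg n"
  using deg_t(3)[of x n] deg_t(1)[of "t' \<triangleright> x" "n - 1"] deg_t(2)[of x n] deg_t(4)[of "x \<triangleleft> t" "n + 1"]
  by (simp_all add: p_apply degD)

lemma beta_range: "\<beta> ` car F = {p \<triangleright> (x \<triangleleft> p) | x. x \<in> car F}"
proof -
  have "\<beta> x = p \<triangleright> (\<beta> x \<triangleleft> p)" if "x \<in> car F" for x
    using that by (simp add: \<beta>_def p_apply car_F degD)
  \<comment> \<open>A preimage of \<open>p x p\<close> is \<open>t\<^sup>* x t\<close>, whose degree
    is again 0.\<close>
  moreover have "p \<triangleright> (x \<triangleleft> p) = \<beta> ((t' \<triangleright> x) \<triangleleft> t)" "(t' \<triangleright> x) \<triangleleft> t \<in> car F" if "x \<in> car F" for x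
    using that deg_t(3)[of x 0] deg_t(2)[of "t' \<triangleright> x" "-1"] by (simp_all add: \<beta>_def p_apply car_F degD)
  ultimately show ?thesis using beta_deg car_F by (auto simp: image_iff) metis+
qed

lemma restrict_multiplier:
  assumes m: "m \<in> car (multiplier D)" and F: "\<And>x. x \<in> deg 0 \<Longrightarrow> m \<triangleright> x \<in> deg 0" "\<And>x. x \<in> deg 0 \<Longrightarrow> x \<triangleleft> m \<in> deg 0"
  shows "mult_restrict F m \<in> car (multiplier F)"
proof -
  interpret F: cstar_algebra F by (rule F_algebra)
  obtain K where "\<And>x. x \<in> car D \<Longrightarrow> nrm D (m \<triangleright> x) \<le> K * nrm D x"
    using multiplierD(8)[OF m] by blast
  then show ?thesis
    by (intro F.multiplierI[where K = K]) (use F m in \<open>simp_all add: mult_restrict_def car_F degD\<close>)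
qed

lemma F_corner: "corner_endomorphism F \<beta> (mult_restrict F p)"
proof -
  interpret F: cstar_algebra F by (rule F_algebra)
  show ?thesis
  proof unfold_locales
    show "cstar_hom F F \<beta>" by (rule beta_hom)
    show "mult_restrict F p \<in> car (multiplier F)"
      by (rule restrict_multiplier) (simp_all add: p_deg)
    fix x assume x: "x \<in> car F"
    then show "star F (mult_restrict F p \<triangleright> x) = star F x \<triangleleft> mult_restrict F p"
      using F.star_closed[OF x] by (simp add: mult_restrict_def p_apply car_F degD)
    show "mult_restrict F p \<triangleright> (mult_restrict F p \<triangleright> x) = mult_restrict F p \<triangleright> x"
      using x p_deg(1)[of x 0] by (simp add: mult_restrict_def car_F) (simp add: p_apply degD)
    show "mult_restrict F p \<triangleright> \<beta> x = \<beta> x"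
      using x beta_deg[of x 0] by (simp add: mult_restrict_def car_F) (simp add: \<beta>_def p_apply degD)
    show "mult_restrict F p \<triangleright> (x \<triangleleft> mult_restrict F p) \<in> \<beta> ` car F"
      using x p_deg(2)[of x 0] unfolding beta_range by (auto simp: mult_restrict_def car_F)
  qed
qed

lemma beta_extension: "\<exists>\<beta>'. strict_extension F \<beta> \<beta>' \<and> \<beta>' (mone F) = mult_restrict F p"
proof -
  interpret F: corner_endomorphism F \<beta> "mult_restrict F p" by (rule F_corner)
  show ?thesis using F.strict_extension F.extension_mone by blast
qed

lemma beta_inj: "inj_on \<beta> (car F)"
  by (rule inj_on_inverseI[where g = "\<lambda>x. (t' \<triangleright> x) \<triangleleft> t"]) (simp add: beta_inverse car_F degD)

text \<open>Average with the gauge automorphism that changes the sign of the unwanted component, one degree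
  at a time.\<close>

lemma extract_component:
  assumes "finite K" "n \<notin> K"
  obtains P where "linear_map D D P" "\<And>x. x \<in> car D \<Longrightarrow> nrm D (P x) \<le> nrm D x"
    "\<And>x. x \<in> deg n \<Longrightarrow> P x = x" "\<And>k x. k \<in> K \<Longrightarrow> x \<in> deg k \<Longrightarrow> P x = zer D"
proof -
  have "\<exists>P. linear_map D D P \<and> (\<forall>x\<in>car D. nrm D (P x) \<le> nrm D x)
    \<and> (\<forall>x\<in>deg n. P x = x) \<and> (\<forall>k\<in>K. \<forall>x\<in>deg k. P x = zer D)"
    using assms
  proof (induction K)
    case empty
    then show ?case by (intro exI[of _ "\<lambda>x. x"]) (simp add: linear_map_def)
  next
    case (insert k K)
    then obtain P where P: "linear_map D D P" "\<And>x. x \<in> car D \<Longrightarrow> nrm D (P x) \<le> nrm D x"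
      "\<And>x. x \<in> deg n \<Longrightarrow> P x = x" "\<And>k x. k \<in> K \<Longrightarrow> x \<in> deg k \<Longrightarrow> P x = zer D" by blast
    note [simp] = linear_map_simps[OF P(1)]
    \<comment> \<open>Since \<open>k\<close> differs from \<open>n\<close>, this \<open>z\<close>
      satisfies \<open>z powi (k - n) = -1\<close>.\<close>
    define z where "z = cis (pi / of_int (k - n))"
    have z: "cmod z = 1" "z \<noteq> 0" by (simp_all add: z_def)
    have zk: "z powi (k - n) = -1"
      using insert unfolding z_def cis_power_int by simp
    define R where "R x = scl D (1/2) (add D x (scl D (z powi (-n)) (\<gamma> z x)))" for x
    have Rc [simp]: "R x \<in> car D" if "x \<in> car D" for x using that z by (simp add: R_def)
    have Rl: "linear_map D D R"
      unfolding linear_map_def R_def using z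
      by (auto intro!: vec_eqI simp: functional_simps algebra_simps)
    have Rn: "nrm D (R x) \<le> nrm D x" if x: "x \<in> car D" for x
    proof -
      have "nrm D (R x) \<le> 1/2 * (nrm D x + nrm D (\<gamma> z x))"
        using x z nrm_triangle[of x "scl D (z powi (-n)) (\<gamma> z x)"]
        by (simp add: R_def nrm_scl norm_power_int)
      then show ?thesis
        using cstar_hom_contractive[OF cstar_algebra_axioms cstar_algebra_axioms gauge_hom x, of z] z by simp
    qed
    \<comment> \<open>The scalar is 1 for \<open>m = n\<close> and 0 for \<open>m = k\<close>. Other
      degrees are merely rescaled, so \<open>P\<close> still annihilates those in
      \<open>K\<close>.\<close>
    have Rd: "R x = scl D ((1 + z powi (m - n)) / 2) x" if x: "x \<in> deg m" for x m
      unfolding R_def using x z degD[OF x]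
      by (intro vec_eqI) (auto simp: functional_simps power_int_diff power_int_minus field_simps)
    show ?case
    proof (intro exI[of _ "\<lambda>x. P (R x)"] conjI ballI)
      show "linear_map D D (\<lambda>x. P (R x))"
        using Rl P(1) by (auto simp: linear_map_def)
      show "nrm D (P (R x)) \<le> nrm D x" if "x \<in> car D" for x
        using P(2)[of "R x"] Rn[OF that] that by simp
      show "P (R x) = x" if "x \<in> deg n" for x
        using Rd[OF that] that P(3) by (simp add: degD)
      fix l x assume l: "l \<in> insert k K" "x \<in> deg l"
      show "P (R x) = zer D"
      proof (cases "l = k")
        case True
        then have "R x = zer D" using Rd[OF l(2)] zk l degD by simp
        then show ?thesis using linear_map_zer[OF banach banach P(1)] by simp
      next
        case False
        then show ?thesis using Rd[OF l(2)] P(4)[of l x] l degD by simp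
      qed
    qed
  qed
  then show thesis using that by blast
qed

end

section \<open>Finite sums of homogeneous elements\<close>

text \<open>Addition is a record field here and not a type-class operation, hence a sum by
  recursion.\<close>

primrec csum :: "('a, 'r) cspace_scheme \<Rightarrow> (nat \<Rightarrow> 'a) \<Rightarrow> nat \<Rightarrow> 'a" where
  "csum V f 0 = zer V"
| "csum V f (Suc n) = add V (csum V f n) (f n)"

context complex_banach
begin

lemma csum_closed: "(\<And>k. k < n \<Longrightarrow> f k \<in> car V) \<Longrightarrow> csum V f n \<in> car V"
  by (induction n) simp_all

lemma csum_cong: "(\<And>k. k < n \<Longrightarrow> f k = g k) \<Longrightarrow> csum V f n = csum V g n"
  by (induction n) simp_all

lemma csum_add:
  "\<lbrakk>\<And>k. k < n \<Longrightarrow> f k \<in> car V; \<And>k. k < n \<Longrightarrow> g k \<in> car V\<rbrakk>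
    \<Longrightarrow> csum V (\<lambda>k. add V (f k) (g k)) n = add V (csum V f n) (csum V g n)"
  by (induction n) (simp_all add: csum_closed add_assoc add_left_commute)

lemma csum_single:
  "\<lbrakk>m < n; x \<in> car V\<rbrakk> \<Longrightarrow> csum V (\<lambda>k. if k = m then x else zer V) n = x"
proof (induction n)
  case (Suc n)
  have "csum V (\<lambda>k. if k = m then x else zer V) j = zer V" if "j \<le> m" for j
    using that by (induction j) simp_all
  then show ?case using Suc by (cases "m = n") auto
qed simp

lemma nrm_csum: "(\<And>k. k < n \<Longrightarrow> f k \<in> car V) \<Longrightarrow> nrm V (csum V f n) \<le> (\<Sum>k<n. nrm V (f k))"
proof (induction n)
  case (Suc n)
  then show ?case using nrm_triangle[of "csum V f n" "f n"] csum_closed[of n f] by force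
qed simp

end

lemma csum_linear:
  assumes "complex_banach V" "complex_banach W" "linear_map V W g"
  shows "(\<And>k. k < n \<Longrightarrow> f k \<in> car V) \<Longrightarrow> g (csum V f n) = csum W (\<lambda>k. g (f k)) n"
  by (induction n)
    (simp_all add: linear_map_zer[OF assms] linear_map_simps[OF assms(3)]
      complex_banach.csum_closed[OF assms(1)])

text \<open>If \<open>a > b > 0\<close>, the powers of \<open>a / b\<close> outgrow every linear
  bound. Bernoulli's inequality is itself only linear in the exponent \<open>2 ^ k\<close>, so it is
  squared and compared with the hypothesis at \<open>Suc k\<close>.\<close>

lemma le_of_power_le_linear:
  fixes a b C :: real
  assumes b: "0 \<le> b" and C: "0 \<le> C" and le: "\<And>k. a ^ (2 ^ k) \<le> (C * 2 ^ k + 1) * b ^ (2 ^ k)"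
  shows "a \<le> b"
proof (rule ccontr)
  assume "\<not> a \<le> b"
  then have ab: "b < a" by simp
  have "a \<le> (C + 1) * b" using le[of 0] by simp
  then have b0: "b > 0" using ab b by (cases "b = 0") auto
  define d where "d = a / b - 1"
  have d: "d > 0" using ab b0 by (simp add: d_def)
  have up: "(1 + d) ^ (2 ^ k) \<le> C * 2 ^ k + 1" for k
    using le[of k] b0 by (simp add: d_def power_divide field_simps)
  have "2 ^ k * d\<^sup>2 \<le> 2 * C" for k :: nat
  proof -
    have "1 + 2 ^ k * d \<le> (1 + d) ^ (2 ^ k)"
      using Bernoulli_inequality[of d "2 ^ k"] d by simp
    then have "(1 + 2 ^ k * d)\<^sup>2 \<le> ((1 + d) ^ (2 ^ k))\<^sup>2" using d by (intro power_mono) auto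
    also have "\<dots> = (1 + d) ^ (2 ^ Suc k)" by (simp add: power_mult[symmetric] mult.commute)
    also have "\<dots> \<le> C * 2 ^ Suc k + 1" by (rule up)
    finally have "(2 ^ k * d)\<^sup>2 + 2 * (2 ^ k * d) \<le> C * (2 * 2 ^ k)" by (simp add: power2_sum)
    moreover have "0 \<le> 2 * (2 ^ k * d)" using d by simp
    ultimately have "(2 ^ k * d)\<^sup>2 \<le> C * (2 * 2 ^ k)" by linarith
    then have "2 ^ k * (2 ^ k * d\<^sup>2) \<le> 2 ^ k * (2 * C)" by (simp add: power2_eq_square ac_simps)
    then show ?thesis by simp
  qed
  moreover obtain k where "2 * C / d\<^sup>2 < 2 ^ k" using real_arch_pow[of 2 "2 * C / d\<^sup>2"] by auto
  then have "2 * C < 2 ^ k * d\<^sup>2" using d by (simp add: field_simps)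
  ultimately show False by (meson not_le)
qed

context cstar_algebra
begin

lemma approx_trans:
  assumes "approx A X x" "\<And>y. y \<in> X \<Longrightarrow> y \<in> car A \<Longrightarrow> approx A Y y"
  shows "approx A Y x"
  unfolding approx_def
proof (intro conjI allI impI)
  show x: "x \<in> car A" using assms(1) by (simp add: approx_def)
  fix e :: real assume "e > 0"
  then have e: "e / 2 > 0" by simp
  then obtain y where y: "y \<in> X" "y \<in> car A" "nrm A (sub A x y) < e / 2"
    using assms(1) unfolding approx_def by blast
  then obtain z where z: "z \<in> Y" "z \<in> car A" "nrm A (sub A y z) < e / 2"
    using assms(2)[OF y(1,2)] e unfolding approx_def by blast
  show "\<exists>y\<in>Y. y \<in> car A \<and> nrm A (sub A x y) < e"
    using y z nrm_sub_triangle[OF x y(2) z(2)] by (intro bexI[of _ z]) auto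
qed

lemma approx_image:
  assumes "approx A X x" "lip A A g" "\<And>y. y \<in> X \<Longrightarrow> y \<in> car A \<Longrightarrow> approx A Y (g y)"
  shows "approx A Y (g x)"
  by (rule approx_trans[OF approx_lip[OF banach assms(1,2)]]) (use assms(3) in auto)

lemma add_lip: "a \<in> car A \<Longrightarrow> lip A A (add A a)" "a \<in> car A \<Longrightarrow> lip A A (\<lambda>x. add A x a)"
proof -
  assume a: "a \<in> car A"
  have "sub A (add A a x) (add A a y) = sub A x y" "sub A (add A x a) (add A y a) = sub A x y"
    if "x \<in> car A" "y \<in> car A" for x y
    using that a by (auto intro!: vec_eqI simp: functional_simps)
  then show "lip A A (add A a)" "lip A A (\<lambda>x. add A x a)"
    using a by (auto simp: lip_def intro!: exI[of _ 1])
qed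

text \<open>Sums and products pass to the closure one variable at a time: first with one argument in
  \<open>S\<close>, then with that argument approximated.\<close>

lemma closure_cstar_sub:
  assumes S: "subspace_of A S" "\<And>x y. x \<in> S \<Longrightarrow> y \<in> S \<Longrightarrow> x \<cdot>\<^bsub>A\<^esub> y \<in> S" "\<And>x. x \<in> S \<Longrightarrow> star A x \<in> S"
  shows "cstar_sub A {x. approx A S x}"
proof -
  have Sc: "x \<in> car A" if "x \<in> S" for x using S(1) that by (auto simp: subspace_of_def)
  have S0: "zer A \<in> S" and Sa: "\<And>x y. x \<in> S \<Longrightarrow> y \<in> S \<Longrightarrow> add A x y \<in> S"
    and Ss: "\<And>c x. x \<in> S \<Longrightarrow> scl A c x \<in> S" using S(1) by (auto simp: subspace_of_def)
  have in_car: "x \<in> car A" if "approx A S x" for x using that by (simp add: approx_def)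
  have add: "approx A S (add A x y)" if xy: "approx A S x" "approx A S y" for x y
  proof -
    have "approx A S (add A s y)" if "s \<in> S" for s
      by (rule approx_image[OF xy(2) add_lip(1)]) (use that Sc Sa in \<open>auto intro!: approx_mem\<close>)
    then show ?thesis
      by (intro approx_image[OF xy(1) add_lip(2)]) (use xy in_car in auto)
  qed
  have mul: "approx A S (x \<cdot>\<^bsub>A\<^esub> y)" if xy: "approx A S x" "approx A S y" for x y
  proof -
    have "approx A S (s \<cdot>\<^bsub>A\<^esub> y)" if "s \<in> S" for s
      by (rule approx_image[OF xy(2) lip_mul_left]) (use that Sc S(2) in \<open>auto intro!: approx_mem\<close>)
    then show ?thesis
      by (intro approx_image[OF xy(1) lip_mul_right]) (use xy in_car in auto)
  qed
  have star: "approx A S (star A x)" if "approx A S x" for x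
    by (rule approx_image[OF that lip_star]) (use Sc S(3) in \<open>auto intro!: approx_mem\<close>)
  have scl: "approx A S (scl A c x)" if "approx A S x" for c x
    by (rule approx_image[OF that lip_scl]) (use Sc Ss in \<open>auto intro!: approx_mem\<close>)
  have "closed_subspace A {x. approx A S x}"
    unfolding closed_subspace_approx subspace_of_def
    using add scl in_car S0 by (auto intro: approx_trans approx_mem)
  then show ?thesis using mul star by (auto simp: cstar_sub_def)
qed

lemma cstar_generated_least: "cstar_sub A U \<Longrightarrow> X \<subseteq> U \<Longrightarrow> cstar_generated A X \<subseteq> U"
  by (auto simp: cstar_generated_def cstar_sub_def)

end

section \<open>Isometry from a grading\<close>

text \<open>The sets \<open>comp n\<close> are not assumed closed or independent of each other.
  Degrees are told apart in \<open>D\<close>, where the gauge action lives.\<close>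

locale graded_hom = D: gauge_isometry D t \<gamma> + E: cstar_algebra E
  for D :: "'d cstar" and t :: "'d mlt" and \<gamma> and E :: "'e cstar" +
  fixes \<Phi> :: "'e \<Rightarrow> 'd" and comp :: "int \<Rightarrow> 'e set"
  assumes Phi: "cstar_hom E D \<Phi>"
    and comp_car: "x \<in> comp n \<Longrightarrow> x \<in> car E"
    and comp_zer: "zer E \<in> comp n"
    and comp_add: "\<lbrakk>x \<in> comp n; y \<in> comp n\<rbrakk> \<Longrightarrow> add E x y \<in> comp n"
    and comp_scl: "x \<in> comp n \<Longrightarrow> scl E c x \<in> comp n"
    and comp_mul: "\<lbrakk>x \<in> comp m; y \<in> comp n\<rbrakk> \<Longrightarrow> x \<cdot>\<^bsub>E\<^esub> y \<in> comp (m + n)"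
    and comp_star: "x \<in> comp n \<Longrightarrow> star E x \<in> comp (- n)"
    and comp_deg: "x \<in> comp n \<Longrightarrow> \<Phi> x \<in> D.deg n"
    and comp_isometric: "x \<in> comp n \<Longrightarrow> nrm D (\<Phi> x) = nrm E x"
begin

lemmas Phi_simps [simp] = cstar_hom_simps[OF Phi]

text \<open>Sums of homogeneous elements of degrees from \<open>-N\<close> to \<open>N\<close>: slot
  \<open>k\<close> holds degree \<open>k - N\<close>, whence \<open>2 * N + 1\<close> slots.\<close>

definition spread :: "nat \<Rightarrow> 'e set" where
  "spread N = {csum E f (2 * N + 1) | f. \<forall>k < 2 * N + 1. f k \<in> comp (int k - int N)}"

lemma spread_car:
  assumes "x \<in> spread N" shows "x \<in> car E"
proof -
  obtain f where f: "x = csum E f (2 * N + 1)" "\<And>k. k < 2 * N + 1 \<Longrightarrow> f k \<in> comp (int k - int N)"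
    using assms unfolding spread_def by blast
  then show ?thesis using comp_car E.csum_closed[of "2 * N + 1" f] by blast
qed

lemma comp_spread:
  assumes "x \<in> comp n" "\<bar>n\<bar> \<le> int N"
  shows "x \<in> spread N"
proof -
  let ?f = "\<lambda>k. if k = nat (n + int N) then x else zer E"
  have "csum E ?f (2 * N + 1) = x"
    using assms comp_car by (intro E.csum_single) auto
  moreover have "\<forall>k < 2 * N + 1. ?f k \<in> comp (int k - int N)"
    using assms comp_zer by auto
  ultimately show ?thesis unfolding spread_def by (intro CollectI exI[of _ ?f]) simp
qed

lemma spread_add:
  assumes "x \<in> spread N" "y \<in> spread N" shows "add E x y \<in> spread N"
proof -
  obtain f g where f: "x = csum E f (2 * N + 1)" "\<And>k. k < 2 * N + 1 \<Longrightarrow> f k \<in> comp (int k - int N)"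
    and g: "y = csum E g (2 * N + 1)" "\<And>k. k < 2 * N + 1 \<Longrightarrow> g k \<in> comp (int k - int N)"
    using assms unfolding spread_def by blast
  have "add E x y = csum E (\<lambda>k. add E (f k) (g k)) (2 * N + 1)"
    unfolding f(1) g(1) by (rule E.csum_add[symmetric]) (use f g comp_car in auto)
  then show ?thesis unfolding spread_def using f g comp_add by blast
qed

lemma spread_zer: "zer E \<in> spread N"
  using comp_spread[of "zer E" 0] comp_zer by simp

lemma spread_csum: "(\<And>k. k < n \<Longrightarrow> f k \<in> spread N) \<Longrightarrow> csum E f n \<in> spread N"
  by (induction n) (simp_all add: spread_zer spread_add)

text \<open>Reduces membership to homogeneous elements; applied in each variable separately it
  handles products.\<close>

lemma spread_linear:
  assumes "linear_map E E g" "\<And>n x. \<bar>n\<bar> \<le> int N \<Longrightarrow> x \<in> comp n \<Longrightarrow> g x \<in> spread M" "x \<in> spread N"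
  shows "g x \<in> spread M"
proof -
  obtain f where f: "x = csum E f (2 * N + 1)" "\<And>k. k < 2 * N + 1 \<Longrightarrow> f k \<in> comp (int k - int N)"
    using assms(3) unfolding spread_def by blast
  have "g x = csum E (\<lambda>k. g (f k)) (2 * N + 1)"
    unfolding f(1) by (rule csum_linear[OF E.banach E.banach assms(1)]) (use f comp_car in auto)
  moreover have "g (f k) \<in> spread M" if "k < 2 * N + 1" for k
    using assms(2)[OF _ f(2)[OF that]] that by linarith
  ultimately show ?thesis using spread_csum[of "2 * N + 1" "\<lambda>k. g (f k)"] by metis
qed

lemma spread_scl: "x \<in> spread N \<Longrightarrow> scl E c x \<in> spread N"
  by (rule spread_linear[where N = N])
    (auto simp: linear_map_def E.scl_add_right E.scl_scl mult.commute intro: comp_spread comp_scl)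

lemma spread_mono: "x \<in> spread N \<Longrightarrow> N \<le> M \<Longrightarrow> x \<in> spread M"
  by (rule spread_linear[where N = N and g = "\<lambda>x. x"])
    (auto simp: linear_map_def intro: comp_spread)

lemma spread_mul:
  assumes x: "x \<in> spread M" and y: "y \<in> spread N"
  shows "x \<cdot>\<^bsub>E\<^esub> y \<in> spread (M + N)"
proof (rule spread_linear[where N = N and g = "\<lambda>y. x \<cdot>\<^bsub>E\<^esub> y", OF _ _ y])
  show "linear_map E E (\<lambda>y. x \<cdot>\<^bsub>E\<^esub> y)" using spread_car[OF x] by (auto simp: linear_map_def E.alg_simps)
  fix n z assume n: "\<bar>n\<bar> \<le> int N" "z \<in> comp n"
  show "x \<cdot>\<^bsub>E\<^esub> z \<in> spread (M + N)"
  proof (rule spread_linear[where N = M and g = "\<lambda>x. x \<cdot>\<^bsub>E\<^esub> z", OF _ _ x])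
    show "linear_map E E (\<lambda>x. x \<cdot>\<^bsub>E\<^esub> z)"
      using comp_car[OF n(2)] by (auto simp: linear_map_def E.alg_simps)
    fix m w assume "\<bar>m\<bar> \<le> int M" "w \<in> comp m"
    then show "w \<cdot>\<^bsub>E\<^esub> z \<in> spread (M + N)" using n by (intro comp_spread[OF comp_mul]) auto
  qed
qed

text \<open>The adjoint is only conjugate linear, so \<open>spread_linear\<close> does not apply.\<close>

lemma spread_star:
  assumes "x \<in> spread N" shows "star E x \<in> spread N"
proof -
  obtain f where f: "x = csum E f (2 * N + 1)" "\<And>k. k < 2 * N + 1 \<Longrightarrow> f k \<in> comp (int k - int N)"
    using assms unfolding spread_def by blast
  have "star E (csum E f n) = csum E (\<lambda>k. star E (f k)) n" if "n \<le> 2 * N + 1" for n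
    using that
  proof (induction n)
    case (Suc n)
    have fk: "f k \<in> car E" if "k < 2 * N + 1" for k using comp_car[OF f(2)[OF that]] .
    have "csum E f n \<in> car E" using Suc(2) by (intro E.csum_closed fk) simp
    then show ?case using Suc fk[of n] by (simp add: E.star_add)
  qed simp
  moreover have "star E (f k) \<in> spread N" if "k < 2 * N + 1" for k
    by (rule comp_spread[OF comp_star[OF f(2)[OF that]]]) (use that in linarith)
  ultimately show ?thesis
    unfolding f(1) using spread_csum[of "2 * N + 1" "\<lambda>k. star E (f k)"] by (metis order_refl)
qed

lemma spread_bound:
  assumes x: "x \<in> spread N"
  shows "nrm E x \<le> real (2 * N + 1) * nrm D (\<Phi> x)"
proof -
  obtain f where f: "x = csum E f (2 * N + 1)" "\<And>k. k < 2 * N + 1 \<Longrightarrow> f k \<in> comp (int k - int N)"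
    using x unfolding spread_def by blast
  have Px: "\<Phi> x = csum D (\<lambda>k. \<Phi> (f k)) (2 * N + 1)"
    unfolding f(1)
    by (rule csum_linear[OF E.banach D.banach cstar_hom_linear[OF Phi]]) (use f comp_car in auto)
  have "nrm E (f m) \<le> nrm D (\<Phi> x)" if m: "m < 2 * N + 1" for m
  proof -
    obtain P where P: "linear_map D D P" "\<And>x. x \<in> car D \<Longrightarrow> nrm D (P x) \<le> nrm D x"
      "\<And>x. x \<in> D.deg (int m - int N) \<Longrightarrow> P x = x"
      "\<And>k x. k \<in> (\<lambda>k. int k - int N) ` ({..<2 * N + 1} - {m}) \<Longrightarrow> x \<in> D.deg k \<Longrightarrow> P x = zer D"
      by (rule D.extract_component[of "(\<lambda>k. int k - int N) ` ({..<2 * N + 1} - {m})" "int m - int N"])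
        auto
    have "P (\<Phi> x) = csum D (\<lambda>k. P (\<Phi> (f k))) (2 * N + 1)"
      unfolding Px by (rule csum_linear[OF D.banach D.banach P(1)]) (use comp_car[OF f(2)] in simp)
    also have "\<dots> = csum D (\<lambda>k. if k = m then \<Phi> (f m) else zer D) (2 * N + 1)"
      by (rule D.csum_cong) (use P(3,4) comp_deg[OF f(2)] m in auto)
    also have "\<dots> = \<Phi> (f m)" using m comp_car[OF f(2)[OF m]] by (intro D.csum_single) simp_all
    finally have "P (\<Phi> x) = \<Phi> (f m)" .
    then show ?thesis using comp_isometric[OF f(2)[OF m]] P(2)[of "\<Phi> x"] spread_car[OF x] by simp
  qed
  then have "(\<Sum>k<2 * N + 1. nrm E (f k)) \<le> (\<Sum>k<2 * N + 1. nrm D (\<Phi> x))"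
    by (intro sum_mono) auto
  moreover have "nrm E x \<le> (\<Sum>k<2 * N + 1. nrm E (f k))"
    unfolding f(1) by (rule E.nrm_csum) (use f comp_car in auto)
  ultimately show ?thesis by simp
qed

text \<open>The number of components of \<open>(x\<^sup>* x)\<close> to the power \<open>2\<^sup>k\<close> grows linearly in the exponent, so the bound
  of \<open>spread_bound\<close> becomes an isometry in the limit.\<close>

lemma spread_isometric:
  assumes x: "x \<in> spread N"
  shows "nrm E x \<le> nrm D (\<Phi> x)"
proof -
  define h where "h = rec_nat (star E x \<cdot>\<^bsub>E\<^esub> x) (\<lambda>_ y. y \<cdot>\<^bsub>E\<^esub> y)"
  have h0: "h 0 = star E x \<cdot>\<^bsub>E\<^esub> x" and hS: "h (Suc k) = h k \<cdot>\<^bsub>E\<^esub> h k" for k by (simp_all add: h_def)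
  have xc: "x \<in> car E" using spread_car[OF x] .
  have hc [simp]: "h k \<in> car E" for k by (induction k) (simp_all add: h0 hS xc)
  have hs: "star E (h k) = h k" for k by (induction k) (simp_all add: h0 hS xc E.star_mul)
  have hN: "h k \<in> spread (2 * N * 2 ^ k)" for k
  proof (induction k)
    case 0 then show ?case using spread_mul[OF spread_star[OF x] x] by (simp add: h0 mult_2)
  next
    case (Suc k) then show ?case using spread_mul[OF Suc Suc] by (simp add: hS mult_2 algebra_simps)
  qed
  have nE: "nrm E (h k) = ((nrm E x)\<^sup>2) ^ 2 ^ k" for k
  proof (induction k)
    case 0 then show ?case using E.cstar_identity[OF xc] by (simp add: h0)
  next
    case (Suc k)
    have "nrm E (h (Suc k)) = (nrm E (h k))\<^sup>2" using E.cstar_identity[of "h k"] hs by (simp add: hS)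
    then show ?case using Suc by (simp flip: power_mult add: mult.commute)
  qed
  have nD: "nrm D (\<Phi> (h k)) = ((nrm D (\<Phi> x))\<^sup>2) ^ 2 ^ k" for k
  proof (induction k)
    case 0 then show ?case using D.cstar_identity[of "\<Phi> x"] xc by (simp add: h0)
  next
    case (Suc k)
    have "star D (\<Phi> (h k)) = \<Phi> (h k)" using hs by (simp flip: Phi_simps(5))
    then have "nrm D (\<Phi> (h (Suc k))) = (nrm D (\<Phi> (h k)))\<^sup>2"
      using D.cstar_identity[of "\<Phi> (h k)"] by (simp add: hS)
    then show ?case using Suc by (simp flip: power_mult add: mult.commute)
  qed
  have "(nrm E x)\<^sup>2 \<le> (nrm D (\<Phi> x))\<^sup>2"
  \<comment> \<open>\<open>h k\<close> has \<open>2 * (2 * N * 2 ^ k) + 1\<close> slots, whence the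
    constant \<open>4 * N\<close>.\<close>
  proof (rule le_of_power_le_linear[where C = "4 * real N"])
    fix k :: nat
    show "((nrm E x)\<^sup>2) ^ 2 ^ k \<le> (4 * real N * 2 ^ k + 1) * ((nrm D (\<Phi> x))\<^sup>2) ^ 2 ^ k"
      using spread_bound[OF hN[of k]] by (simp add: nE nD algebra_simps)
  qed simp_all
  then show ?thesis using D.nrm_nonneg[of "\<Phi> x"] xc by (auto intro: power2_le_imp_le)
qed

lemma union_spread: 
  shows "subspace_of E (\<Union>N. spread N)"
    and "\<lbrakk>x \<in> (\<Union>N. spread N); y \<in> (\<Union>N. spread N)\<rbrakk> \<Longrightarrow> x \<cdot>\<^bsub>E\<^esub> y \<in> (\<Union>N. spread N)"
    and "x \<in> (\<Union>N. spread N) \<Longrightarrow> star E x \<in> (\<Union>N. spread N)"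
proof -
  have add: "add E x y \<in> spread (M + N)" if "x \<in> spread M" "y \<in> spread N" for x y M N
    by (rule spread_add; rule spread_mono, rule that, simp)
  show "subspace_of E (\<Union>N. spread N)"
    unfolding subspace_of_def
  proof (intro conjI ballI allI)
    show "(\<Union>N. spread N) \<subseteq> car E" by (auto dest: spread_car)
    show "zer E \<in> (\<Union>N. spread N)" using spread_zer[of 0] by (rule UN_I[OF UNIV_I])
    fix x assume "x \<in> (\<Union>N. spread N)"
    then obtain M where x: "x \<in> spread M" by (elim UN_E)
    show "scl E c x \<in> (\<Union>N. spread N)" for c
      using spread_scl[OF x, of c] by (rule UN_I[OF UNIV_I])
    fix y assume "y \<in> (\<Union>N. spread N)"
    then obtain N where y: "y \<in> spread N" by (elim UN_E)
    show "add E x y \<in> (\<Union>N. spread N)" using add[OF x y] by (rule UN_I[OF UNIV_I])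
  qed
next
  assume "x \<in> (\<Union>N. spread N)" "y \<in> (\<Union>N. spread N)"
  then obtain M N where "x \<in> spread M" "y \<in> spread N" by (elim UN_E)
  then show "x \<cdot>\<^bsub>E\<^esub> y \<in> (\<Union>N. spread N)" using UN_I[OF UNIV_I, of "x \<cdot>\<^bsub>E\<^esub> y" spread "M + N"] spread_mul by blast
next
  assume "x \<in> (\<Union>N. spread N)"
  then obtain M where "x \<in> spread M" by (elim UN_E)
  then show "star E x \<in> (\<Union>N. spread N)" using UN_I[OF UNIV_I, of "star E x" spread M] spread_star by blast
qed

text \<open>The finite sums form a subalgebra closed under adjoints, so by \<open>gen\<close> they
  are dense in \<open>E\<close>; contractivity of \<open>\<Phi>\<close> carries the lower estimate
  to their limits.\<close>

lemma isometric:
  assumes gen: "car E \<subseteq> cstar_generated E (\<Union>n. comp n)" and x: "x \<in> car E"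
  shows "nrm D (\<Phi> x) = nrm E x"
proof -
  have con: "nrm D (\<Phi> y) \<le> nrm E y" if "y \<in> car E" for y
    by (rule cstar_hom_contractive[OF _ _ Phi that]) unfold_locales
  have "comp n \<subseteq> {x. approx E (\<Union>N. spread N) x}" for n
    using comp_spread[of _ n "nat \<bar>n\<bar>"] comp_car by (auto intro!: E.approx_mem)
  then have "(\<Union>n. comp n) \<subseteq> {x. approx E (\<Union>N. spread N) x}" by (rule UN_least)
  then have "cstar_generated E (\<Union>n. comp n) \<subseteq> {x. approx E (\<Union>N. spread N) x}"
    using E.cstar_generated_least[OF E.closure_cstar_sub[OF union_spread]] by simp
  then have ap: "approx E (\<Union>N. spread N) x" using gen x by blast
  have "nrm E x \<le> nrm D (\<Phi> x)"
  proof (rule field_le_epsilon)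
    fix e :: real assume "e > 0"
    then have "e / 2 > 0" by simp
    then obtain y N where y: "y \<in> spread N" "y \<in> car E" "nrm E (sub E x y) < e / 2"
      using ap unfolding approx_def by blast
    have "nrm E x \<le> nrm E y + nrm E (sub E x y)" using E.nrm_le_sub x y by simp
    also have "nrm E y \<le> nrm D (\<Phi> y)" by (rule spread_isometric[OF y(1)])
    also have "\<dots> \<le> nrm D (\<Phi> x) + nrm D (sub D (\<Phi> y) (\<Phi> x))"
      using x y by (intro D.nrm_le_sub) simp_all
    also have "nrm D (sub D (\<Phi> y) (\<Phi> x)) \<le> nrm E (sub E y x)"
      using con[of "sub E y x"] x y E.linear_map_sub[OF cstar_hom_linear[OF Phi]] by simp
    also have "\<dots> = nrm E (sub E x y)" using x y by (intro E.nrm_sub_commute)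
    finally show "nrm E x \<le> nrm D (\<Phi> x) + e" using y(3) by simp
  qed
  with con[OF x] show ?thesis by simp
qed

end

text \<open>Approximants within \<open>(1/2) ^ n\<close> of a limit point have preimages with
  summable differences, because \<open>g\<close> is isometric. The limit of these preimages is
  mapped to the given point.\<close>

lemma isometric_range_cstar_sub:
  assumes E: "cstar_algebra E" and D: "cstar_algebra D" and g: "cstar_hom E D g"
    and iso: "\<And>x. x \<in> car E \<Longrightarrow> nrm D (g x) = nrm E x"
  shows "cstar_sub D (g ` car E)"
proof -
  interpret E: cstar_algebra E by fact
  interpret D: cstar_algebra D by fact
  note gs [simp] = cstar_hom_simps[OF g]
  have "subspace_of D (g ` car E)"
    unfolding subspace_of_def
    using linear_map_zer[OF E.banach D.banach cstar_hom_linear[OF g]]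
    by (auto simp flip: gs(2,3) intro!: image_eqI[of _ g "zer E"])
  moreover have "d \<in> g ` car E" if d: "approx D (g ` car E) d" for d
  proof -
    have dc: "d \<in> car D" using d by (simp add: approx_def)
    have "\<exists>e. e \<in> car E \<and> nrm D (sub D d (g e)) < r" if "r > 0" for r
      using d that unfolding approx_def by blast
    then have "\<exists>e. e \<in> car E \<and> nrm D (sub D d (g e)) < (1/2) ^ n" for n :: nat by simp
    then obtain e where e: "\<And>n. e n \<in> car E" "\<And>n. nrm D (sub D d (g (e n))) < (1/2) ^ n" by metis
    have sub: "nrm E (sub E x y) = nrm D (sub D (g x) (g y))" if "x \<in> car E" "y \<in> car E" for x y
      using iso[of "sub E x y"] that E.linear_map_sub[OF cstar_hom_linear[OF g]] by simp
    have "nrm E (sub E (e (Suc n)) (e n)) \<le> 2 * (1/2) ^ n" for n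
    proof -
      have "nrm E (sub E (e (Suc n)) (e n)) = nrm D (sub D (g (e (Suc n))) (g (e n)))"
        using e sub by simp
      also have "\<dots> \<le> nrm D (sub D (g (e (Suc n))) d) + nrm D (sub D d (g (e n)))"
        using e dc by (intro D.nrm_sub_triangle) simp_all
      also have "nrm D (sub D (g (e (Suc n))) d) = nrm D (sub D d (g (e (Suc n))))"
        using e dc by (intro D.nrm_sub_commute) simp_all
      also have "\<dots> \<le> (1/2) ^ Suc n" using e(2)[of "Suc n"] by simp
      also have "nrm D (sub D d (g (e n))) \<le> (1/2) ^ n" using e(2)[of n] by simp
      also have "(1/2) ^ Suc n + (1/2) ^ n \<le> 2 * (1/2 :: real) ^ n" by simp
      finally show ?thesis by simp
    qed
    then obtain l where l: "l \<in> car E" "(\<lambda>n. nrm E (sub E (e n) l)) \<longlonglongrightarrow> 0"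
      by (rule E.complete_seq[of e "\<lambda>n. 2 * (1/2) ^ n", OF e(1)])
        (auto intro!: summable_mult summable_geometric)
    have "nrm D (sub D d (g l)) \<le> (1/2) ^ n + nrm E (sub E (e n) l)" for n
      using D.nrm_sub_triangle[of d "g (e n)" "g l"] e(2)[of n] e(1) l dc sub[of "e n" l] by simp
    moreover have "(\<lambda>n. (1/2) ^ n + nrm E (sub E (e n) l)) \<longlonglongrightarrow> 0 + 0"
      by (intro tendsto_intros l LIMSEQ_realpow_zero) simp_all
    ultimately have "nrm D (sub D d (g l)) \<le> 0"
      by (intro LIMSEQ_le_const[of "\<lambda>n. (1/2) ^ n + nrm E (sub E (e n) l)"]) auto
    then have "d = g l"
      using D.nrm_nonneg[of "sub D d (g l)"] D.nrm_eq_zero[of "sub D d (g l)"] dc l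
      by (auto simp: D.sub_eq_zer)
    then show ?thesis using l by blast
  qed
  ultimately have "closed_subspace D (g ` car E)" using D.closed_subspace_approx by blast
  then show ?thesis
    by (auto simp: cstar_sub_def simp flip: gs(4,5))
qed

section \<open>Comparison with a Stacey crossed product\<close>

context gauge_isometry
begin

lemma mpow_deg:
  "x \<in> deg n \<Longrightarrow> mpow D t k \<triangleright> x \<in> deg (n + int k)"
  "x \<in> deg n \<Longrightarrow> x \<triangleleft> mpow D t k \<in> deg (n + int k)"
  "x \<in> deg n \<Longrightarrow> star (multiplier D) (mpow D t k) \<triangleright> x \<in> deg (n - int k)"
  "x \<in> deg n \<Longrightarrow> x \<triangleleft> star (multiplier D) (mpow D t k) \<in> deg (n - int k)"
proof -
  have L: "mpow D t k \<triangleright> x \<in> deg (n + int k)" if "x \<in> deg n" for x n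
    using that
  proof (induction k arbitrary: x n)
    case (Suc k)
    have "mpow D t k \<triangleright> (t \<triangleright> x) \<in> deg (n + 1 + int k)" by (rule Suc.IH[OF deg_t(1)[OF Suc.prems]])
    then show ?case using degD(1)[OF Suc.prems] by (simp add: ac_simps)
  qed (simp add: degD)
  have R: "x \<triangleleft> mpow D t k \<in> deg (n + int k)" if "x \<in> deg n" for x n
    using that
  proof (induction k arbitrary: x n)
    case (Suc k)
    have "(x \<triangleleft> mpow D t k) \<triangleleft> t \<in> deg (n + int k + 1)" by (rule deg_t(2)[OF Suc.IH[OF Suc.prems]])
    then show ?case using degD(1)[OF Suc.prems] by (simp add: ac_simps)
  qed (simp add: degD)
  assume x: "x \<in> deg n"
  show "mpow D t k \<triangleright> x \<in> deg (n + int k)" "x \<triangleleft> mpow D t k \<in> deg (n + int k)" using L R x by auto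
  show "star (multiplier D) (mpow D t k) \<triangleright> x \<in> deg (n - int k)"
    using deg_star[OF R[OF deg_star[OF x]]] degD(1)[OF x] by simp
  show "x \<triangleleft> star (multiplier D) (mpow D t k) \<in> deg (n - int k)"
    using deg_star[OF L[OF deg_star[OF x]]] degD(1)[OF x] by simp
qed

end

text \<open>What the comparison uses once \<open>\<Phi>\<close> has been obtained from the universal
  property. The fixed-point algebra appears as \<open>D.deg 0\<close>, and nondegeneracy of
  \<open>iF\<close> as the vanishing of an annihilator.\<close>

locale stacey_comparison = D: gauge_isometry D t \<gamma> + E: isometry_multiplier E v
  for D :: "'d cstar" and t :: "'d mlt" and \<gamma> and E :: "'e cstar" and v :: "'e mlt" +
  fixes iF :: "'d \<Rightarrow> 'e" and \<Phi> :: "'e \<Rightarrow> 'd"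
  assumes iF: "cstar_hom D.F E iF" and Phi: "cstar_hom E D \<Phi>"
    and iF_nondegenerate: "\<lbrakk>z \<in> car E; \<And>f. f \<in> D.deg 0 \<Longrightarrow> iF f \<cdot>\<^bsub>E\<^esub> z = zer E\<rbrakk> \<Longrightarrow> z = zer E"
    and Phi_iF: "c \<in> D.deg 0 \<Longrightarrow> \<Phi> (iF c) = c"
    and Phi_v: "x \<in> car E \<Longrightarrow> \<Phi> (v \<triangleright> x) = t \<triangleright> \<Phi> x" "x \<in> car E \<Longrightarrow> \<Phi> (x \<triangleleft> v) = \<Phi> x \<triangleleft> t"
    and covariance: "c \<in> D.deg 0 \<Longrightarrow> iF ((t \<triangleright> c) \<triangleleft> star (multiplier D) t) = (v \<triangleright> iF c) \<triangleleft> star (multiplier E) v"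
begin

lemmas Phi_simps [simp] = cstar_hom_simps[OF Phi]

lemma iF_simps [simp]:
  "c \<in> D.deg 0 \<Longrightarrow> iF c \<in> car E"
  "\<lbrakk>c \<in> D.deg 0; d \<in> D.deg 0\<rbrakk> \<Longrightarrow> iF (add D c d) = add E (iF c) (iF d)"
  "c \<in> D.deg 0 \<Longrightarrow> iF (scl D a c) = scl E a (iF c)"
  "\<lbrakk>c \<in> D.deg 0; d \<in> D.deg 0\<rbrakk> \<Longrightarrow> iF (c \<cdot>\<^bsub>D\<^esub> d) = iF c \<cdot>\<^bsub>E\<^esub> iF d"
  "c \<in> D.deg 0 \<Longrightarrow> iF (star D c) = star E (iF c)"
  using cstar_hom_simps[OF iF] by (simp_all add: D.car_F)

lemma deg_0 [simp]: "zer D \<in> D.deg 0" "c \<in> D.deg 0 \<Longrightarrow> c \<in> car D"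
  "\<lbrakk>c \<in> D.deg 0; d \<in> D.deg 0\<rbrakk> \<Longrightarrow> add D c d \<in> D.deg 0"
  "\<lbrakk>c \<in> D.deg 0; d \<in> D.deg 0\<rbrakk> \<Longrightarrow> sub D c d \<in> D.deg 0"
  "\<lbrakk>c \<in> D.deg 0; d \<in> D.deg 0\<rbrakk> \<Longrightarrow> c \<cdot>\<^bsub>D\<^esub> d \<in> D.deg 0"
  "c \<in> D.deg 0 \<Longrightarrow> scl D a c \<in> D.deg 0" "c \<in> D.deg 0 \<Longrightarrow> star D c \<in> D.deg 0"
  using D.deg_mul[of c 0 d 0] D.deg_star[of c 0] D.deg_add D.deg_scl D.deg_zer D.degD
  by (simp_all add: sub_def)

lemma iF_zer [simp]: "iF (zer D) = zer E"
  using iF_simps(3)[of "zer D" 0] by simp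

lemma iF_sub: "\<lbrakk>c \<in> D.deg 0; d \<in> D.deg 0\<rbrakk> \<Longrightarrow> iF (sub D c d) = sub E (iF c) (iF d)"
  by (simp add: sub_def)

text \<open>\<open>\<Phi>\<close> is a left inverse of \<open>iF\<close>, and both are
  contractive.\<close>

lemma iF_isometric: assumes c: "c \<in> D.deg 0" shows "nrm E (iF c) = nrm D c"
proof (rule antisym)
  have "nrm E (iF c) \<le> nrm D.F c"
    by (rule cstar_hom_contractive[OF D.F_algebra E.cstar_algebra_axioms iF]) (use c in \<open>simp add: D.car_F\<close>)
  then show "nrm E (iF c) \<le> nrm D c" by simp
  have "nrm D (\<Phi> (iF c)) \<le> nrm E (iF c)"
    by (rule cstar_hom_contractive[OF E.cstar_algebra_axioms D.cstar_algebra_axioms Phi]) (use c in simp)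
  then show "nrm D c \<le> nrm E (iF c)" using c Phi_iF by simp
qed

text \<open>For \<open>q = u u\<^sup>* c\<close>, the element \<open>z = iF q - w w\<^sup>* iF q\<close> satisfies \<open>z z\<^sup>* = 0\<close> by covariance, and
  \<open>w\<^sup>* iF (c - q)\<close> vanishes because the nondegenerate \<open>iF\<close> annihilates it from the left.\<close>

lemma transport:
  assumes u: "isometry_multiplier D u" and w: "isometry_multiplier E w"
    and uF: "\<And>c. c \<in> D.deg 0 \<Longrightarrow> (u \<triangleright> c) \<triangleleft> star (multiplier D) u \<in> D.deg 0"
      "\<And>c. c \<in> D.deg 0 \<Longrightarrow> (star (multiplier D) u \<triangleright> c) \<triangleleft> u \<in> D.deg 0"
      "\<And>c. c \<in> D.deg 0 \<Longrightarrow> u \<triangleright> (star (multiplier D) u \<triangleright> c) \<in> D.deg 0"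
    and cov: "\<And>c. c \<in> D.deg 0 \<Longrightarrow> iF ((u \<triangleright> c) \<triangleleft> star (multiplier D) u) = (w \<triangleright> iF c) \<triangleleft> star (multiplier E) w"
    and c: "c \<in> D.deg 0"
  shows "iF (u \<triangleright> (star (multiplier D) u \<triangleright> c)) = w \<triangleright> (star (multiplier E) w \<triangleright> iF c)"
    and "iF ((star (multiplier D) u \<triangleright> c) \<triangleleft> u) = (star (multiplier E) w \<triangleright> iF c) \<triangleleft> w"
proof -
  interpret u: isometry_multiplier D u by fact
  interpret w: isometry_multiplier E w by fact
  let ?u' = "star (multiplier D) u" and ?w' = "star (multiplier E) w"
  have main: "iF (u \<triangleright> (?u' \<triangleright> c)) = w \<triangleright> (?w' \<triangleright> iF c)" if c: "c \<in> D.deg 0" for c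
  proof -
    define q where "q = u \<triangleright> (?u' \<triangleright> c)"
    have q: "q \<in> D.deg 0" using uF c by (simp add: q_def)
    define x where "x = iF q"
    have x: "x \<in> car E" using q by (simp add: x_def)
    \<comment> \<open>\<open>g\<close> has degree 0 and \<open>q q\<^sup>* = u g u\<^sup>*\<close>,
      so covariance places \<open>x x\<^sup>*\<close> in the corner of
      \<open>w w\<^sup>*\<close>.\<close>
    define g where "g = (?u' \<triangleright> (c \<cdot>\<^bsub>D\<^esub> star D c)) \<triangleleft> u"
    have g: "g \<in> D.deg 0" unfolding g_def by (rule uF(2)) (use c in simp)
    have "q \<cdot>\<^bsub>D\<^esub> star D q = (u \<triangleright> g) \<triangleleft> ?u'" using c by (simp add: q_def g_def)
    then have xx: "x \<cdot>\<^bsub>E\<^esub> star E x = (w \<triangleright> iF g) \<triangleleft> ?w'"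
      using cov[OF g] q unfolding x_def by (metis deg_0(7) iF_simps(4,5))
    define z where "z = sub E x (w \<triangleright> (?w' \<triangleright> x))"
    have z: "z \<in> car E" using x by (simp add: z_def)
    have "w \<triangleright> (?w' \<triangleright> (x \<cdot>\<^bsub>E\<^esub> star E x)) = x \<cdot>\<^bsub>E\<^esub> star E x" unfolding xx using g by simp
    then have zx: "z \<cdot>\<^bsub>E\<^esub> star E x = zer E" using x by (simp add: z_def E.mul_sub_left)
    have "z \<cdot>\<^bsub>E\<^esub> star E (w \<triangleright> (?w' \<triangleright> x)) = ((z \<cdot>\<^bsub>E\<^esub> star E x) \<triangleleft> w) \<triangleleft> ?w'"
      using x z by simp
    also have "\<dots> = zer E" unfolding zx by simp
    finally have "z \<cdot>\<^bsub>E\<^esub> star E z = zer E"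
      using zx x z by (simp add: z_def[symmetric] E.mul_sub_right)
        (simp add: z_def E.star_sub E.mul_sub_right)
    then have "z = zer E" using E.mul_star_zero z by blast
    then have 1: "iF q = w \<triangleright> (?w' \<triangleright> iF q)" using x by (simp add: z_def x_def E.sub_eq_zer)
    have "?w' \<triangleright> iF (sub D c q) = zer E"
    proof (rule iF_nondegenerate)
      fix f assume f: "f \<in> D.deg 0"
      \<comment> \<open>\<open>u\<^sup>*\<close> annihilates \<open>c - q\<close>, since
        \<open>q = u u\<^sup>* c\<close> and \<open>u\<close> is an isometry.\<close>
      have z: "((u \<triangleright> f) \<triangleleft> ?u') \<cdot>\<^bsub>D\<^esub> sub D c q = zer D"
        using c f by (simp add: q_def D.multiplier_add D.mul_sub_right)
      have "iF f \<cdot>\<^bsub>E\<^esub> (?w' \<triangleright> iF (sub D c q)) = (?w' \<triangleright> ((w \<triangleright> iF f) \<triangleleft> ?w')) \<cdot>\<^bsub>E\<^esub> iF (sub D c q)"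
        using f c q by simp
      also have "\<dots> = (?w' \<triangleright> iF ((u \<triangleright> f) \<triangleleft> ?u')) \<cdot>\<^bsub>E\<^esub> iF (sub D c q)" using cov[OF f] by simp
      also have "\<dots> = ?w' \<triangleright> iF (((u \<triangleright> f) \<triangleleft> ?u') \<cdot>\<^bsub>D\<^esub> sub D c q)"
        using uF(1)[OF f] c q by simp
      also have "\<dots> = zer E" unfolding z by simp
      finally show "iF f \<cdot>\<^bsub>E\<^esub> (?w' \<triangleright> iF (sub D c q)) = zer E" .
    qed (use c q in simp)
    then have "?w' \<triangleright> iF c = ?w' \<triangleright> iF q" using c q by (simp add: iF_sub E.multiplier_add E.sub_eq_zer)
    with 1 show ?thesis unfolding q_def by simp
  qed
  show "iF (u \<triangleright> (?u' \<triangleright> c)) = w \<triangleright> (?w' \<triangleright> iF c)" by (rule main[OF c])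
  have mainR: "iF ((c \<triangleleft> u) \<triangleleft> ?u') = (iF c \<triangleleft> w) \<triangleleft> ?w'" if c: "c \<in> D.deg 0" for c
  proof -
    have "star E (iF (u \<triangleright> (?u' \<triangleright> star D c))) = star E (w \<triangleright> (?w' \<triangleright> iF (star D c)))"
      using main[of "star D c"] c by simp
    moreover have "u \<triangleright> (?u' \<triangleright> star D c) \<in> D.deg 0" using uF(3)[of "star D c"] c by simp
    then have "star E (iF (u \<triangleright> (?u' \<triangleright> star D c))) = iF (star D (u \<triangleright> (?u' \<triangleright> star D c)))" by simp
    ultimately show ?thesis using c by simp
  qed
  have g: "(?u' \<triangleright> c) \<triangleleft> u \<in> D.deg 0" using uF(2) c by simp
  define c1 where "c1 = u \<triangleright> (?u' \<triangleright> c)"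
  have c1: "c1 \<in> D.deg 0" using uF(3) c by (simp add: c1_def)
  \<comment> \<open>The compression by \<open>w\<close> does not change when
    \<open>w w\<^sup>*\<close> is inserted on both sides of \<open>iF c\<close>. The enlarged middle
    is \<open>iF\<close> of \<open>u (u\<^sup>* c u) u\<^sup>*\<close>, to which covariance
    applies.\<close>
  have "(?w' \<triangleright> iF c) \<triangleleft> w = ?w' \<triangleright> ((w \<triangleright> (?w' \<triangleright> iF c)) \<triangleleft> w)" using c by simp
  also have "\<dots> = ?w' \<triangleright> (iF c1 \<triangleleft> w)" using main[OF c] by (simp add: c1_def)
  also have "\<dots> = (?w' \<triangleright> ((iF c1 \<triangleleft> w) \<triangleleft> ?w')) \<triangleleft> w" using c1 by simp
  also have "\<dots> = (?w' \<triangleright> iF ((c1 \<triangleleft> u) \<triangleleft> ?u')) \<triangleleft> w" using mainR[OF c1] by simp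
  also have "(c1 \<triangleleft> u) \<triangleleft> ?u' = (u \<triangleright> ((?u' \<triangleright> c) \<triangleleft> u)) \<triangleleft> ?u'" using c by (simp add: c1_def)
  also have "iF \<dots> = (w \<triangleright> iF ((?u' \<triangleright> c) \<triangleleft> u)) \<triangleleft> ?w'" by (rule cov[OF g])
  also have "(?w' \<triangleright> \<dots>) \<triangleleft> w = iF ((?u' \<triangleright> c) \<triangleleft> u)" using g by simp
  finally show "iF ((?u' \<triangleright> c) \<triangleleft> u) = (?w' \<triangleright> iF c) \<triangleleft> w" ..
qed

section \<open>Monomials in the Stacey crossed product\<close>

abbreviation tk where "tk k \<equiv> mpow D t k"
abbreviation vk where "vk k \<equiv> mpow E v k"
abbreviation tk' where "tk' k \<equiv> star (multiplier D) (mpow D t k)"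
abbreviation vk' where "vk' k \<equiv> star (multiplier E) (mpow E v k)"

lemma beta_0: "c \<in> D.deg 0 \<Longrightarrow> D.\<beta> c \<in> D.deg 0" by (rule D.beta_deg)

lemma covariance_beta: "c \<in> D.deg 0 \<Longrightarrow> iF (D.\<beta> c) = (v \<triangleright> iF c) \<triangleleft> star (multiplier E) v"
  using covariance by (simp add: D.\<beta>_def)

lemma tk_deg_0: assumes "c \<in> D.deg 0"
  shows "(tk k \<triangleright> c) \<triangleleft> tk' k \<in> D.deg 0" "(tk' k \<triangleright> c) \<triangleleft> tk k \<in> D.deg 0" "tk k \<triangleright> (tk' k \<triangleright> c) \<in> D.deg 0"
  using D.mpow_deg(4)[OF D.mpow_deg(1)[OF assms, of k], of k]
    D.mpow_deg(2)[OF D.mpow_deg(3)[OF assms, of k], of k]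
    D.mpow_deg(1)[OF D.mpow_deg(3)[OF assms, of k], of k] by simp_all

lemma covariance_power:
  "c \<in> D.deg 0 \<Longrightarrow> iF ((tk k \<triangleright> c) \<triangleleft> tk' k) = (vk k \<triangleright> iF c) \<triangleleft> vk' k"
proof (induction k arbitrary: c)
  case 0 
  then show ?case by (simp add: D.multiplier_apply(4) E.multiplier_apply(4) del: D.star_lmul E.star_lmul)
next
  case (Suc k)
  note b = beta_0[OF Suc.prems]
  have c: "c \<in> car D" and ic: "iF c \<in> car E" using Suc.prems by simp_all
  have "(tk (Suc k) \<triangleright> c) \<triangleleft> tk' (Suc k) = ((tk (Suc k) \<triangleright> c) \<triangleleft> star (multiplier D) t) \<triangleleft> tk' k"
    using c by (intro D.star_mpow_Suc(2)) simp
  also have "\<dots> = (tk k \<triangleright> D.\<beta> c) \<triangleleft> tk' k" using c by (simp add: D.\<beta>_def)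
  finally have "iF ((tk (Suc k) \<triangleright> c) \<triangleleft> tk' (Suc k)) = (vk k \<triangleright> iF (D.\<beta> c)) \<triangleleft> vk' k"
    using Suc.IH[OF b] by simp
  also have "\<dots> = ((vk (Suc k) \<triangleright> iF c) \<triangleleft> star (multiplier E) v) \<triangleleft> vk' k"
    using ic by (simp add: covariance_beta[OF Suc.prems])
  also have "\<dots> = (vk (Suc k) \<triangleright> iF c) \<triangleleft> vk' (Suc k)"
    using ic by (intro E.star_mpow_Suc(2)[symmetric]) simp
  finally show ?case .
qed

lemma transport_power:
  assumes "c \<in> D.deg 0"
  shows "iF (tk k \<triangleright> (tk' k \<triangleright> c)) = vk k \<triangleright> (vk' k \<triangleright> iF c)"
    and "iF ((tk' k \<triangleright> c) \<triangleleft> tk k) = (vk' k \<triangleright> iF c) \<triangleleft> vk k"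
  by (rule transport[OF D.power E.power]; simp add: tk_deg_0 covariance_power assms
      del: D.mpow_closed E.mpow_closed)+

text \<open>The monomial \<open>v\<^sup>*\<^sup>k iF(c) v\<^sup>l\<close>. Raising both exponents by covariance makes the inner exponents
  of a product agree, so that products need no case distinction.\<close>

definition mon :: "nat \<Rightarrow> 'd \<Rightarrow> nat \<Rightarrow> 'e" where
  "mon k c l = (vk' k \<triangleright> iF c) \<triangleleft> vk l"

lemma mon_car [simp]: "c \<in> D.deg 0 \<Longrightarrow> mon k c l \<in> car E"
  by (simp add: mon_def)

text \<open>\<open>iF (D.\<beta> c)\<close> is \<open>v iF(c) v\<^sup>*\<close>, and the new outer
  factors \<open>v\<^sup>*\<close> and \<open>v\<close> cancel against it.\<close>

lemma mon_raise:
  assumes c: "c \<in> D.deg 0"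
  shows "mon k c l = mon (Suc k) (D.\<beta> c) (Suc l)"
proof -
  have ic: "iF c \<in> car E" using c by simp
  have "mon (Suc k) (D.\<beta> c) (Suc l)
      = ((vk' k \<triangleright> (star (multiplier E) v \<triangleright> iF (D.\<beta> c))) \<triangleleft> v) \<triangleleft> vk l"
    unfolding mon_def using beta_0[OF c]
    by (simp only: E.star_mpow_Suc(1) E.mpow_Suc_right iF_simps(1) E.t
        E.multiplierD(1) E.multiplier_star_closed E.mpow_closed)
  then show ?thesis using ic by (simp add: covariance_beta[OF c] mon_def)
qed

lemma mon_raise_power:
  "c \<in> D.deg 0 \<Longrightarrow> \<exists>d\<in>D.deg 0. mon k c l = mon (k + j) d (l + j)"
proof (induction j)
  case (Suc j)
  then obtain d where "d \<in> D.deg 0" "mon k c l = mon (k + j) d (l + j)" by blast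
  then show ?case using mon_raise[of d "k + j" "l + j"] beta_0[of d] by auto
qed auto

text \<open>Single monomials suffice: after raising exponents, two monomials of equal degree have
  equal exponents and add up to one.\<close>

definition comp :: "int \<Rightarrow> 'e set" where
  "comp n = {mon k c l | k c l. c \<in> D.deg 0 \<and> int l - int k = n}"

lemma compI: "c \<in> D.deg 0 \<Longrightarrow> mon k c l \<in> comp (int l - int k)"
  unfolding comp_def by blast

text \<open>Between the coefficients stands the projection
  \<open>v\<^sup>r v\<^sup>*\<^sup>r\<close>, which \<open>transport_power\<close> moves inside
  \<open>iF\<close>.\<close>

lemma mon_mul:
  assumes c: "c \<in> D.deg 0" and d: "d \<in> D.deg 0"
  shows "mon k c r \<cdot>\<^bsub>E\<^esub> mon r d l = mon k (c \<cdot>\<^bsub>D\<^esub> (tk r \<triangleright> (tk' r \<triangleright> d))) l"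
  unfolding mon_def using c d tk_deg_0[OF d] by (simp add: transport_power(1)[OF d])

lemma mon_star: "c \<in> D.deg 0 \<Longrightarrow> star E (mon k c l) = mon l (star D c) k"
  by (simp add: mon_def)

lemma mon_diagonal: "c \<in> D.deg 0 \<Longrightarrow> mon k c k = iF ((tk' k \<triangleright> c) \<triangleleft> tk k)"
  by (simp add: mon_def transport_power(2))

lemma Phi_power:
  assumes "x \<in> car E"
  shows "\<Phi> (x \<triangleleft> vk k) = \<Phi> x \<triangleleft> tk k" "\<Phi> (vk' k \<triangleright> x) = tk' k \<triangleright> \<Phi> x"
proof -
  have R: "\<Phi> (x \<triangleleft> vk k) = \<Phi> x \<triangleleft> tk k" if "x \<in> car E" for x
    using that by (induction k) (simp_all add: Phi_v)
  show "\<Phi> (x \<triangleleft> vk k) = \<Phi> x \<triangleleft> tk k" using R assms by simp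
  have "\<Phi> (star E (star E x \<triangleleft> vk k)) = star D (\<Phi> (star E x) \<triangleleft> tk k)"
    using R[of "star E x"] assms by (simp del: E.star_rmul D.star_rmul)
  then show "\<Phi> (vk' k \<triangleright> x) = tk' k \<triangleright> \<Phi> x" using assms by simp
qed

lemma Phi_mon:
  assumes c: "c \<in> D.deg 0"
  shows "\<Phi> (mon k c l) \<in> D.deg (int l - int k)"
  using D.mpow_deg(2)[OF D.mpow_deg(3)[OF c, of k], of l] c
  by (simp add: mon_def Phi_power Phi_iF del: E.star_lmul)

text \<open>For a monomial \<open>x\<close>, \<open>x\<^sup>* x\<close> is a diagonal monomial and
  so lies in the image of \<open>iF\<close>, where \<open>\<Phi>\<close> preserves norms; the
  C*-identity does the rest.\<close>

lemma mon_isometric: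
  assumes c: "c \<in> D.deg 0"
  shows "nrm D (\<Phi> (mon k c l)) = nrm E (mon k c l)"
proof -
  define e where "e = star D c \<cdot>\<^bsub>D\<^esub> (tk k \<triangleright> (tk' k \<triangleright> c))"
  have e: "e \<in> D.deg 0" using c tk_deg_0 by (simp add: e_def)
  define g where "g = (tk' l \<triangleright> e) \<triangleleft> tk l"
  have g: "g \<in> D.deg 0" using tk_deg_0(2)[OF e] by (simp add: g_def)
  have xx: "star E (mon k c l) \<cdot>\<^bsub>E\<^esub> mon k c l = iF g"
    unfolding g_def using mon_mul[of "star D c" c] c e mon_star[OF c] mon_diagonal[OF e]
    by (simp add: e_def)
  have "(nrm E (mon k c l))\<^sup>2 = nrm E (iF g)" using E.cstar_identity[of "mon k c l"] xx c by simp
  also have "\<dots> = nrm D (\<Phi> (iF g))" using iF_isometric[OF g] Phi_iF[OF g] by simp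
  also have "\<dots> = nrm D (star D (\<Phi> (mon k c l)) \<cdot>\<^bsub>D\<^esub> \<Phi> (mon k c l))"
    using c by (simp flip: xx)
  also have "\<dots> = (nrm D (\<Phi> (mon k c l)))\<^sup>2" using c by (intro D.cstar_identity) simp
  finally show ?thesis using D.nrm_nonneg[of "\<Phi> (mon k c l)"] E.nrm_nonneg[of "mon k c l"] c
    by (simp add: power2_eq_iff_nonneg)
qed

lemma graded: "graded_hom D t \<gamma> E \<Phi> comp"
proof unfold_locales
  show "cstar_hom E D \<Phi>" by (rule Phi)
  show "zer E \<in> comp n" for n
  proof -
    \<comment> \<open>The zero element needs exponents with difference \<open>n\<close>; truncation
      to natural numbers provides them for either sign.\<close>
    have "mon (nat (- n)) (zer D) (nat n) = zer E" by (simp add: mon_def)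
    moreover have "int (nat n) - int (nat (- n)) = n" by arith
    ultimately show ?thesis using compI[of "zer D" "nat (- n)" "nat n"] by (simp del: int_nat_eq)
  qed
  fix n x assume "x \<in> comp n"
  then obtain k c l where x: "x = mon k c l" "c \<in> D.deg 0" "int l - int k = n"
    unfolding comp_def by blast
  show "x \<in> car E" using x by simp
  show "scl E a x \<in> comp n" for a
  proof -
    have "scl E a x = mon k (scl D a c) l" using x by (simp add: mon_def E.multiplier_scl)
    then show ?thesis using compI[of "scl D a c" k l] x by simp
  qed
  have "int k - int l = - n" using x(3) by simp
  then show "star E x \<in> comp (- n)"
    using compI[of "star D c" k l] x(1,2) mon_star[OF x(2)] compI[OF deg_0(7)[OF x(2)], of l k] by metis
  show "\<Phi> x \<in> D.deg n" using Phi_mon[OF x(2), of k l] x(1) unfolding x(3) by simp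
  show "nrm D (\<Phi> x) = nrm E x" using mon_isometric x by simp
  show "add E x y \<in> comp n" if "y \<in> comp n" for y
  proof -
    obtain k' d l' where y: "y = mon k' d l'" "d \<in> D.deg 0" "int l' - int k' = n"
      using \<open>y \<in> comp n\<close> unfolding comp_def by blast
    obtain c1 where c1: "c1 \<in> D.deg 0" "x = mon (k + k') c1 (l + k')"
      using mon_raise_power[OF x(2), of k l k'] x by blast
    obtain d1 where d1: "d1 \<in> D.deg 0" "y = mon (k' + k) d1 (l' + k)"
      using mon_raise_power[OF y(2), of k' l' k] y by blast
    \<comment> \<open>The left exponents agree after raising, and equal degree then forces the right
      ones to agree.\<close>
    have eq: "k' + k = k + k'" "l' + k = l + k'" using x(3) y(3) by linarith+
    have "add E x y = mon (k + k') (add D c1 d1) (l + k')"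
      using c1 d1 unfolding c1(2) d1(2) eq by (simp add: mon_def E.multiplier_add)
    then show ?thesis using compI[of "add D c1 d1" "k + k'" "l + k'"] c1 d1 x(3) by simp
  qed
  show "x \<cdot>\<^bsub>E\<^esub> y \<in> comp (n + m)" if "y \<in> comp m" for y m
  proof -
    obtain k' d l' where y: "y = mon k' d l'" "d \<in> D.deg 0" "int l' - int k' = m"
      using \<open>y \<in> comp m\<close> unfolding comp_def by blast
    \<comment> \<open>\<open>x\<close> is raised by the left exponent of \<open>y\<close>, and
      \<open>y\<close> by the right exponent of \<open>x\<close>, so that both inner exponents
      become \<open>l + k'\<close>.\<close>
    obtain c1 where c1: "c1 \<in> D.deg 0" "x = mon (k + k') c1 (l + k')"
      using mon_raise_power[OF x(2), of k l k'] x by blast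
    obtain d1 where d1: "d1 \<in> D.deg 0" "y = mon (k' + l) d1 (l' + l)"
      using mon_raise_power[OF y(2), of k' l' l] y by blast
    have "x \<cdot>\<^bsub>E\<^esub> y = mon (k + k') (c1 \<cdot>\<^bsub>D\<^esub> (tk (l + k') \<triangleright> (tk' (l + k') \<triangleright> d1))) (l' + l)"
      using mon_mul[OF c1(1) d1(1)] unfolding c1(2) d1(2) by (simp add: add.commute)
    moreover have "int (l' + l) - int (k + k') = n + m" using x(3) y(3) by simp
    ultimately show ?thesis
      using compI[of "c1 \<cdot>\<^bsub>D\<^esub> (tk (l + k') \<triangleright> (tk' (l + k') \<triangleright> d1))" "k + k'" "l' + l"] c1 d1 tk_deg_0
      by simp
  qed
qed

lemma generators: "iF ` car D.F \<union> (\<lambda>c. iF c \<triangleleft> v) ` car D.F \<subseteq> (\<Union>n. comp n)"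
proof -
  have "iF c \<in> comp 0" "iF c \<triangleleft> v \<in> comp 1" if c: "c \<in> D.deg 0" for c
  proof -
    have "mon 0 c 0 = iF c" "mon 0 c 1 = iF c \<triangleleft> v"
      using c by (simp_all add: mon_def E.multiplier_apply(3) del: E.star_rmul)
    then show "iF c \<in> comp 0" "iF c \<triangleleft> v \<in> comp 1" using compI[OF c, of 0 0] compI[OF c, of 0 1] by simp_all
  qed
  then show ?thesis unfolding D.car_F by (intro Un_least image_subsetI; auto)
qed

lemma bijective:
  assumes gen: "cstar_generated E (iF ` car D.F \<union> (\<lambda>c. iF c \<triangleleft> v) ` car D.F) = car E"
    and genD: "cstar_generated D X = car D" and X: "X \<subseteq> \<Phi> ` car E"
  shows "bij_betw \<Phi> (car E) (car D)"
proof -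
  interpret graded_hom D t \<gamma> E \<Phi> comp by (rule graded)
  have "car E \<subseteq> cstar_generated E (\<Union>n. comp n)"
    unfolding gen[symmetric] cstar_generated_def using generators
    by (intro Inter_anti_mono Collect_mono) (meson order_trans)
  then have iso: "nrm D (\<Phi> x) = nrm E x" if "x \<in> car E" for x using isometric that by blast
  have "inj_on \<Phi> (car E)"
  proof (rule inj_onI)
    fix x y assume xy: "x \<in> car E" "y \<in> car E" "\<Phi> x = \<Phi> y"
    have "nrm E (sub E x y) = nrm D (sub D (\<Phi> x) (\<Phi> y))"
      using iso[of "sub E x y"] xy(1,2) E.linear_map_sub[OF cstar_hom_linear[OF Phi]] by simp
    then have "nrm E (sub E x y) = 0" using xy by simp
    then show "x = y" using E.nrm_eq_zero[of "sub E x y"] xy by (simp add: E.sub_eq_zer)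
  qed
  moreover have "cstar_sub D (\<Phi> ` car E)"
    by (rule isometric_range_cstar_sub[OF E.cstar_algebra_axioms D.cstar_algebra_axioms Phi iso])
  then have "car D \<subseteq> \<Phi> ` car E" using D.cstar_generated_least X genD by blast
  ultimately show ?thesis unfolding bij_betw_def by auto
qed

end

section \<open>Surjective homomorphisms\<close>

lemma preimage_closed_subspace:
  assumes A: "cstar_algebra A" and B: "cstar_algebra B" and h: "cstar_hom A B h"
    and U: "closed_subspace B U"
  shows "closed_subspace A {x \<in> car A. h x \<in> U}"
proof -
  interpret A: cstar_algebra A by fact
  interpret B: cstar_algebra B by fact
  have Us: "subspace_of B U" "\<And>x. approx B U x \<Longrightarrow> x \<in> U"
    using U B.closed_subspace_approx by auto
  have "subspace_of A {x \<in> car A. h x \<in> U}"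
    using Us(1) linear_map_zer[OF A.banach B.banach cstar_hom_linear[OF h]]
    unfolding subspace_of_def by (auto simp: cstar_hom_simps[OF h])
  moreover have "h x \<in> U" if x: "approx A {x \<in> car A. h x \<in> U} x" for x
  proof -
    have "approx B (h ` ({x \<in> car A. h x \<in> U} \<inter> car A)) (h x)"
      by (rule A.approx_lip[OF B.banach x cstar_hom_lip[OF A B h]])
    then have "approx B U (h x)" unfolding approx_def by fastforce
    then show ?thesis by (rule Us(2))
  qed
  moreover have "x \<in> car A" if "approx A {x \<in> car A. h x \<in> U} x" for x
    using that by (simp add: approx_def)
  ultimately show ?thesis unfolding A.closed_subspace_approx by blast
qed

text \<open>A closed subspace of \<open>C\<close> that contains the products pulls back along
  \<open>h\<close> to one that contains the products in \<open>B\<close>, hence to all of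
  \<open>B\<close>.\<close>

lemma nondegenerate_surj:
  assumes B: "cstar_algebra B" and C: "cstar_algebra C" and h: "cstar_hom B C h"
    and surj: "h ` car B = car C" and f: "f \<in> car A \<rightarrow> car B" and nd: "nondegenerate A B f"
  shows "nondegenerate A C (\<lambda>a. h (f a))"
proof -
  interpret B: cstar_algebra B by fact
  interpret C: cstar_algebra C by fact
  let ?X = "{h (f a) \<cdot>\<^bsub>C\<^esub> c | a c. a \<in> car A \<and> c \<in> car C}"
  have "?X \<subseteq> car C" using f by (auto intro!: C.mul_closed cstar_hom_simps(1)[OF h])
  then have "closed_span C ?X \<subseteq> car C" by (rule C.closed_span_car)
  moreover have "car C \<subseteq> U" if U: "closed_subspace C U" "?X \<subseteq> U" for U
  proof -
    have "{f a \<cdot>\<^bsub>B\<^esub> b | a b. a \<in> car A \<and> b \<in> car B} \<subseteq> {x \<in> car B. h x \<in> U}"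
      using U(2) f surj cstar_hom_simps[OF h] by (auto simp: Pi_iff) blast
    then have "closed_span B {f a \<cdot>\<^bsub>B\<^esub> b | a b. a \<in> car A \<and> b \<in> car B} \<subseteq> {x \<in> car B. h x \<in> U}"
      by (intro B.closed_span_least preimage_closed_subspace[OF B C h U(1)])
    then have "car B \<subseteq> {x \<in> car B. h x \<in> U}" using nd by (simp add: nondegenerate_def)
    then have "h ` car B \<subseteq> U" by auto
    then show ?thesis using surj by simp
  qed
  then have "car C \<subseteq> closed_span C ?X" unfolding closed_span_def by (intro Inter_greatest) simp
  ultimately show ?thesis by (simp add: nondegenerate_def)
qed

text \<open>As the image of \<open>f\<close> is closed under adjoints, \<open>star B z\<close>
  annihilates all products \<open>f(a) b\<close> from the left, hence their closed span, which
  contains \<open>z\<close>. So \<open>z\<^sup>* z = 0\<close>.\<close>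

lemma nondegenerate_left_cancel:
  assumes B: "cstar_algebra B" and f: "f \<in> car A \<rightarrow> car B" "\<And>a. a \<in> car A \<Longrightarrow> \<exists>a'\<in>car A. f a' = star B (f a)"
    and nd: "nondegenerate A B f" and z: "z \<in> car B" "\<And>a. a \<in> car A \<Longrightarrow> f a \<cdot>\<^bsub>B\<^esub> z = zer B"
  shows "z = zer B"
proof -
  interpret B: cstar_algebra B by fact
  let ?U = "{b \<in> car B. star B z \<cdot>\<^bsub>B\<^esub> b = zer B}"
  have "star B z \<cdot>\<^bsub>B\<^esub> f a = zer B" if a: "a \<in> car A" for a
  proof -
    obtain a' where a': "a' \<in> car A" "f a' = star B (f a)" using f(2) a by blast
    have "star B (f a' \<cdot>\<^bsub>B\<^esub> z) = star B (zer B)" using z(2)[OF a'(1)] by simp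
    moreover have "f a \<in> car B" using f a by blast
    ultimately show ?thesis using a' z by (simp add: B.star_mul)
  qed
  then have "{f a \<cdot>\<^bsub>B\<^esub> b | a b. a \<in> car A \<and> b \<in> car B} \<subseteq> ?U"
    using f(1) z(1) by (auto simp: Pi_iff simp flip: B.mul_assoc)
  moreover have "closed_subspace B ?U"
    unfolding B.closed_subspace_approx
  proof (intro conjI allI impI)
    show "subspace_of B ?U" using z(1) by (auto simp: subspace_of_def B.alg_simps)
    fix x assume x: "approx B ?U x"
    have "star B z \<cdot>\<^bsub>B\<^esub> x = zer B"
      by (rule B.approx_eq[OF B.banach x B.lip_mul_left B.lip_const]) (use z B.banach in auto)
    then show "x \<in> ?U" using x by (simp add: approx_def)
  qed
  ultimately have "closed_span B {f a \<cdot>\<^bsub>B\<^esub> b | a b. a \<in> car A \<and> b \<in> car B} \<subseteq> ?U"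
    by (intro B.closed_span_least)
  then have "z \<in> ?U" using nd z(1) by (auto simp: nondegenerate_def)
  then show ?thesis using B.star_mul_zero[of z] z(1) by simp
qed

lemma cstar_generated_surj:
  assumes B: "cstar_algebra B" and C: "cstar_algebra C" and h: "cstar_hom B C h"
    and surj: "h ` car B = car C" and X: "X \<subseteq> car B" and gen: "cstar_generated B X = car B"
  shows "cstar_generated C (h ` X) = car C"
proof
  interpret B: cstar_algebra B by fact
  interpret C: cstar_algebra C by fact
  note hs = cstar_hom_simps[OF h]
  have "cstar_sub C (car C)" by (simp add: cstar_sub_def C.car_closed_subspace)
  then show "cstar_generated C (h ` X) \<subseteq> car C"
    by (rule C.cstar_generated_least) (use X hs in auto)
  have "car C \<subseteq> U" if U: "cstar_sub C U" "h ` X \<subseteq> U" for U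
  proof -
    have "closed_subspace B {x \<in> car B. h x \<in> U}"
      by (rule preimage_closed_subspace[OF B C h]) (use U in \<open>simp add: cstar_sub_def\<close>)
    then have "cstar_sub B {x \<in> car B. h x \<in> U}"
      using U(1) by (auto simp: cstar_sub_def hs)
    then have "cstar_generated B X \<subseteq> {x \<in> car B. h x \<in> U}"
      by (rule B.cstar_generated_least) (use U X in auto)
    then have "h ` car B \<subseteq> U" unfolding gen by auto
    then show ?thesis using surj by simp
  qed
  then show "car C \<subseteq> cstar_generated C (h ` X)"
    unfolding cstar_generated_def cstar_sub_def by (intro Inter_greatest) simp
qed

text \<open>\<open>mult_ext\<close> records left actions only. By surjectivity every element of
  \<open>C\<close> is some \<open>h w\<close>, and testing against these recovers the right action
  and then the adjoint.\<close>

lemma multiplier_surj: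
  assumes B: "cstar_algebra B" and C: "cstar_algebra C" and h: "cstar_hom B C h"
    and surj: "h ` car B = car C" and mn: "mult_ext B C h m n"
  shows "x \<in> car B \<Longrightarrow> h x \<triangleleft> n = h (x \<triangleleft> m)"
    and "isometry_multiplier B m \<Longrightarrow> isometry_multiplier C n"
proof -
  interpret B: cstar_algebra B by fact
  interpret C: cstar_algebra C by fact
  note hs [simp] = cstar_hom_simps[OF h]
  have m: "m \<in> car (multiplier B)" and n: "n \<in> car (multiplier C)"
    and L: "\<And>x. x \<in> car B \<Longrightarrow> n \<triangleright> h x = h (m \<triangleright> x)"
    using mn by (auto simp: mult_ext_def)
  note [simp] = B.multiplierD(1,2)[OF m] C.multiplierD(1,2)[OF n]
  have R: "h x \<triangleleft> n = h (x \<triangleleft> m)" if x: "x \<in> car B" for x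
  proof (rule C.eq_by_right_mult)
    fix y assume "y \<in> car C"
    then obtain w where w: "w \<in> car B" "y = h w" using surj by blast
    have "(h x \<triangleleft> n) \<cdot>\<^bsub>C\<^esub> y = h (x \<cdot>\<^bsub>B\<^esub> (m \<triangleright> w))" using x w L C.multiplierD(5)[OF n] by simp
    also have "\<dots> = h (x \<triangleleft> m) \<cdot>\<^bsub>C\<^esub> y" using x w by (simp flip: B.multiplierD(5)[OF m])
    finally show "(h x \<triangleleft> n) \<cdot>\<^bsub>C\<^esub> y = h (x \<triangleleft> m) \<cdot>\<^bsub>C\<^esub> y" .
  qed (use x in simp_all)
  then show "x \<in> car B \<Longrightarrow> h x \<triangleleft> n = h (x \<triangleleft> m)" .
  assume "isometry_multiplier B m"
  then interpret m: isometry_multiplier B m .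
  show "isometry_multiplier C n"
  proof
    show "n \<in> car (multiplier C)" by (rule n)
    fix y assume "y \<in> car C"
    then obtain x where x: "x \<in> car B" "y = h x" using surj by blast
    have "star (multiplier C) n \<triangleright> (n \<triangleright> h x) = h (star B (star B (m \<triangleright> x) \<triangleleft> m))"
      using x by (simp add: L R C.multiplier_apply(3) del: B.star_lmul B.star_rmul flip: hs(5))
    also have "star B (star B (m \<triangleright> x) \<triangleleft> m) = x" using x by simp
    finally show "star (multiplier C) n \<triangleright> (n \<triangleright> y) = y" using x by simp
  qed
qed

text \<open>Moving \<open>s\<close> past \<open>i(a)\<close> gives
  \<open>s\<^sup>* s i(a) x = s\<^sup>* i(\<alpha>(a)) s x = i(a) x\<close>, and by nondegeneracy
  the elements \<open>i(a) x\<close> span a dense subspace.\<close>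

lemma toeplitz_isometry:
  assumes A: "exel_system A \<alpha> L" and T: "cstar_algebra T" and rep: "toeplitz_rep A \<alpha> L T i s"
  shows "isometry_multiplier T s" and "a \<in> car A \<Longrightarrow> s \<triangleright> i a = i (\<alpha> a) \<triangleleft> s"
proof -
  interpret A: cstar_algebra A using A by (simp add: exel_system_def)
  interpret T: cstar_algebra T by fact
  have i: "cstar_hom A T i" and nd: "nondegenerate A T i" and s: "s \<in> car (multiplier T)"
    and al: "cstar_hom A A \<alpha>"
    and cov: "\<And>a. a \<in> car A \<Longrightarrow> s \<cdot>\<^bsub>multiplier T\<^esub> memb T (i a) = memb T (i (\<alpha> a)) \<cdot>\<^bsub>multiplier T\<^esub> s"
    and tr: "\<And>a. a \<in> car A \<Longrightarrow> star (multiplier T) s \<cdot>\<^bsub>multiplier T\<^esub> memb T (i a) \<cdot>\<^bsub>multiplier T\<^esub> s = memb T (i (L a))"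
    using A rep by (auto simp: toeplitz_rep_def exel_system_def)
  note [simp] = cstar_hom_simps[OF i] cstar_hom_simps[OF al] T.multiplierD(1,2)[OF s] s
  \<comment> \<open>The transfer identity at the multiplier 1, which \<open>L'\<close>
    fixes.\<close>
  have La: "L (\<alpha> a) = a" if a: "a \<in> car A" for a
  proof -
    obtain L' where L': "\<And>a m. a \<in> car A \<Longrightarrow> m \<in> car (multiplier A) \<Longrightarrow> L (\<alpha> a \<triangleleft> m) = a \<triangleleft> L' m"
      "L' (mone A) = mone A"
      using A unfolding exel_system_def by blast
    show ?thesis using L'(1)[OF a A.mone_closed] L'(2) a by simp
  qed
  have cov': "s \<triangleright> (i a \<cdot>\<^bsub>T\<^esub> x) = i (\<alpha> a) \<cdot>\<^bsub>T\<^esub> (s \<triangleright> x)" if "a \<in> car A" "x \<in> car T" for a x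
  proof -
    have "(s \<cdot>\<^bsub>multiplier T\<^esub> memb T (i a)) \<triangleright> x = (memb T (i (\<alpha> a)) \<cdot>\<^bsub>multiplier T\<^esub> s) \<triangleright> x"
      using cov that by simp
    then show ?thesis using that by simp
  qed
  show sa: "s \<triangleright> i a = i (\<alpha> a) \<triangleleft> s" if a: "a \<in> car A" for a
  proof (rule T.eq_by_right_mult)
    fix x assume x: "x \<in> car T"
    show "(s \<triangleright> i a) \<cdot>\<^bsub>T\<^esub> x = (i (\<alpha> a) \<triangleleft> s) \<cdot>\<^bsub>T\<^esub> x"
      using cov'[OF a x] a x T.multiplierD(3,5)[OF s] by simp
  qed (use a in simp_all)
  let ?s' = "star (multiplier T) s"
  let ?U = "{x \<in> car T. ?s' \<triangleright> (s \<triangleright> x) = x}"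
  have "i a \<cdot>\<^bsub>T\<^esub> x \<in> ?U" if a: "a \<in> car A" and x: "x \<in> car T" for a x
  proof -
    have "(?s' \<cdot>\<^bsub>multiplier T\<^esub> memb T (i (\<alpha> a)) \<cdot>\<^bsub>multiplier T\<^esub> s) \<triangleright> x = memb T (i (L (\<alpha> a))) \<triangleright> x"
      using tr[of "\<alpha> a"] a by simp
    then have "?s' \<triangleright> (i (\<alpha> a) \<cdot>\<^bsub>T\<^esub> (s \<triangleright> x)) = i a \<cdot>\<^bsub>T\<^esub> x"
      using a x La by (simp del: T.multiplier_apply(3))
    then show ?thesis using cov'[OF a x] a x by (simp del: T.multiplier_apply(3))
  qed
  then have "{i a \<cdot>\<^bsub>T\<^esub> x | a x. a \<in> car A \<and> x \<in> car T} \<subseteq> ?U" by blast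
  moreover have "closed_subspace T ?U"
    unfolding T.closed_subspace_approx
  proof (intro conjI allI impI)
    have s': "?s' \<in> car (multiplier T)" by simp
    show "subspace_of T ?U"
      using T.multiplier_zer[OF s] T.multiplier_zer[OF s'] T.multiplierD(1)[OF s']
      by (auto simp: subspace_of_def T.multiplier_add[OF s] T.multiplier_scl[OF s]
          T.multiplier_add[OF s'] T.multiplier_scl[OF s'] simp del: T.multiplier_apply(3))
    fix x assume x: "approx T ?U x"
    have "?s' \<triangleright> (s \<triangleright> x) = x"
      by (rule T.approx_eq[OF T.banach x lip_comp[OF T.banach T.banach T.banach
            T.multiplier_lip(1)[OF s] T.multiplier_lip(1)[OF s']] T.lip_id]) simp
    then show "x \<in> ?U" using x by (simp add: approx_def del: T.multiplier_apply(3))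
  qed
  ultimately have "closed_span T {i a \<cdot>\<^bsub>T\<^esub> x | a x. a \<in> car A \<and> x \<in> car T} \<subseteq> ?U"
    by (intro T.closed_span_least)
  then have "car T \<subseteq> ?U" using nd by (simp add: nondegenerate_def)
  then show "isometry_multiplier T s" by unfold_locales (use s in auto)
qed

section \<open>The Exel crossed product as a Stacey crossed product\<close>

context gauge_isometry
begin

text \<open>Stated for a surjection, so that it covers both \<open>D\<close> itself and its copy in
  the type of the test algebras.\<close>

lemma stacey_rep_surj:
  assumes nd: "nondegenerate F D (\<lambda>x. x)" and C: "cstar_algebra C" and h: "cstar_hom D C h"
    and surj: "h ` car D = car C" and W: "mult_ext D C h t W"
  shows "stacey_rep F \<beta> C h W"
proof -
  interpret C: isometry_multiplier C W
    by (rule multiplier_surj(2)[OF cstar_algebra_axioms C h surj W isometry_multiplier_axioms])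
  note hs [simp] = cstar_hom_simps[OF h]
  have W: "\<And>x. x \<in> car D \<Longrightarrow> W \<triangleright> h x = h (t \<triangleright> x)" using W by (simp add: mult_ext_def)
  have Fc: "c \<in> car D" if "c \<in> car F" for c using that degD(1) car_F by blast
  show ?thesis
    unfolding stacey_rep_def
  proof (intro conjI ballI)
    show "cstar_hom F C h" using h Fc by (auto simp: cstar_hom_def linear_map_def)
    show "nondegenerate F C h"
      using nondegenerate_surj[OF cstar_algebra_axioms C h surj _ nd] Fc by auto
    show "W \<in> car (multiplier C)" by simp
    show "star (multiplier C) W \<cdot>\<^bsub>multiplier C\<^esub> W = mone C"
      by (rule C.multiplier_eqI) simp_all
    fix c assume c: "c \<in> car F"
    have bc: "\<beta> c \<in> car D" using Fc[OF c] by (simp add: \<beta>_def)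
    show "memb C (h (\<beta> c))
        = W \<cdot>\<^bsub>multiplier C\<^esub> memb C (h c) \<cdot>\<^bsub>multiplier C\<^esub> star (multiplier C) W"
    proof (rule C.multiplier_eqI)
      fix x assume x: "x \<in> car C"
      \<comment> \<open>\<open>\<beta> c\<close> is written as the adjoint of
        \<open>t (t c)\<^sup>*\<close>, so that only left actions of \<open>t\<close> occur.\<close>
      have "h (\<beta> c) = star C (h (t \<triangleright> star D (t \<triangleright> c)))" 
        using Fc[OF c] by (simp add: \<beta>_def flip: hs(5))
      also have "\<dots> = star C (W \<triangleright> star C (W \<triangleright> h c))"
        using Fc[OF c] W[of c] W[of "star D (t \<triangleright> c)"] by (simp del: star_lmul C.star_lmul)
      also have "\<dots> = (W \<triangleright> h c) \<triangleleft> star (multiplier C) W" using Fc[OF c] by simp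
      finally show "memb C (h (\<beta> c)) \<triangleright> x
          = (W \<cdot>\<^bsub>multiplier C\<^esub> memb C (h c) \<cdot>\<^bsub>multiplier C\<^esub> star (multiplier C) W) \<triangleright> x"
        using x Fc[OF c] by simp
    qed (use Fc[OF c] bc in simp_all)
  qed
qed

text \<open>The universal property is stated for algebras on \<^typ>\<open>nat \<Rightarrow> 'd + 'e\<close>, hence the copy of \<open>D\<close>.\<close>

lemma stacey_isomorphism:
  fixes E :: "'e cstar"
  assumes nd: "nondegenerate F D (\<lambda>x. x)" and cp: "stacey_crossed_product F \<beta> E iF v"
    and gen: "cstar_generated D X = car D" and X: "X \<subseteq> deg 0 \<union> (\<lambda>c. c \<triangleleft> t) ` deg 0"
  shows "\<exists>\<Phi>. integrated_form F E iF v D (\<lambda>x. x) t \<Phi> \<and> bij_betw \<Phi> (car E) (car D)"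
proof -
  \<comment> \<open>Constant sequences in the left summand: an embedding of the elements of
    \<open>D\<close> into the test type.\<close>
  define g :: "'d \<Rightarrow> nat \<Rightarrow> 'd + 'e" where "g = (\<lambda>x n. Inl x)"
  have g: "inj g" by (auto simp: g_def inj_on_def fun_eq_iff)
  let ?B = "copy g D" and ?W = "copy_multiplier g D t"
  have B: "cstar_algebra ?B" by (rule copy_algebra[OF g])
  have gW: "mult_ext D ?B g t ?W"
    using g by (simp add: mult_ext_def copy_multiplier_closed)
  have "stacey_rep F \<beta> ?B g ?W"
    by (rule stacey_rep_surj[OF nd B copy_hom[OF g] _ gW]) (simp add: g)
  then obtain h where h: "integrated_form F E iF v ?B g ?W h"
    using cp B unfolding stacey_crossed_product_def by blast
  have E: "cstar_algebra E" and iF: "stacey_rep F \<beta> E iF v"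
    and genE: "cstar_generated E (iF ` car F \<union> (\<lambda>c. iF c \<triangleleft> v) ` car F) = car E"
    using cp by (auto simp: stacey_crossed_product_def)
  interpret E: cstar_algebra E by fact
  have hh: "cstar_hom E ?B h" and hi: "\<And>c. c \<in> car F \<Longrightarrow> h (iF c) = g c" and hv: "mult_ext E ?B h v ?W"
    using h by (auto simp: integrated_form_def)
  define \<Phi> where "\<Phi> = (\<lambda>x. inv g (h x))"
  have Phi: "cstar_hom E D \<Phi>"
    using hh copy_inv_hom[OF g] unfolding \<Phi>_def cstar_hom_def linear_map_def
    by (auto simp: Pi_iff)
  note Ps [simp] = cstar_hom_simps[OF Phi]
  have gP: "h x = g (\<Phi> x)" if "x \<in> car E" for x
    using cstar_hom_simps(1)[OF hh that] g by (auto simp: \<Phi>_def)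
  have v: "v \<in> car (multiplier E)" using hv by (simp add: mult_ext_def)
  note vD [simp] = E.multiplierD(1,2)[OF v]
  have Pv: "\<Phi> (v \<triangleright> x) = t \<triangleright> \<Phi> x" if x: "x \<in> car E" for x
  proof -
    have "h (v \<triangleright> x) = ?W \<triangleright> h x" using hv x by (simp add: mult_ext_def)
    then have "g (\<Phi> (v \<triangleright> x)) = g (t \<triangleright> \<Phi> x)" using x gP g by simp
    then show ?thesis using g by (simp add: inj_eq)
  qed
  have Pi: "\<Phi> (iF c) = c" if "c \<in> car F" for c using hi[OF that] g by (simp add: \<Phi>_def)
  have iFh: "cstar_hom F E iF" and iFn: "nondegenerate F E iF"
    and iFv: "star (multiplier E) v \<cdot>\<^bsub>multiplier E\<^esub> v = mone E"
    and iFc: "\<And>c. c \<in> car F \<Longrightarrow> memb E (iF (\<beta> c))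
          = v \<cdot>\<^bsub>multiplier E\<^esub> memb E (iF c) \<cdot>\<^bsub>multiplier E\<^esub> star (multiplier E) v"
    using iF by (auto simp: stacey_rep_def)
  have Fc: "c \<in> car D" if "c \<in> car F" for c using that degD(1) car_F by blast
  have Fs: "star D c \<in> car F" if "c \<in> car F" for c using that deg_star[of c 0] by (simp add: car_F)
  interpret E: isometry_multiplier E v
  proof
    fix x assume "x \<in> car E"
    then show "star (multiplier E) v \<triangleright> (v \<triangleright> x) = x"
      using arg_cong[OF iFv, of "\<lambda>m. m \<triangleright> x"] by (simp del: E.multiplier_apply(3))
  qed (rule v)
  interpret S: stacey_comparison D t \<gamma> E v iF \<Phi>
  proof
    show "cstar_hom F E iF" "cstar_hom E D \<Phi>" by fact+
    show "z = zer E" if "z \<in> car E" "\<And>f. f \<in> deg 0 \<Longrightarrow> iF f \<cdot>\<^bsub>E\<^esub> z = zer E" for z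
    proof (rule nondegenerate_left_cancel[OF E _ _ iFn that(1)])
      show "iF \<in> car F \<rightarrow> car E" using cstar_hom_simps(1)[OF iFh] by auto
      show "\<exists>a'\<in>car F. iF a' = star E (iF a)" if "a \<in> car F" for a
        using cstar_hom_simps(5)[OF iFh that] Fs[OF that] by auto
    qed (use that car_F in auto)
    show "\<Phi> (iF c) = c" if "c \<in> deg 0" for c using Pi that car_F by blast
    show "\<Phi> (v \<triangleright> x) = t \<triangleright> \<Phi> x" if "x \<in> car E" for x using Pv that .
    show "\<Phi> (x \<triangleleft> v) = \<Phi> x \<triangleleft> t" if x: "x \<in> car E" for x
    proof -
      \<comment> \<open>The universal property gives the left relation only. Multiplying by
        \<open>\<Phi>(iF c) = c\<close> shows that \<open>z\<close> annihilates the fixed-point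
        algebra from the left; its adjoint is then annihilated by that algebra, and nondegeneracy
        applies.\<close>
      define z where "z = sub D (\<Phi> (x \<triangleleft> v)) (\<Phi> x \<triangleleft> t)"
      have z: "z \<in> car D" using x by (simp add: z_def)
      have zc: "z \<cdot>\<^bsub>D\<^esub> c = zer D" if c: "c \<in> car F" for c
      proof -
        have ic: "iF c \<in> car E" using cstar_hom_simps(1)[OF iFh c] .
        have "\<Phi> (x \<triangleleft> v) \<cdot>\<^bsub>D\<^esub> \<Phi> (iF c) = \<Phi> x \<cdot>\<^bsub>D\<^esub> (t \<triangleright> \<Phi> (iF c))"
          using x ic Ps(4)[of "x \<triangleleft> v" "iF c"] Pv[OF ic] by simp
        then show ?thesis using x Fc[OF c] Pi[OF c] by (simp add: z_def mul_sub_left)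
      qed
      have "star D z = zer D"
      proof (rule nondegenerate_left_cancel[OF cstar_algebra_axioms _ _ nd])
        show "(\<lambda>x. x) \<in> car F \<rightarrow> car D" using Fc by auto
        show "\<exists>a'\<in>car F. a' = star D a" if "a \<in> car F" for a using Fs[OF that] by simp
        fix a assume a: "a \<in> car F"
        have "star D (z \<cdot>\<^bsub>D\<^esub> star D a) = a \<cdot>\<^bsub>D\<^esub> star D z"
          using z Fc[OF a] by (simp add: star_mul)
        then show "a \<cdot>\<^bsub>D\<^esub> star D z = zer D" using zc[OF Fs[OF a]] by simp
      qed (use z in simp)
      then have "z = zer D" using z star_star[of z] by simp
      then show ?thesis using x by (simp add: z_def sub_eq_zer)
    qed
    fix c assume "c \<in> deg 0"
    then have c: "c \<in> car F" by (simp add: car_F)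
    have bc: "\<beta> c \<in> car F" using c beta_deg by (simp add: car_F)
    have ic: "iF c \<in> car E" "iF (\<beta> c) \<in> car E" using cstar_hom_simps(1)[OF iFh] c bc by auto
    have "iF (\<beta> c) = (v \<triangleright> iF c) \<triangleleft> star (multiplier E) v"
    proof (rule E.eq_by_right_mult)
      fix x assume x: "x \<in> car E"
      have "memb E (iF (\<beta> c)) \<triangleright> x = (v \<cdot>\<^bsub>multiplier E\<^esub> memb E (iF c) \<cdot>\<^bsub>multiplier E\<^esub> star (multiplier E) v) \<triangleright> x"
        using iFc[OF c] by simp
      then show "iF (\<beta> c) \<cdot>\<^bsub>E\<^esub> x = ((v \<triangleright> iF c) \<triangleleft> star (multiplier E) v) \<cdot>\<^bsub>E\<^esub> x"
        using x ic by simp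
    qed (use ic in simp_all)
    then show "iF ((t \<triangleright> c) \<triangleleft> t') = (v \<triangleright> iF c) \<triangleleft> star (multiplier E) v" by (simp add: \<beta>_def)
  qed
  have "X \<subseteq> \<Phi> ` car E"
  proof -
    have "c \<in> \<Phi> ` car E" "c \<triangleleft> t \<in> \<Phi> ` car E" if c: "c \<in> deg 0" for c
      using S.Phi_iF[OF c] S.Phi_v(2)[of "iF c"] c
        image_eqI[of c \<Phi> "iF c" "car E"] image_eqI[of "c \<triangleleft> t" \<Phi> "iF c \<triangleleft> v" "car E"] by simp_all
    then show ?thesis using X by blast
  qed
  then have "bij_betw \<Phi> (car E) (car D)" by (rule S.bijective[OF genE gen])
  moreover have "nondegenerate E D \<Phi>"
  proof -
    have "x \<cdot>\<^bsub>D\<^esub> b \<in> {\<Phi> a \<cdot>\<^bsub>D\<^esub> b | a b. a \<in> car E \<and> b \<in> car D}" if "x \<in> car F" "b \<in> car D" for x b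
      using that Pi[OF that(1)] cstar_hom_simps(1)[OF iFh that(1)]
      by (intro CollectI exI[of _ "iF x"] exI[of _ b]) simp
    then have "{x \<cdot>\<^bsub>D\<^esub> b | x b. x \<in> car F \<and> b \<in> car D} \<subseteq> {\<Phi> a \<cdot>\<^bsub>D\<^esub> b | a b. a \<in> car E \<and> b \<in> car D}"
      by (auto simp del: mem_Collect_eq)
    then have "car D \<subseteq> closed_span D {\<Phi> a \<cdot>\<^bsub>D\<^esub> b | a b. a \<in> car E \<and> b \<in> car D}"
      using nd closed_span_mono unfolding nondegenerate_def by blast
    moreover have "closed_span D {\<Phi> a \<cdot>\<^bsub>D\<^esub> b | a b. a \<in> car E \<and> b \<in> car D} \<subseteq> car D"
      by (rule closed_span_car) auto
    ultimately show ?thesis by (simp add: nondegenerate_def)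
  qed
  then have "integrated_form F E iF v D (\<lambda>x. x) t \<Phi>"
    using Phi Pi Pv v by (simp add: integrated_form_def mult_ext_def)
  ultimately show ?thesis by blast
qed

end

theorem corollary4p2:
  fixes A :: "'a cstar" and \<alpha> L :: "'a \<Rightarrow> 'a"
    and T :: "'t cstar" and i :: "'a \<Rightarrow> 't" and s :: "'t mlt"
    and M :: "('a, 'm) hbimod" and q :: "'a \<Rightarrow> 'm" and \<psi> :: "'m \<Rightarrow> 't"
    and D :: "'d cstar" and Q :: "'t \<Rightarrow> 'd" and j :: "'a \<Rightarrow> 'd" and t :: "'d mlt"
    and \<gamma> :: "complex \<Rightarrow> 'd \<Rightarrow> 'd"
  assumes "exel_system A \<alpha> L"
    and "exel_crossed_product A \<alpha> L T i s M q \<psi> D Q j t"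
    and "dual_action A D j t \<gamma>"
  defines "F \<equiv> fixed_algebra D \<gamma>"
    and "p \<equiv> t \<cdot>\<^bsub>multiplier D\<^esub> star (multiplier D) t"
  shows "\<exists>\<beta>. cstar_hom F F \<beta> \<and> inj_on \<beta> (car F)
    \<and> (\<forall>a\<in>car A. \<forall>b\<in>car A. \<forall>k. \<beta> (core_elt D j t a k b) = core_elt D j t (\<alpha> a) (k + 1) (\<alpha> b))
    \<and> (\<exists>\<beta>'. strict_extension F \<beta> \<beta>' \<and> \<beta>' (mone F) = mult_restrict F p)
    \<and> \<beta> ` car F = {p \<triangleright> (x \<triangleleft> p) | x. x \<in> car F}
    \<and> stacey_rep F \<beta> D (\<lambda>x. x) t
    \<and> (\<forall>(E :: 'e cstar) iF v. stacey_crossed_product F \<beta> E iF v \<longrightarrow>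
         (\<exists>\<Phi>. integrated_form F E iF v D (\<lambda>x. x) t \<Phi> \<and> bij_betw \<Phi> (car E) (car D)))"
proof -
  have T: "cstar_algebra T" and rep: "toeplitz_rep A \<alpha> L T i s"
    and genT: "cstar_generated T (i ` car A \<union> (\<lambda>a. i a \<triangleleft> s) ` car A) = car T"
    and D: "cstar_algebra D" and Q: "cstar_hom T D Q" and Qs: "Q ` car T = car D"
    and j: "j = Q \<circ> i" and Qt: "mult_ext T D Q s t"
    using assms(2) by (auto simp: exel_crossed_product_def toeplitz_crossed_product_def is_quotient_def)
  interpret A: cstar_algebra A using assms(1) by (simp add: exel_system_def)
  have al: "cstar_hom A A \<alpha>" using assms(1) by (simp add: exel_system_def)
  interpret T: isometry_multiplier T s by (rule toeplitz_isometry(1)[OF assms(1) T rep])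
  interpret D: isometry_multiplier D t
    by (rule multiplier_surj(2)[OF T D Q Qs Qt T.isometry_multiplier_axioms])
  interpret D: gauge_isometry D t \<gamma>
  proof
    fix z :: complex assume z: "cmod z = 1"
    then have zs: "z \<in> sphere 0 1" by simp
    show "cstar_hom D D (\<gamma> z)" "\<gamma> z ` car D = car D"
      using assms(3) zs by (auto simp: dual_action_def circle_action_def bij_betw_def)
    fix x assume x: "x \<in> car D"
    have "mult_ext D D (\<gamma> z) t (scl (multiplier D) z t)"
      using assms(3) zs by (simp add: dual_action_def)
    then show "\<gamma> z (t \<triangleright> x) = scl D z (t \<triangleright> \<gamma> z x)"
      using x cstar_hom_simps(1)[OF \<open>cstar_hom D D (\<gamma> z)\<close>] by (simp add: mult_ext_def)
  qed
  have F: "F = D.F" and p: "p = D.p" by (simp_all add: F_def p_def D.p_def)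
  have i: "cstar_hom A T i" and ind: "nondegenerate A T i" using rep by (auto simp: toeplitz_rep_def)
  note ish = cstar_hom_simps[OF i] and as [simp] = cstar_hom_simps[OF al]
  have jh: "cstar_hom A D j"
    using i Q unfolding j cstar_hom_def linear_map_def by (auto simp: Pi_iff)
  note js [simp] = cstar_hom_simps[OF jh]
  have j0: "j a \<in> D.deg 0" if "a \<in> car A" for a
    using assms(3) that by (auto simp: D.deg_def dual_action_def)
  have tj: "t \<triangleright> j a = j (\<alpha> a) \<triangleleft> t" if a: "a \<in> car A" for a
  proof -
    have "t \<triangleright> Q (i a) = Q (s \<triangleright> i a)" using Qt ish(1)[OF a] by (simp add: mult_ext_def)
    also have "\<dots> = Q (i (\<alpha> a) \<triangleleft> s)" using toeplitz_isometry(2)[OF assms(1) T rep a] by simp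
    also have "\<dots> = Q (i (\<alpha> a)) \<triangleleft> t"
      by (rule multiplier_surj(1)[OF T D Q Qs Qt, symmetric]) (use ish a in simp)
    finally show ?thesis by (simp add: j)
  qed
  \<comment> \<open>The adjoint of the preceding relation, taken at \<open>star A a\<close>.\<close>
  have jt': "j a \<triangleleft> star (multiplier D) t = star (multiplier D) t \<triangleright> j (\<alpha> a)" if a: "a \<in> car A" for a
    using arg_cong[OF tj[of "star A a"], of "star D"] a by simp
  have jnd: "nondegenerate A D j"
    using nondegenerate_surj[OF T D Q Qs _ ind] ish(1) by (simp add: j comp_def Pi_iff)
  have nd: "nondegenerate D.F D (\<lambda>x. x)"
  proof -
    have "{j a \<cdot>\<^bsub>D\<^esub> b | a b. a \<in> car A \<and> b \<in> car D} \<subseteq> {x \<cdot>\<^bsub>D\<^esub> b | x b. x \<in> car D.F \<and> b \<in> car D}"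
      using j0 D.car_F by blast
    then have "car D \<subseteq> closed_span D {x \<cdot>\<^bsub>D\<^esub> b | x b. x \<in> car D.F \<and> b \<in> car D}"
      using jnd D.closed_span_mono unfolding nondegenerate_def by blast
    moreover have "closed_span D {x \<cdot>\<^bsub>D\<^esub> b | x b. x \<in> car D.F \<and> b \<in> car D} \<subseteq> car D"
      by (rule D.closed_span_car) (auto simp: D.car_F D.degD)
    ultimately show ?thesis by (simp add: nondegenerate_def)
  qed
  \<comment> \<open>The outer \<open>t\<close> moves right past \<open>j a\<close> and the outer
    adjoint moves left past \<open>j b\<close>; each applies \<open>\<alpha>\<close> on its way and
    raises its exponent by one.\<close>
  have core: "D.\<beta> (core_elt D j t a k b) = core_elt D j t (\<alpha> a) (k + 1) (\<alpha> b)"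
    if a: "a \<in> car A" and b: "b \<in> car A" for a b k
  proof -
    let ?t' = "star (multiplier D) t"
    have "D.\<beta> (core_elt D j t a k b)
        = (j (\<alpha> a) \<triangleleft> t) \<cdot>\<^bsub>D\<^esub> (mpow D t k \<triangleright> (mpow D ?t' k \<triangleright> (j b \<triangleleft> ?t')))"
      using a b tj[OF a] by (simp add: D.\<beta>_def core_elt_def)
    also have "\<dots> = j (\<alpha> a) \<cdot>\<^bsub>D\<^esub> (t \<triangleright> (mpow D t k \<triangleright> (mpow D ?t' k \<triangleright> (?t' \<triangleright> j (\<alpha> b)))))"
      using a b jt'[OF b] by simp
    also have "\<dots> = core_elt D j t (\<alpha> a) (k + 1) (\<alpha> b)"
      using a b D.mpow_Suc_left[of t "mpow D ?t' k \<triangleright> (?t' \<triangleright> j (\<alpha> b))" k] by (simp add: core_elt_def)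
    finally show ?thesis .
  qed
  have "cstar_generated D (Q ` (i ` car A \<union> (\<lambda>a. i a \<triangleleft> s) ` car A)) = car D"
    by (rule cstar_generated_surj[OF T D Q Qs _ genT]) (use ish in auto)
  \<comment> \<open>The generators become \<open>j a\<close>, fixed by the action, and
    \<open>j a \<triangleleft> t\<close>.\<close>
  moreover have "Q ` (i ` car A \<union> (\<lambda>a. i a \<triangleleft> s) ` car A) \<subseteq> D.deg 0 \<union> (\<lambda>c. c \<triangleleft> t) ` D.deg 0"
    using j0 multiplier_surj(1)[OF T D Q Qs Qt, symmetric] ish(1) by (auto simp: j)
  ultimately have iso: "\<exists>\<Phi>. integrated_form F E iF v D (\<lambda>x. x) t \<Phi> \<and> bij_betw \<Phi> (car E) (car D)"
    if "stacey_crossed_product F D.\<beta> E iF v" for E :: "'e cstar" and iF v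
    using D.stacey_isomorphism[OF nd] that unfolding F by blast
  have "stacey_rep D.F D.\<beta> D (\<lambda>x. x) t"
    \<comment> \<open>The surjection is the identity of \<open>D\<close>.\<close>
    by (rule D.stacey_rep_surj[OF nd D]) (simp_all add: cstar_hom_def linear_map_def mult_ext_def)
  then show ?thesis
    using D.beta_hom D.beta_inj core D.beta_extension D.beta_range iso unfolding F p
    by (intro exI[of _ D.\<beta>]) blast
qed

end
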